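(* Consider a family of causal lattices $\mathcal{L}$ of growing linear size $L$ on the $d$-dimensional torus, and define the toric code of type $k\in\{2,\ldots,d-1\}$ on $\mathcal{L}$. Then there exists a constant $p^*_{\mathrm{th}}>0$ such that for any phase-flip error rate $p<p^*_{\mathrm{th}}$ the failure probability of the Sweep Decoder for perfect syndrome extraction goes to zero as $L\to\infty$. Here the error is a random set $\epsilon\subseteq\Delta_k(\mathcal{L})$ containing each $k$-simplex independently with probability $p$; the decoder is given the exact syndrome $\sigma=\partial_k\epsilon$; and it fails if its output is $\rho=\texttt{FAIL}$ or if $\rho+\epsilon\notin\operatorname{im}\partial_{k+1}$.
   Context: **Lattices and chains.** A lattice $\mathcal{L}$ on the $d$-dimensional torus is built of simplices: $d$-simplices are attached to one another along their $(d-1)$-dimensional faces. Its linear size $L$ is the length of the shortest non-contractible path in $\mathcal{L}$. $\Delta_i(\mathcal{L})$ is the set of $i$-simplices of $\mathcal{L}$, and $\mathrm{St}_k(v)$ is the set of $k$-simplices containing the vertex $v$. $C_i$ is the $\mathbb{F}_2$-vector space with basis $\Delta_i(\mathcal{L})$, whose vectors are identified with subsets of $\Delta_i(\mathcal{L})$, and $\partial_i:C_i\to C_{i-1}$ is the linear map sending an $i$-simplex to the sum of the $(i-1)$-simplices contained in it. For a collection of simplices $\sigma$, its restriction $\sigma|_v$ is the set of simplices of $\sigma$ containing $v$. **Causal structure.** The sweep direction $\vec t\in\mathbb{R}^d$ is a unit vector not perpendicular to any edge of $\mathcal{L}$. A path between two vertices is a sequence of consecutive edges, and its length is its number of edges.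 A path is causal if the inner products of $\vec t$ with its successive edge vectors all have the same sign. The partial order $\preceq$ on vertices is: $u\preceq w$ iff there is a causal path from $u$ to $w$ all of whose edges, directed from $u$ to $w$, have positive inner product with $\vec t$ (and $v\preceq v$). For a simplex $\kappa$, $v\preceq\kappa$ (resp. $\kappa\preceq v$) means $v\preceq u$ (resp. $u\preceq v$) for all vertices $u$ of $\kappa$. The future and past of $v$ are $\uparrow(v)=\{\kappa: v\preceq\kappa\}$ and $\downarrow(v)=\{\kappa:\kappa\preceq v\}$, with $\kappa$ ranging over simplices of all dimensions. For a set of vertices $V$, $\inf V$ and $\sup V$ are its greatest lower bound and least upper bound for $\preceq$, and its causal diamond is $\Diamond(V)=\uparrow(\inf V)\cap\downarrow(\sup V)$; for a collection of simplices these refer to its set of vertices. On the torus, the partial order and the derived notions are well defined only within local regions of $\mathcal{L}$, i.e. regions with diameter at most some fraction of the linear size of $\mathcal{L}$. **Distances.** $d(u,v)$ is the length of a shortest path between $u$ and $v$; the distance between sets of vertices (or simplices) is the minimum over their vertices; $\mathrm{diam}(V)=\max_{u,v\in V}d(u,v)$; $B_v(r)$ is the set of all simplices $\kappa$ (of all dimensions) with $d(v,\kappa)<r$. **Causal lattices.** A family of lattices of growing linear size $L$ is causal if, with constants $c_B,c_D,c_P$ not depending on $L$: (i) for any subset of vertices $V$ within a local region of $\mathcal{L}$ there exists a unique causal diamond $\Diamond(V)$; (ii) for any vertex $v$ and any $\sigma\in\operatorname{im}\partial_k$ with $\sigma|_v\subset\uparrow(v)$, there exists $\varphi(v)\subseteq\mathrm{St}_k(v)\cap\uparrow(v)$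 satisfying $(\partial_k\varphi(v))|_v=\sigma|_v$ and $\Diamond(\varphi(v))=\Diamond(\sigma|_v)$; (iii) for any ball $B_v(R)$ within a local region of $\mathcal{L}$ and radius $r<R$ there is a cover $\bigcup_{u\in U}B_u(r)\supset B_v(R)$, with $U$ a set of vertices, such that $|U|\le c_B(R/r)^d$; (iv) for any subset of vertices $V$ within a local region of $\mathcal{L}$, $\mathrm{diam}(\Diamond(V))\le c_D\,\mathrm{diam}(V)$; (v) for any pair of vertices $u\preceq v$, the maximal length of a causal path between $u$ and $v$ is at most $c_P\,d(u,v)$. **Toric code of type $k$.** Qubits are placed on the $k$-simplices of $\mathcal{L}$; $X$- and $Z$-stabilizers are associated with $(k-1)$- and $(k+1)$-simplices, respectively. A set $\epsilon\subseteq\Delta_k(\mathcal{L})$ of qubits affected by Pauli $Z$ (phase-flip) errors has $X$-syndrome $\sigma=\partial_k\epsilon$. $Z$-stabilizers correspond to the elements of $\operatorname{im}\partial_{k+1}$ and $Z$-logical operators to those of $\ker\partial_k$. **Sweep Rule.** Given $\sigma\in\operatorname{im}\partial_k$, a vertex $v$ is trailing if $\sigma|_v$ is non-empty and $\sigma|_v\subset\uparrow(v)$. For every trailing $v$ the rule finds a set $\varphi(v)\subseteq\mathrm{St}_k(v)\cap\uparrow(v)$ such that $(\partial_k\varphi(v))|_v=\sigma|_v$ and $\Diamond(\partial_k\varphi(v))=\Diamond(\sigma|_v)$, and flips the $k$-simplices in $\varphi(v)$ (the choice of $\varphi(v)$ need not be unique; different ways of choosing give a family of rules). Nothing is done at non-trailing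 vertices. Applied simultaneously to every vertex, it yields $\rho(\sigma)=\sum_{v\ \mathrm{trailing}}\varphi(v)\in C_k$. **Sweep Decoder.** Input: $\sigma\in\operatorname{im}\partial_k$. Set $T=1$, $\sigma^{(1)}=\sigma$. Unless $T>T_{\max}$ or $\sigma^{(T)}=0$, repeat: apply the Sweep Rule simultaneously to every vertex to get $\rho^{(T)}=\rho(\sigma^{(T)})$, put $\sigma^{(T+1)}=\sigma^{(T)}+\partial_k\rho^{(T)}$, and increase $T$ by $1$. At the end, if $T\le T_{\max}$ output $\rho=\sum_{i=1}^{T-1}\rho^{(i)}$; otherwise output $\rho=\texttt{FAIL}$. Here $T_{\max}$ is of the order of the linear size $L$; specifically $T_{\max}=c_Dc_PQ^{m^*-1}+1=O(L)$ with $Q=6c_Dc_P$ and $m^*=\lceil\log_Q(L/c_D)\rceil$.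
   Formalization: It is additionally assumed that the number of vertices of the lattice is at most polynomial in the linear size L; without this the claim fails, e.g. on a torus that is exponentially-exponentially long in one direction while its shortest non-contractible path has length L. *)

theory Defs
  imports
    "HOL-Probability.Probability"
    "HOL-Library.While_Combinator"
begin

text \<open>
  A lattice on the flat torus \<open>\<real>\<^sup>d / \<Lambda>\<close> is given by its lift to the universal cover \<open>\<real>\<^sup>d\<close>: a
  geometric simplicial complex that triangulates \<open>\<real>\<^sup>d\<close> and is invariant under the translation
  group \<open>\<Lambda>\<close>, which is generated by the columns of the matrix \<open>periods\<close>.  A simplex of the lift is
  represented by its set of vertices, so that the vertex set of a collection \<open>S\<close> of simplices is
  \<open>\<Union>S\<close>.  A simplex of the lattice itself is a \<open>\<Lambda>\<close>-orbit of simplices of the lift.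
\<close>

record ('d::finite) torus_lattice =
  periods :: "real ^ 'd ^ 'd"
  cells :: "(real ^ 'd) set set"
  sweep_dir :: "real ^ 'd"

definition shifts :: "'d::finite torus_lattice \<Rightarrow> (real ^ 'd) set" where
  "shifts \<L> = {periods \<L> *v z |z. \<forall>i. z $ i \<in> \<int>}"

definition orbit :: "'d::finite torus_lattice \<Rightarrow> (real ^ 'd) set \<Rightarrow> (real ^ 'd) set set" where
  "orbit \<L> \<kappa> = (\<lambda>a. (+) a ` \<kappa>) ` shifts \<L>"

text \<open>\<open>simplices \<L> i\<close> is \<open>\<Delta>\<^sub>i(\<L>)\<close>; \<open>verts \<L>\<close> are the vertices of the lift.\<close>

definition simplices :: "'d::finite torus_lattice \<Rightarrow> nat \<Rightarrow> (real ^ 'd) set set set" where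
  "simplices \<L> i = orbit \<L> ` {\<kappa> \<in> cells \<L>. card \<kappa> = i + 1}"

definition verts :: "'d::finite torus_lattice \<Rightarrow> (real ^ 'd) set" where
  "verts \<L> = {v. {v} \<in> cells \<L>}"

definition adjacent :: "'d::finite torus_lattice \<Rightarrow> real ^ 'd \<Rightarrow> real ^ 'd \<Rightarrow> bool" where
  "adjacent \<L> u v \<longleftrightarrow> u \<noteq> v \<and> {u, v} \<in> cells \<L>"

definition valid_lattice :: "'d::finite torus_lattice \<Rightarrow> bool" where
  "valid_lattice \<L> \<longleftrightarrow>
     invertible (periods \<L>) \<and>
     (\<forall>\<kappa>\<in>cells \<L>. finite \<kappa> \<and> \<kappa> \<noteq> {} \<and> \<not> affine_dependent \<kappa>) \<and>
     (\<forall>\<kappa>\<in>cells \<L>. \<forall>\<tau>. \<tau> \<subseteq> \<kappa> \<and> \<tau> \<noteq> {} \<longrightarrow> \<tau> \<in> cells \<L>) \<and>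
     (\<forall>\<kappa>\<in>cells \<L>. \<forall>\<tau>\<in>cells \<L>. convex hull \<kappa> \<inter> convex hull \<tau> = convex hull (\<kappa> \<inter> \<tau>)) \<and>
     (\<forall>\<kappa>\<in>cells \<L>. \<exists>\<tau>\<in>cells \<L>. \<kappa> \<subseteq> \<tau> \<and> card \<tau> = CARD('d) + 1) \<and>
     (\<Union>\<kappa>\<in>cells \<L>. convex hull \<kappa>) = UNIV \<and>
     (\<forall>\<kappa>\<in>cells \<L>. orbit \<L> \<kappa> \<subseteq> cells \<L>) \<and>
     finite (orbit \<L> ` cells \<L>) \<and>
     norm (sweep_dir \<L>) = 1 \<and>
     (\<forall>u v. adjacent \<L> u v \<longrightarrow> sweep_dir \<L> \<bullet> (v - u) \<noteq> 0)"


section \<open>Paths, linear size and distances\<close>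

definition edge_path :: "'d::finite torus_lattice \<Rightarrow> (real ^ 'd) list \<Rightarrow> bool" where
  "edge_path \<L> p \<longleftrightarrow> p \<noteq> [] \<and> set p \<subseteq> verts \<L> \<and> successively (adjacent \<L>) p"

definition path_length :: "'a list \<Rightarrow> nat" where
  "path_length p = length p - 1"

text \<open>
  The torus is realised as a product of unit circles; \<open>torus_proj \<L>\<close> is the covering map whose
  fibres are the cosets of \<open>\<Lambda>\<close>.  A closed path of the lattice is given by a lift to \<open>\<real>\<^sup>d\<close>.
\<close>

definition torus :: "(complex ^ 'd::finite) set" where
  "torus = {z. \<forall>i. cmod (z $ i) = 1}"

definition torus_proj :: "'d::finite torus_lattice \<Rightarrow> real ^ 'd \<Rightarrow> complex ^ 'd" where
  "torus_proj \<L> x = (\<chi> i. cis (2 * pi * (matrix_inv (periods \<L>) *v x) $ i))"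

fun polygonal_path :: "'a::real_normed_vector list \<Rightarrow> real \<Rightarrow> 'a" where
  "polygonal_path [] = linepath 0 0"
| "polygonal_path [x] = linepath x x"
| "polygonal_path (x # y # p) = linepath x y +++ polygonal_path (y # p)"

definition noncontractible :: "'d::finite torus_lattice \<Rightarrow> (real ^ 'd) list \<Rightarrow> bool" where
  "noncontractible \<L> p \<longleftrightarrow>
     edge_path \<L> p \<and> torus_proj \<L> (hd p) = torus_proj \<L> (last p) \<and>
     \<not> (\<exists>c. homotopic_loops torus (torus_proj \<L> \<circ> polygonal_path p) (linepath c c))"

definition linear_size :: "'d::finite torus_lattice \<Rightarrow> nat" where
  "linear_size \<L> = Inf {path_length p |p. noncontractible \<L> p}"

text \<open>
  Distances, the partial order and the causal diamonds are taken in the lift, where they are well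
  defined.  A region of the torus of diameter less than a third of the linear size lifts
  isometrically.
  The infimum in \<open>gdist\<close> is over a nonempty set, because the 1-skeleton of a triangulation of
  \<open>\<real>\<^sup>d\<close> is connected.
\<close>

definition gdist :: "'d::finite torus_lattice \<Rightarrow> real ^ 'd \<Rightarrow> real ^ 'd \<Rightarrow> nat" where
  "gdist \<L> u v = Inf {path_length p |p. edge_path \<L> p \<and> hd p = u \<and> last p = v}"

definition diam :: "'d::finite torus_lattice \<Rightarrow> (real ^ 'd) set \<Rightarrow> enat" where
  "diam \<L> V = (SUP u\<in>V. SUP v\<in>V. enat (gdist \<L> u v))"

definition gball :: "'d::finite torus_lattice \<Rightarrow> real ^ 'd \<Rightarrow> real \<Rightarrow> (real ^ 'd) set set" where
  "gball \<L> v r = {\<kappa> \<in> cells \<L>. real (MIN u\<in>\<kappa>. gdist \<L> v u) < r}"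

definition local_region :: "'d::finite torus_lattice \<Rightarrow> real \<Rightarrow> (real ^ 'd) set \<Rightarrow> bool" where
  "local_region \<L> l V \<longleftrightarrow>
     V \<subseteq> verts \<L> \<and> ereal_of_enat (diam \<L> V) \<le> ereal (l * real (linear_size \<L>))"


section \<open>Causal structure\<close>

definition causal_path :: "'d::finite torus_lattice \<Rightarrow> (real ^ 'd) list \<Rightarrow> bool" where
  "causal_path \<L> p \<longleftrightarrow> edge_path \<L> p \<and>
     (successively (\<lambda>x y. sweep_dir \<L> \<bullet> (y - x) > 0) p \<or>
      successively (\<lambda>x y. sweep_dir \<L> \<bullet> (y - x) < 0) p)"

definition precedes :: "'d::finite torus_lattice \<Rightarrow> real ^ 'd \<Rightarrow> real ^ 'd \<Rightarrow> bool" where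
  "precedes \<L> u w \<longleftrightarrow> (\<exists>p. causal_path \<L> p \<and> hd p = u \<and> last p = w \<and>
     successively (\<lambda>x y. sweep_dir \<L> \<bullet> (y - x) > 0) p)"

definition future :: "'d::finite torus_lattice \<Rightarrow> real ^ 'd \<Rightarrow> (real ^ 'd) set set" where
  "future \<L> v = {\<kappa> \<in> cells \<L>. \<forall>u\<in>\<kappa>. precedes \<L> v u}"

definition past :: "'d::finite torus_lattice \<Rightarrow> real ^ 'd \<Rightarrow> (real ^ 'd) set set" where
  "past \<L> v = {\<kappa> \<in> cells \<L>. \<forall>u\<in>\<kappa>. precedes \<L> u v}"

definition is_inf :: "'d::finite torus_lattice \<Rightarrow> (real ^ 'd) set \<Rightarrow> real ^ 'd \<Rightarrow> bool" where
  "is_inf \<L> V m \<longleftrightarrow> m \<in> verts \<L> \<and> (\<forall>v\<in>V. precedes \<L> m v) \<and>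
     (\<forall>x\<in>verts \<L>. (\<forall>v\<in>V. precedes \<L> x v) \<longrightarrow> precedes \<L> x m)"

definition is_sup :: "'d::finite torus_lattice \<Rightarrow> (real ^ 'd) set \<Rightarrow> real ^ 'd \<Rightarrow> bool" where
  "is_sup \<L> V m \<longleftrightarrow> m \<in> verts \<L> \<and> (\<forall>v\<in>V. precedes \<L> v m) \<and>
     (\<forall>x\<in>verts \<L>. (\<forall>v\<in>V. precedes \<L> v x) \<longrightarrow> precedes \<L> m x)"

definition diamond :: "'d::finite torus_lattice \<Rightarrow> (real ^ 'd) set \<Rightarrow> (real ^ 'd) set set" where
  "diamond \<L> V = future \<L> (THE m. is_inf \<L> V m) \<inter> past \<L> (THE m. is_sup \<L> V m)"


section \<open>Chains\<close>

text \<open>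
  A vector of \<open>C\<^sub>i\<close>, that is, a subset of \<open>\<Delta>\<^sub>i(\<L>)\<close>, is represented by its full preimage in the
  lift, a \<open>\<Lambda>\<close>-invariant set of \<open>i\<close>-simplices.  Addition is symmetric difference.  The boundary
  operator also applies to finite, non-invariant sets of simplices of the lift, which represent
  chains supported in a local region.
\<close>

definition chains :: "'d::finite torus_lattice \<Rightarrow> nat \<Rightarrow> (real ^ 'd) set set set" where
  "chains \<L> i = {\<Union>S |S. S \<subseteq> simplices \<L> i}"

definition boundary ::
  "'d::finite torus_lattice \<Rightarrow> nat \<Rightarrow> (real ^ 'd) set set \<Rightarrow> (real ^ 'd) set set" where
  "boundary \<L> i c = {\<tau> \<in> cells \<L>. card \<tau> = i \<and> odd (card {\<kappa> \<in> c. \<tau> \<subseteq> \<kappa>})}"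

definition restr :: "'a set set \<Rightarrow> 'a \<Rightarrow> 'a set set" where
  "restr \<sigma> v = {\<kappa> \<in> \<sigma>. v \<in> \<kappa>}"

definition star :: "'d::finite torus_lattice \<Rightarrow> nat \<Rightarrow> real ^ 'd \<Rightarrow> (real ^ 'd) set set" where
  "star \<L> i v = {\<kappa> \<in> cells \<L>. card \<kappa> = i + 1 \<and> v \<in> \<kappa>}"


section \<open>Causal lattices\<close>

text \<open>
  The number \<open>l\<close> is the fraction of the linear size that bounds the diameter of local regions;
  decreasing it only weakens the conditions.  The lifting condition (the second one) is required
  only for the type \<open>k\<close> of the code.
\<close>

definition causal ::
  "'d::finite torus_lattice \<Rightarrow> nat \<Rightarrow> real \<Rightarrow> real \<Rightarrow> real \<Rightarrow> real \<Rightarrow> bool" where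
  "causal \<L> k l c\<^sub>B c\<^sub>D c\<^sub>P \<longleftrightarrow>
     (\<forall>V. V \<noteq> {} \<and> local_region \<L> l V \<longrightarrow> (\<exists>!m. is_inf \<L> V m) \<and> (\<exists>!m. is_sup \<L> V m)) \<and>
     (\<forall>v\<in>verts \<L>. \<forall>\<sigma>\<in>boundary \<L> k ` chains \<L> k. restr \<sigma> v \<subseteq> future \<L> v \<longrightarrow>
        (\<exists>\<phi>. \<phi> \<subseteq> star \<L> k v \<inter> future \<L> v \<and>
             restr (boundary \<L> k \<phi>) v = restr \<sigma> v \<and>
             diamond \<L> (\<Union>\<phi>) = diamond \<L> (\<Union>(restr \<sigma> v)))) \<and>
     (\<forall>v\<in>verts \<L>. \<forall>R r. 0 < r \<and> r < R \<and> local_region \<L> l (\<Union>(gball \<L> v R)) \<longrightarrow>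
        (\<exists>U. U \<subseteq> verts \<L> \<and> finite U \<and> gball \<L> v R \<subseteq> (\<Union>u\<in>U. gball \<L> u r) \<and>
             real (card U) \<le> c\<^sub>B * (R / r) ^ CARD('d))) \<and>
     (\<forall>V. V \<noteq> {} \<and> local_region \<L> l V \<longrightarrow>
        ereal_of_enat (diam \<L> (\<Union>(diamond \<L> V))) \<le> ereal c\<^sub>D * ereal_of_enat (diam \<L> V)) \<and>
     (\<forall>u v p. local_region \<L> l {u, v} \<and> precedes \<L> u v \<and>
        causal_path \<L> p \<and> hd p = u \<and> last p = v \<longrightarrow>
        real (path_length p) \<le> c\<^sub>P * real (gdist \<L> u v))"


section \<open>Sweep Rule and Sweep Decoder\<close>

definition trailing :: "'d::finite torus_lattice \<Rightarrow> (real ^ 'd) set set \<Rightarrow> real ^ 'd \<Rightarrow> bool" where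
  "trailing \<L> \<sigma> v \<longleftrightarrow> v \<in> verts \<L> \<and> restr \<sigma> v \<noteq> {} \<and> restr \<sigma> v \<subseteq> future \<L> v"

text \<open>
  \<open>\<phi> \<sigma> v\<close> is the set flipped at \<open>v\<close>.  The last conjunct says that the choice is made at the
  vertices of the torus, that is, it is the same at all lifts of a vertex.
\<close>

definition sweep_rule :: "'d::finite torus_lattice \<Rightarrow> nat \<Rightarrow>
    ((real ^ 'd) set set \<Rightarrow> real ^ 'd \<Rightarrow> (real ^ 'd) set set) \<Rightarrow> bool" where
  "sweep_rule \<L> k \<phi> \<longleftrightarrow>
     (\<forall>\<sigma>\<in>boundary \<L> k ` chains \<L> k. \<forall>v. trailing \<L> \<sigma> v \<longrightarrow>
        \<phi> \<sigma> v \<subseteq> star \<L> k v \<inter> future \<L> v \<and>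
        restr (boundary \<L> k (\<phi> \<sigma> v)) v = restr \<sigma> v \<and>
        diamond \<L> (\<Union>(boundary \<L> k (\<phi> \<sigma> v))) = diamond \<L> (\<Union>(restr \<sigma> v)) \<and>
        (\<forall>a\<in>shifts \<L>. \<phi> \<sigma> (a + v) = (\<lambda>\<kappa>. (+) a ` \<kappa>) ` \<phi> \<sigma> v))"

definition sweep :: "'d::finite torus_lattice \<Rightarrow>
    ((real ^ 'd) set set \<Rightarrow> real ^ 'd \<Rightarrow> (real ^ 'd) set set) \<Rightarrow>
    (real ^ 'd) set set \<Rightarrow> (real ^ 'd) set set" where
  "sweep \<L> \<phi> \<sigma> = {\<kappa>. odd (card {v. trailing \<L> \<sigma> v \<and> \<kappa> \<in> \<phi> \<sigma> v})}"

definition T_max :: "real \<Rightarrow> real \<Rightarrow> nat \<Rightarrow> real" where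
  "T_max c\<^sub>D c\<^sub>P L =
     (let Q = 6 * c\<^sub>D * c\<^sub>P; m = \<lceil>log Q (real L / c\<^sub>D)\<rceil> in c\<^sub>D * c\<^sub>P * Q powi (m - 1) + 1)"

text \<open>\<open>None\<close> stands for \<open>FAIL\<close>.\<close>

definition sweep_decoder :: "'d::finite torus_lattice \<Rightarrow> nat \<Rightarrow>
    ((real ^ 'd) set set \<Rightarrow> real ^ 'd \<Rightarrow> (real ^ 'd) set set) \<Rightarrow> real \<Rightarrow>
    (real ^ 'd) set set \<Rightarrow> (real ^ 'd) set set option" where
  "sweep_decoder \<L> k \<phi> Tm \<sigma>\<^sub>1 =
     (let (T, \<sigma>, \<rho>) =
        while (\<lambda>(T, \<sigma>, \<rho>). \<not> (real T > Tm \<or> \<sigma> = {}))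
          (\<lambda>(T, \<sigma>, \<rho>). let \<rho>\<^sub>T = sweep \<L> \<phi> \<sigma> in
             (T + 1, sym_diff \<sigma> (boundary \<L> k \<rho>\<^sub>T), sym_diff \<rho> \<rho>\<^sub>T))
          (1 :: nat, \<sigma>\<^sub>1, {})
      in if real T \<le> Tm then Some \<rho> else None)"

definition decoder_fails :: "'d::finite torus_lattice \<Rightarrow> nat \<Rightarrow>
    ((real ^ 'd) set set \<Rightarrow> real ^ 'd \<Rightarrow> (real ^ 'd) set set) \<Rightarrow> real \<Rightarrow>
    (real ^ 'd) set set \<Rightarrow> bool" where
  "decoder_fails \<L> k \<phi> Tm \<epsilon> \<longleftrightarrow>
     (case sweep_decoder \<L> k \<phi> Tm (boundary \<L> k \<epsilon>) of
        None \<Rightarrow> True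
      | Some \<rho> \<Rightarrow> sym_diff \<rho> \<epsilon> \<notin> boundary \<L> (k + 1) ` chains \<L> (k + 1))"

definition failure_prob :: "'d::finite torus_lattice \<Rightarrow> nat \<Rightarrow>
    ((real ^ 'd) set set \<Rightarrow> real ^ 'd \<Rightarrow> (real ^ 'd) set set) \<Rightarrow> real \<Rightarrow> real \<Rightarrow> real" where
  "failure_prob \<L> k \<phi> Tm p =
     measure_pmf.prob (Pi_pmf (simplices \<L> k) False (\<lambda>_. bernoulli_pmf p))
       {e. decoder_fails \<L> k \<phi> Tm (\<Union>{q \<in> simplices \<L> k. e q})}"

end

theory Submission
  imports Defs "HOL-Complex_Analysis.Winding_Numbers"
begin

text \<open>
  The error is decomposed into clusters on the scales \<open>Q ^ i\<close>: at each scale, the points that have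
  no other point at intermediate distance form clusters that are far from everything else, and are
  removed.  A point that survives \<open>m\<close> such rounds lies in a binary tree of \<open>2 ^ m\<close> errors, and since
  there are at most \<open>\<mu> ^ (2 ^ m)\<close> such trees at a given point, this is unlikely for \<open>p < 1 / (2 * \<mu>)\<close>.

  If no point survives, each cluster evolves independently of the others.  Its syndrome stays below
  the supremum of the cluster, and after \<open>T\<close> steps each of its vertices is reached from the infimum by
  an ascending path of length \<open>T\<close>, so that the syndrome vanishes after a time proportional to the
  diameter, before it could meet the syndrome of another cluster.  What remains of the
  cluster and its correction is a finite cycle in a triangulation of \<open>\<real>\<^sup>d\<close>, which bounds: one cones
  it off, subdivides the cone finely and maps it back by a simplicial approximation of the identity.
\<close>

section \<open>Sums modulo 2 and finite cycles\<close>

text \<open>The decoder acts everywhere at once for a time of order \<open>L\<close>, so the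
  obstacle is to show that distant parts of the error do not influence each other. The causal
  structure supplies a clock: the bounds on diamonds and on causal paths limit an ascending path
  between the infimum and supremum of a cluster of diameter \<Delta> to length
  \<open>c\<^sub>P * c\<^sub>D * \<Delta>\<close>. This is a lifetime for the syndrome of the
  cluster, and it suffices that two clusters are farther apart than twice the smaller lifetime.
  Clusters of level \<open>i\<close> have diameter at most \<open>4 * Q ^ i\<close> and distance
  above \<open>(Q - 3) * Q ^ i\<close> from all others of level at least \<open>i\<close>, so
  \<open>Q\<close> only has to be large compared with \<open>8 * c\<^sub>P * c\<^sub>D\<close>. It
  is not the \<open>Q\<close> of \<open>T_max\<close>, of which only the lower bound
  \<open>L / (6 * c\<^sub>D) + 1\<close> enters. Levels are used up to \<open>Q ^ m\<close> of order
  \<open>L\<close>, so the number of trees is paid for by a probability doubly exponential in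
  \<open>m\<close>. In the lift a cluster is finite and the homology of the torus never enters; the
  price is that sums run over infinitely many translates and must be controlled by local
  finiteness.\<close>

text \<open>
  The sum modulo 2 of the sets \<open>f x\<close>.  An element of infinitely many of them does not belong to it.
\<close>

definition msum :: "('a \<Rightarrow> 'b set) \<Rightarrow> 'a set \<Rightarrow> 'b set" where
  "msum f A = {y. odd (card {x \<in> A. y \<in> f x})}"

lemma msum_cong [fundef_cong]: "A = B \<Longrightarrow> (\<And>x. x \<in> B \<Longrightarrow> f x = g x) \<Longrightarrow> msum f A = msum g B"
proof -
  assume 1: "A = B" and 2: "\<And>x. x \<in> B \<Longrightarrow> f x = g x"
  then have "{x \<in> A. y \<in> f x} = {x \<in> B. y \<in> g x}" for y by blast
  then show "msum f A = msum g B" by (simp add: msum_def)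
qed

lemma msum_empty [simp]: "msum f {} = {}"
  by (simp add: msum_def)

lemma msum_singleton [simp]: "msum f {x} = f x"
proof -
  have "{x' \<in> {x}. y \<in> f x'} = (if y \<in> f x then {x} else {})" for y by auto
  then show ?thesis by (auto simp: msum_def)
qed

lemma msum_subset: "msum f A \<subseteq> (\<Union>x\<in>A. f x)"
proof
  fix y assume "y \<in> msum f A"
  then have "odd (card {x \<in> A. y \<in> f x})" by (simp add: msum_def)
  then have "{x \<in> A. y \<in> f x} \<noteq> {}" by (rule odd_card_imp_not_empty)
  then show "y \<in> (\<Union>x\<in>A. f x)" by blast
qed

lemma msumE: assumes "y \<in> msum f A" obtains x where "x \<in> A" "y \<in> f x"
  using subsetD[OF msum_subset assms] that by auto

lemma odd_card_sym_diff:
  assumes "finite A" "finite B"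
  shows "odd (card (sym_diff A B)) \<longleftrightarrow> odd (card A) \<noteq> odd (card B)"
proof -
  have "card (sym_diff A B) = card (A - B) + card (B - A)"
    using assms by (intro card_Un_disjoint) auto
  moreover have "card A = card (A - B) + card (A \<inter> B)"
    by (subst card_Un_disjoint[symmetric]) (use assms in \<open>auto intro: arg_cong[where f = card]\<close>)
  moreover have "card B = card (B - A) + card (A \<inter> B)"
    by (subst card_Un_disjoint[symmetric]) (use assms in \<open>auto intro: arg_cong[where f = card]\<close>)
  ultimately show ?thesis by presburger
qed

lemma msum_sym_diff:
  assumes "\<And>y. finite {x \<in> A. y \<in> f x}" "\<And>y. finite {x \<in> B. y \<in> f x}"
  shows "msum f (sym_diff A B) = sym_diff (msum f A) (msum f B)"
proof -
  have "{x \<in> sym_diff A B. y \<in> f x} = sym_diff {x \<in> A. y \<in> f x} {x \<in> B. y \<in> f x}" for y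
    by blast
  then show ?thesis
    unfolding msum_def using odd_card_sym_diff[OF assms] by auto
qed

lemma msum_fun_sym_diff:
  assumes "\<And>y. finite {x \<in> A. y \<in> f x}" "\<And>y. finite {x \<in> A. y \<in> g x}"
  shows "msum (\<lambda>x. sym_diff (f x) (g x)) A = sym_diff (msum f A) (msum g A)"
proof -
  have "{x \<in> A. y \<in> sym_diff (f x) (g x)} = sym_diff {x \<in> A. y \<in> f x} {x \<in> A. y \<in> g x}" for y
    by blast
  then show ?thesis
    unfolding msum_def using odd_card_sym_diff[OF assms] by auto
qed

text \<open>Grouping the pairs by their second component, only fibres of odd size contribute to the
  parity. Used for a relation and its converse, this interchanges two summations modulo 2.\<close>

lemma odd_card_fibres:
  assumes "finite P"
  shows "odd (card P) \<longleftrightarrow> odd (card {z. odd (card {x. (x, z) \<in> P})})"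
proof -
  have "card P = (\<Sum>z\<in>snd ` P. card {p \<in> P. snd p = z})"
    using sum.image_gen[OF assms, of "\<lambda>_. 1::nat" snd] by simp
  also have "\<dots> = (\<Sum>z\<in>snd ` P. card {x. (x, z) \<in> P})"
  proof (rule sum.cong[OF refl])
    fix z
    have "{p \<in> P. snd p = z} = (\<lambda>x. (x, z)) ` {x. (x, z) \<in> P}" by force
    then show "card {p \<in> P. snd p = z} = card {x. (x, z) \<in> P}"
      by (simp add: card_image inj_on_def)
  qed
  finally have "odd (card P) \<longleftrightarrow> odd (card {z \<in> snd ` P. odd (card {x. (x, z) \<in> P})})"
    using assms by (simp add: even_sum_iff)
  also have "{z \<in> snd ` P. odd (card {x. (x, z) \<in> P})} = {z. odd (card {x. (x, z) \<in> P})}"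
  proof -
    have "z \<in> snd ` P" if "odd (card {x. (x, z) \<in> P})" for z
    proof (rule ccontr)
      assume "z \<notin> snd ` P"
      then have "{x. (x, z) \<in> P} = {}" by force
      then show False using that by simp
    qed
    then show ?thesis by auto
  qed
  finally show ?thesis .
qed

text \<open>Both sides give the parity of the number of pairs \<open>(x, z)\<close> with
  \<open>y \<in> g z\<close>. Finiteness is asked for each \<open>y\<close> separately, because the
  sums over all translates are infinite and only locally finite.\<close>

lemma msum_msum:
  assumes fin: "\<And>y. finite {(x, z). x \<in> A \<and> z \<in> f x \<and> y \<in> g z}"
  shows "msum g (msum f A) = msum (\<lambda>x. msum g (f x)) A"
proof -
  have "y \<in> msum g (msum f A) \<longleftrightarrow> y \<in> msum (\<lambda>x. msum g (f x)) A" for y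
  proof -
    define P where "P = {(x, z). x \<in> A \<and> z \<in> f x \<and> y \<in> g z}"
    have P: "finite P" "finite (prod.swap ` P)" using fin by (auto simp: P_def)
    have 1: "{z \<in> msum f A. y \<in> g z} = {z. odd (card {x. (x, z) \<in> P})}"
    proof -
      have "{x. (x, z) \<in> P} = (if y \<in> g z then {x \<in> A. z \<in> f x} else {})" for z
        by (auto simp: P_def)
      then show ?thesis by (auto simp: msum_def)
    qed
    have 2: "{x \<in> A. y \<in> msum g (f x)} = {x. odd (card {z. (z, x) \<in> prod.swap ` P})}"
    proof -
      have "{z. (z, x) \<in> prod.swap ` P} = (if x \<in> A then {z \<in> f x. y \<in> g z} else {})" for x
        by (auto simp: P_def image_iff)
      then show ?thesis by (auto simp: msum_def)
    qed
    have 3: "card P = card (prod.swap ` P)" by (simp add: card_image)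
    show ?thesis
      using odd_card_fibres[OF P(1)] odd_card_fibres[OF P(2)] 1 2 3
      by (simp add: msum_def[of g "msum f A"] msum_def[of "\<lambda>x. msum g (f x)" A])
  qed
  then show ?thesis by blast
qed

lemma msum_msum_finite:
  assumes "finite A" "\<And>x. x \<in> A \<Longrightarrow> finite (f x)"
  shows "msum g (msum f A) = msum (\<lambda>x. msum g (f x)) A"
proof -
  have "finite {(x, z). x \<in> A \<and> z \<in> f x \<and> y \<in> g z}" for y
    by (rule finite_subset[of _ "Sigma A f"]) (use assms in auto)
  then show ?thesis using msum_msum[of A f g] by blast
qed

lemma finite_msum: "finite A \<Longrightarrow> (\<And>x. x \<in> A \<Longrightarrow> finite (f x)) \<Longrightarrow> finite (msum f A)"
  by (rule finite_subset[OF msum_subset], rule finite_UN_I)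

lemma msum_image:
  assumes "inj_on h A" shows "msum f (h ` A) = msum (\<lambda>x. f (h x)) A"
proof -
  have "card {x \<in> h ` A. y \<in> f x} = card {x \<in> A. y \<in> f (h x)}" for y
  proof -
    have "{x \<in> h ` A. y \<in> f x} = h ` {x \<in> A. y \<in> f (h x)}" by auto
    then show ?thesis using assms by (simp add: card_image inj_on_def)
  qed
  then show ?thesis by (simp add: msum_def)
qed

lemma image_msum:
  assumes "inj h" shows "h ` msum f A = msum (\<lambda>x. h ` f x) A"
proof -
  have *: "{x \<in> A. h y \<in> h ` f x} = {x \<in> A. y \<in> f x}" for y
    using assms by (auto simp: inj_image_mem_iff)
  have "y \<in> h ` msum f A" if "y \<in> msum (\<lambda>x. h ` f x) A" for y
  proof -
    from that obtain z where z: "y = h z" by (blast elim: msumE)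
    show ?thesis using that unfolding z msum_def by (simp add: * )
  qed
  moreover have "y \<in> msum (\<lambda>x. h ` f x) A" if "y \<in> h ` msum f A" for y
    using that by (auto simp: msum_def * )
  ultimately show ?thesis by blast
qed

lemma msum_disjoint:
  assumes "\<And>x x'. x \<in> A \<Longrightarrow> x' \<in> A \<Longrightarrow> x \<noteq> x' \<Longrightarrow> f x \<inter> f x' = {}"
  shows "msum f A = (\<Union>x\<in>A. f x)"
proof
  show "(\<Union>x\<in>A. f x) \<subseteq> msum f A"
  proof
    fix y assume "y \<in> (\<Union>x\<in>A. f x)"
    then obtain x where "x \<in> A" "y \<in> f x" by blast
    then have "{x \<in> A. y \<in> f x} = {x}" using assms by blast
    then show "y \<in> msum f A" by (simp add: msum_def)
  qed
qed (rule msum_subset)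

lemma msum_ident: "msum (\<lambda>x. {x}) A = A"
proof -
  have "{x \<in> A. y \<in> {x}} = (if y \<in> A then {y} else {})" for y by auto
  then show ?thesis by (auto simp: msum_def)
qed

text \<open>
  A simplex is the list of its vertices, possibly with repetitions, and a finite chain modulo 2 is
  a finite set of simplices.  The empty list is a simplex, so that the chain complex is augmented
  and \<open>(#) b ` C\<close> is the cone over \<open>C\<close> in all dimensions.
\<close>

fun face :: "'a list \<Rightarrow> 'a list set" where
  "face [] = {}"
| "face (x # xs) = sym_diff {xs} ((#) x ` face xs)"

lemma finite_face [simp]: "finite (face xs)"
  by (induction xs) auto

lemma face_length: "ys \<in> face xs \<Longrightarrow> Suc (length ys) = length xs"
proof (induction xs arbitrary: ys)
  case (Cons x xs)
  show ?case
  proof (cases "ys = xs")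
    case False
    then obtain zs where zs: "zs \<in> face xs" "ys = x # zs" using Cons.prems by auto
    show ?thesis using Cons.IH[OF zs(1)] zs(2) by auto
  qed auto
qed simp

lemma face_set: "ys \<in> face xs \<Longrightarrow> set ys \<subseteq> set xs"
proof (induction xs arbitrary: ys)
  case (Cons x xs)
  show ?case
  proof (cases "ys = xs")
    case False
    then obtain zs where zs: "zs \<in> face xs" "ys = x # zs" using Cons.prems by auto
    show ?thesis using Cons.IH[OF zs(1)] zs(2) by auto
  qed auto
qed simp

lemma face_distinct: "ys \<in> face xs \<Longrightarrow> distinct xs \<Longrightarrow> distinct ys"
proof (induction xs arbitrary: ys)
  case (Cons x xs)
  have "x \<notin> set zs" if "zs \<in> face xs" for zs using face_set[OF that] Cons.prems(2) by auto
  then show ?case using Cons by auto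
qed simp

text \<open>This is the cone formula. It yields that boundaries have no boundary, that subdivision
  commutes with the boundary, and that a cycle bounds its cone.\<close>

lemma msum_face_Cons:
  assumes "finite C"
  shows "msum face ((#) b ` C) = sym_diff C ((#) b ` msum face C)"
proof -
  have "msum face ((#) b ` C) = msum (\<lambda>xs. sym_diff {xs} ((#) b ` face xs)) C"
    by (simp add: msum_image)
  also have "\<dots> = sym_diff (msum (\<lambda>xs. {xs}) C) (msum (\<lambda>xs. (#) b ` face xs) C)"
    using assms by (intro msum_fun_sym_diff) auto
  finally show ?thesis by (simp add: msum_ident image_msum)
qed

lemma msum_face_face: "msum face (face xs) = {}"
proof (induction xs)
  case (Cons x xs)
  have "msum face (face (x # xs)) = sym_diff (face xs) (msum face ((#) x ` face xs))"
    by (simp only: face.simps, subst msum_sym_diff) auto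
  then show ?case using Cons by (simp add: msum_face_Cons)
qed simp

section \<open>Barycentric subdivision of chains\<close>

definition barycentre :: "'a::real_vector list \<Rightarrow> 'a" where
  "barycentre xs = (1 / real (length xs)) *\<^sub>R sum_list xs"

text \<open>Barycentric subdivision, meaningful only for lists of length \<open>n\<close>.\<close>

primrec subdiv :: "nat \<Rightarrow> 'a::real_vector list \<Rightarrow> 'a list set" where
  "subdiv 0 xs = {[]}"
| "subdiv (Suc n) xs = (#) (barycentre xs) ` msum (subdiv n) (face xs)"

lemma finite_subdiv [simp]: "finite (subdiv n xs)"
  by (induction n arbitrary: xs) (simp_all add: finite_msum)

text \<open>The subdivided boundary is itself a cycle, by induction and since boundaries have no
  boundary, and the cone over a cycle has that cycle as its boundary. For the empty list both sides
  are empty, which makes the truncated \<open>n - 1\<close> correct.\<close>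

lemma msum_face_subdiv:
  "length xs = n \<Longrightarrow> msum face (subdiv n xs) = msum (subdiv (n - 1)) (face xs)"
proof (induction n arbitrary: xs)
  case (Suc m)
  define C where "C = msum (subdiv m) (face xs)"
  have "msum face C = msum (\<lambda>ys. msum face (subdiv m ys)) (face xs)"
    unfolding C_def by (intro msum_msum_finite) auto
  also have "\<dots> = msum (\<lambda>ys. msum (subdiv (m - 1)) (face ys)) (face xs)"
    using Suc face_length by (intro msum_cong[OF refl] Suc.IH) force
  also have "\<dots> = msum (subdiv (m - 1)) (msum face (face xs))"
    by (intro msum_msum_finite[symmetric]) auto
  finally have "msum face C = {}" by (simp add: msum_face_face)
  moreover have "finite C" unfolding C_def by (intro finite_msum) auto
  ultimately show ?case by (simp add: C_def[symmetric] msum_face_Cons)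
qed auto

lemma barycentre_in_hull:
  fixes xs :: "'a::real_vector list"
  assumes "xs \<noteq> []" shows "barycentre xs \<in> convex hull (set xs)"
proof -
  have "(\<Sum>i\<in>{..<length xs}. (1 / real (length xs)) *\<^sub>R xs ! i) \<in> convex hull (set xs)"
    using assms by (intro convex_sum) (auto simp: hull_inc)
  then show ?thesis
    by (simp add: barycentre_def sum_list_sum_nth scaleR_sum_right atLeast0LessThan)
qed

text \<open>In the average of \<open>x - y\<close> over the vertices \<open>y\<close> the term of
  \<open>x\<close> itself vanishes, which leaves \<open>length xs - 1\<close> terms out of
  \<open>length xs\<close>.\<close>

lemma dist_barycentre:
  fixes xs :: "'a::real_normed_vector list"
  assumes "x \<in> set xs" and small: "\<And>y. y \<in> set xs \<Longrightarrow> dist x y \<le> \<delta>"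
  shows "dist x (barycentre xs) \<le> (1 - 1 / real (length xs)) * \<delta>"
proof -
  let ?n = "length xs"
  obtain j where j: "j < ?n" "xs ! j = x" using assms(1) by (metis in_set_conv_nth)
  have n: "?n > 0" using assms(1) by (cases xs) auto
  have "x = (1 / real ?n) *\<^sub>R (\<Sum>i<?n. x)" using n by (simp add: sum_constant_scaleR)
  then have "x - barycentre xs = (1 / real ?n) *\<^sub>R (\<Sum>i<?n. x - xs ! i)"
    by (simp add: barycentre_def sum_list_sum_nth sum_subtractf atLeast0LessThan scaleR_diff_right)
  then have "dist x (barycentre xs) = (1 / real ?n) * norm (\<Sum>i<?n. x - xs ! i)"
    by (simp add: dist_norm)
  also have "(\<Sum>i<?n. x - xs ! i) = (\<Sum>i\<in>{..<?n} - {j}. x - xs ! i)"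
    using j by (simp add: sum.remove[of "{..<?n}" j])
  also have "norm \<dots> \<le> (\<Sum>i\<in>{..<?n} - {j}. \<delta>)"
    using small by (intro sum_norm_le) (auto simp: dist_norm)
  also have "\<dots> = (real ?n - 1) * \<delta>" using j n by (simp add: of_nat_diff)
  finally show ?thesis using n by (simp add: field_simps)
qed

text \<open>The three properties need a joint induction, as the estimate for the barycentre uses
  that the subdivided faces stay in the convex hull. The factor of a face is smaller than that of
  the simplex, so pairs that avoid the barycentre are covered by the induction hypothesis.\<close>

lemma subdiv_props:
  fixes xs :: "'a::real_normed_vector list"
  assumes "length xs = n" "ys \<in> subdiv n xs"
  shows "length ys = n" "set ys \<subseteq> convex hull (set xs)"
    and "(\<And>x y. x \<in> set xs \<Longrightarrow> y \<in> set xs \<Longrightarrow> dist x y \<le> \<delta>) \<Longrightarrow>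
      x \<in> set ys \<Longrightarrow> y \<in> set ys \<Longrightarrow> dist x y \<le> (1 - 1 / real n) * \<delta>"
proof -
  have "length ys = n \<and> set ys \<subseteq> convex hull (set xs) \<and>
    ((\<forall>x\<in>set xs. \<forall>y\<in>set xs. dist x y \<le> \<delta>) \<longrightarrow>
      (\<forall>x\<in>set ys. \<forall>y\<in>set ys. dist x y \<le> (1 - 1 / real n) * \<delta>))"
    using assms
  proof (induction n arbitrary: xs ys)
    case (Suc n)
    then obtain zs us where zs: "ys = barycentre xs # zs" "us \<in> face xs" "zs \<in> subdiv n us"
      by (auto elim: msumE)
    have us: "length us = n" "set us \<subseteq> set xs" using zs(2) face_length[of us xs] face_set Suc by auto
    note IH = Suc.IH[OF us(1) zs(3)]
    have "xs \<noteq> []" using Suc by auto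
    then have b: "barycentre xs \<in> convex hull (set xs)" by (rule barycentre_in_hull)
    have hull: "set zs \<subseteq> convex hull (set xs)" using IH us hull_mono by blast
    have "dist x y \<le> (1 - 1 / real (Suc n)) * \<delta>"
      if sm: "\<forall>x\<in>set xs. \<forall>y\<in>set xs. dist x y \<le> \<delta>" and xy: "x \<in> set ys" "y \<in> set ys" for x y
    proof -
      have d0: "0 \<le> \<delta>" using sm \<open>xs \<noteq> []\<close> by (metis dist_self last_in_set)
      have bd: "dist (barycentre xs) z \<le> (1 - 1 / real (Suc n)) * \<delta>" if "z \<in> convex hull (set xs)" for z
      proof -
        \<comment> \<open>The estimate at the vertices extends to the whole hull because a ball is
          convex.\<close>
        have "set xs \<subseteq> cball (barycentre xs) ((1 - 1 / real (Suc n)) * \<delta>)"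
          using dist_barycentre[of _ xs \<delta>] sm Suc.prems(1) by (auto simp: dist_commute)
        then have "convex hull (set xs) \<subseteq> cball (barycentre xs) ((1 - 1 / real (Suc n)) * \<delta>)"
          by (simp add: hull_minimal)
        then show ?thesis using that by auto
      qed
      have zz: "dist x y \<le> (1 - 1 / real (Suc n)) * \<delta>" if "x \<in> set zs" "y \<in> set zs"
      proof -
        have n: "n > 0" using that IH by (cases zs) auto
        have "dist x y \<le> (1 - 1 / real n) * \<delta>" using IH that sm us(2) by blast
        also have "\<dots> \<le> (1 - 1 / real (Suc n)) * \<delta>"
          using n d0 by (intro mult_right_mono) (auto simp: field_simps)
        finally show ?thesis .
      qed
      have x: "x = barycentre xs \<or> x \<in> set zs" and y: "y = barycentre xs \<or> y \<in> set zs"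
        using xy zs by auto
      show ?thesis
      proof (cases "x = barycentre xs")
        case True then show ?thesis using bd y b hull by auto
      next
        case False
        show ?thesis
        proof (cases "y = barycentre xs")
          case True then show ?thesis using bd x b hull False by (auto simp: dist_commute)
        qed (use x y False zz in auto)
      qed
    qed
    then show ?case using IH zs b hull by auto
  qed auto
  then show "length ys = n" "set ys \<subseteq> convex hull (set xs)"
    and "(\<And>x y. x \<in> set xs \<Longrightarrow> y \<in> set xs \<Longrightarrow> dist x y \<le> \<delta>) \<Longrightarrow>
      x \<in> set ys \<Longrightarrow> y \<in> set ys \<Longrightarrow> dist x y \<le> (1 - 1 / real n) * \<delta>"
    by auto
qed

definition iter_subdiv :: "nat \<Rightarrow> nat \<Rightarrow> 'a::real_vector list set \<Rightarrow> 'a list set" where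
  "iter_subdiv n m C = (msum (subdiv n) ^^ m) C"

lemma iter_subdiv_0 [simp]: "iter_subdiv n 0 C = C"
  and iter_subdiv_Suc: "iter_subdiv n (Suc m) C = msum (subdiv n) (iter_subdiv n m C)"
  by (simp_all add: iter_subdiv_def)

lemma finite_iter_subdiv [simp]: "finite C \<Longrightarrow> finite (iter_subdiv n m C)"
  by (induction m) (simp_all add: iter_subdiv_Suc finite_msum)

lemma iter_subdiv_props:
  fixes C :: "'a::real_normed_vector list set"
  assumes C: "\<And>xs. xs \<in> C \<Longrightarrow> length xs = n \<and> set xs \<subseteq> S \<and> (\<forall>x\<in>set xs. \<forall>y\<in>set xs. dist x y \<le> \<delta>)"
    and S: "convex S" and "ys \<in> iter_subdiv n m C"
  shows "length ys = n \<and> set ys \<subseteq> S \<and> (\<forall>x\<in>set ys. \<forall>y\<in>set ys. dist x y \<le> (1 - 1 / real n) ^ m * \<delta>)"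
  using assms(3)
proof (induction m arbitrary: ys)
  case 0 then show ?case using C by simp
next
  case (Suc m)
  then obtain xs where xs: "xs \<in> iter_subdiv n m C" "ys \<in> subdiv n xs"
    by (auto simp: iter_subdiv_Suc elim: msumE)
  note IH = Suc.IH[OF xs(1)]
  have "convex hull (set xs) \<subseteq> S" using IH S by (simp add: hull_minimal)
  then show ?case
    using subdiv_props(1,2)[OF _ xs(2)] IH
      subdiv_props(3)[OF _ xs(2), of "(1 - 1 / real n) ^ m * \<delta>"] by (auto simp: mult.assoc)
qed

lemma iter_subdiv_subset_hull:
  fixes xs :: "'a::real_normed_vector list"
  assumes "length xs = n" "ys \<in> iter_subdiv n m {xs}"
  shows "length ys = n \<and> set ys \<subseteq> convex hull (set xs)"
proof -
  \<comment> \<open>Some bound \<delta> on the edge lengths is needed to invoke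
    \<open>iter_subdiv_props\<close>; its value does not enter the result.\<close>
  have "finite ((\<lambda>(x, y). dist x y) ` (set xs \<times> set xs))" by simp
  then obtain \<delta> where "\<forall>z\<in>(\<lambda>(x, y). dist x y) ` (set xs \<times> set xs). z \<le> \<delta>"
    by (meson bdd_above_def bdd_above_finite)
  then show ?thesis
    using iter_subdiv_props[of "{xs}" n "convex hull (set xs)" \<delta> ys m] assms
    by (auto simp: hull_subset)
qed

lemma msum_face_iter_subdiv:
  fixes C :: "'a::real_normed_vector list set"
  assumes "finite C" "\<And>xs. xs \<in> C \<Longrightarrow> length xs = n"
  shows "msum face (iter_subdiv n m C) = iter_subdiv (n - 1) m (msum face C)"
proof (induction m)
  case (Suc m)
  have len: "length ys = n" if ys: "ys \<in> iter_subdiv n m C" for ys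
    using ys
  proof (induction m arbitrary: ys)
    case (Suc m)
    then obtain xs where xs: "xs \<in> iter_subdiv n m C" "ys \<in> subdiv n xs"
      by (auto simp: iter_subdiv_Suc elim: msumE)
    then show ?case using Suc.IH[OF xs(1)] subdiv_props(1)[OF _ xs(2)] by blast
  qed (use assms in auto)
  have fin: "finite (iter_subdiv n m C)" using assms by simp
  have "msum face (iter_subdiv n (Suc m) C) = msum (\<lambda>xs. msum face (subdiv n xs)) (iter_subdiv n m C)"
    unfolding iter_subdiv_Suc using fin by (intro msum_msum_finite) auto
  also have "\<dots> = msum (\<lambda>xs. msum (subdiv (n - 1)) (face xs)) (iter_subdiv n m C)"
    using len by (intro msum_cong[OF refl] msum_face_subdiv)
  also have "\<dots> = msum (subdiv (n - 1)) (msum face (iter_subdiv n m C))"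
    using fin by (intro msum_msum_finite[symmetric]) auto
  finally show ?case by (simp add: Suc iter_subdiv_Suc)
qed simp

section \<open>From ordered to unordered simplices, and labellings of subdivisions\<close>

definition del :: "'a set \<Rightarrow> 'a set set" where
  "del \<kappa> = {\<kappa> - {x} |x. x \<in> \<kappa>}"

text \<open>A list with a repeated vertex is degenerate and counts as zero. The value is a chain
  with at most one simplex, so that it can be summed modulo 2.\<close>

definition lab :: "'a list \<Rightarrow> 'a set set" where
  "lab ys = (if distinct ys then {set ys} else {})"

lemma finite_lab [simp]: "finite (lab ys)"
  by (simp add: lab_def)

text \<open>The critical case is a list whose only repetition is that its head occurs again: it has
  two faces without repetition, on the same vertex set, and these cancel. So forgetting the order
  and the degenerate simplices is a chain map.\<close>

lemma msum_lab_face: "msum lab (face ys) = msum del (lab ys)"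
proof (induction ys)
  case Nil then show ?case by (auto simp: lab_def del_def)
next
  case (Cons y ys)
  \<comment> \<open>\<open>J\<close> is the cone with apex \<open>y\<close> on unordered simplices;
    those that contain \<open>y\<close> already would become degenerate and are dropped.\<close>
  define J where "J C = insert y ` {\<kappa> \<in> C. y \<notin> \<kappa>}" for C :: "'a set set"
  have lc: "lab (y # zs) = J (lab zs)" for zs by (auto simp: lab_def J_def)
  have J: "J C = msum (\<lambda>\<kappa>. if y \<in> \<kappa> then {} else {insert y \<kappa>}) C" for C
    by (subst msum_disjoint) (auto simp: J_def split: if_splits)
  have "msum (\<lambda>zs. lab (y # zs)) (face ys) = J (msum lab (face ys))"
    unfolding lc J[of "lab _"] J[of "msum lab (face ys)"]
    using msum_msum_finite[of "face ys" lab "\<lambda>\<kappa>. if y \<in> \<kappa> then {} else {insert y \<kappa>}"] by simp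
  then have 1: "msum lab (face (y # ys)) = sym_diff (lab ys) (J (msum del (lab ys)))"
    using Cons by (simp only: face.simps, subst msum_sym_diff) (auto simp: msum_image)
  show ?case
  proof (cases "distinct ys")
    case True
    show ?thesis
    proof (cases "y \<in> set ys")
      case T: True
      have "{\<kappa> \<in> del (set ys). y \<notin> \<kappa>} = {set ys - {y}}" using T by (auto simp: del_def)
      then have "J (del (set ys)) = {set ys}" using T by (simp add: J_def insert_absorb)
      then show ?thesis unfolding 1 using True T by (simp add: lab_def)
    next
      case F: False
      let ?D = "(\<lambda>x. insert y (set ys) - {x}) ` set ys"
      have "{\<kappa> \<in> del (set ys). y \<notin> \<kappa>} = (\<lambda>x. set ys - {x}) ` set ys" using F by (auto simp: del_def)
      then have "J (del (set ys)) = (\<lambda>x. insert y (set ys - {x})) ` set ys"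
        by (simp add: J_def image_image)
      also have "\<dots> = ?D" using F by (intro image_cong) auto
      finally have "J (del (set ys)) = ?D" .
      moreover have "set ys \<notin> ?D" using F by blast
      moreover have "del (insert y (set ys)) = insert (set ys) ?D"
        unfolding del_def using F by (subst Setcompr_eq_image) (simp add: insert_Diff_if)
      ultimately show ?thesis unfolding 1 using True F by (simp add: lab_def)
    qed
  next
    case False
    then show ?thesis unfolding 1 by (simp add: lab_def J_def)
  qed
qed

lemma face_map: "face (map v xs) = msum (\<lambda>ys. {map v ys}) (face xs)"
proof (induction xs)
  case (Cons x xs)
  have *: "msum (\<lambda>ys. {map v ys}) ((#) x ` face xs) = (#) (v x) ` msum (\<lambda>ys. {map v ys}) (face xs)"
    by (simp add: msum_image image_msum)
  show ?case using Cons by (simp only: face.simps list.map, subst msum_sym_diff) (auto simp: * )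
qed simp

text \<open>This is simplicial approximation on the level of chains: \<open>m\<close> subdivisions,
  then the vertex map \<open>v\<close>, then removal of degenerate images.\<close>

definition labelled :: "('a::real_vector \<Rightarrow> 'b) \<Rightarrow> nat \<Rightarrow> nat \<Rightarrow> 'a list set \<Rightarrow> 'b set set" where
  "labelled v n m C = msum (\<lambda>ys. lab (map v ys)) (iter_subdiv n m C)"

lemma finite_labelled: "finite C \<Longrightarrow> finite (labelled v n m C)"
  unfolding labelled_def by (rule finite_msum) simp_all

lemma iter_subdiv_sym_diff:
  assumes "finite C" "finite D"
  shows "iter_subdiv n m (sym_diff C D) = sym_diff (iter_subdiv n m C) (iter_subdiv n m D)"
proof (induction m)
  case (Suc m)
  show ?case unfolding iter_subdiv_Suc Suc using assms by (intro msum_sym_diff) auto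
qed simp

lemma labelled_sym_diff:
  assumes "finite C" "finite D"
  shows "labelled v n m (sym_diff C D) = sym_diff (labelled v n m C) (labelled v n m D)"
  unfolding labelled_def iter_subdiv_sym_diff[OF assms] using assms by (intro msum_sym_diff) simp_all

lemma iter_subdiv_empty [simp]: "iter_subdiv n m {} = {}"
  by (induction m) (simp_all add: iter_subdiv_Suc)

lemma labelled_empty [simp]: "labelled v n m {} = {}"
  by (simp add: labelled_def)

lemma labelled_msum:
  assumes "finite C" shows "labelled v n m C = msum (\<lambda>xs. labelled v n m {xs}) C"
  using assms
proof (induction C)
  case (insert x C)
  have "labelled v n m (insert x C) = sym_diff (labelled v n m {x}) (labelled v n m C)"
    using labelled_sym_diff[of "{x}" C v n m] insert by (simp add: insert_Diff_if)
  also have "\<dots> = msum (\<lambda>xs. labelled v n m {xs}) (sym_diff {x} C)"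
    using insert by (subst msum_sym_diff) auto
  finally show ?case using insert by (simp add: insert_Diff_if)
qed simp

lemma msum_del_labelled:
  fixes C :: "'a::real_normed_vector list set"
  assumes "finite C" "\<And>xs. xs \<in> C \<Longrightarrow> length xs = n"
  shows "msum del (labelled v n m C) = labelled v (n - 1) m (msum face C)"
proof -
  let ?I = "iter_subdiv n m C"
  have fin: "finite ?I" using assms by simp
  have "msum del (labelled v n m C) = msum (\<lambda>ys. msum del (lab (map v ys))) ?I"
    unfolding labelled_def using fin by (intro msum_msum_finite) auto
  also have "\<dots> = msum (\<lambda>ys. msum lab (face (map v ys))) ?I" by (simp add: msum_lab_face)
  also have "\<dots> = msum (\<lambda>ys. msum (\<lambda>zs. lab (map v zs)) (face ys)) ?I"
    unfolding face_map by (subst msum_msum_finite) auto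
  also have "\<dots> = msum (\<lambda>zs. lab (map v zs)) (msum face ?I)"
    using fin by (intro msum_msum_finite[symmetric]) auto
  finally show ?thesis using msum_face_iter_subdiv[OF assms] by (simp add: labelled_def)
qed

text \<open>This is Sperner's lemma modulo 2.\<close>

lemma labelled_simplex:
  fixes xs :: "'a::real_normed_vector list"
  assumes closed: "\<And>\<kappa> \<tau>. \<kappa> \<in> K \<Longrightarrow> \<tau> \<subseteq> \<kappa> \<Longrightarrow> \<tau> \<noteq> {} \<Longrightarrow> \<tau> \<in> K"
    and v: "\<And>\<kappa> x. \<kappa> \<in> K \<Longrightarrow> x \<in> convex hull \<kappa> \<Longrightarrow> v x \<in> \<kappa>"
  shows "distinct xs \<Longrightarrow> xs = [] \<or> set xs \<in> K \<Longrightarrow> length xs = n \<Longrightarrow> labelled v n m {xs} = {set xs}"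
proof (induction n arbitrary: xs)
  case 0
  have "iter_subdiv 0 m {[]} = {[]::'a list}" by (induction m) (simp_all add: iter_subdiv_Suc)
  then show ?case using 0 by (simp add: labelled_def lab_def)
next
  case (Suc n)
  have ne: "xs \<noteq> []" and K: "set xs \<in> K" using Suc by auto
  \<comment> \<open>All labels lie in the simplex itself and a nondegenerate image has as many
    vertices, so no other simplex can occur.\<close>
  have sub: "labelled v (Suc n) m {xs} \<subseteq> {set xs}"
  proof
    fix \<kappa> assume "\<kappa> \<in> labelled v (Suc n) m {xs}"
    then obtain ys where ys: "ys \<in> iter_subdiv (Suc n) m {xs}" "\<kappa> \<in> lab (map v ys)"
      unfolding labelled_def by (auto elim: msumE)
    then have "length ys = Suc n" "set ys \<subseteq> convex hull (set xs)"
      using iter_subdiv_subset_hull Suc.prems(3) by blast+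
    moreover have "\<kappa> = v ` set ys" "card \<kappa> = length ys"
      using ys(2) distinct_card[of "map v ys"] by (auto simp: lab_def split: if_splits)
    ultimately have "\<kappa> \<subseteq> set xs" "card \<kappa> = card (set xs)"
      using v[OF K] Suc.prems distinct_card[of xs] by auto
    then show "\<kappa> \<in> {set xs}" using card_subset_eq by blast
  qed
  \<comment> \<open>The simplex does occur: by induction on its faces, the boundary of the labelled
    chain is the boundary of the simplex, which is not zero.\<close>
  have "msum del (labelled v (Suc n) m {xs}) = labelled v n m (face xs)"
    using msum_del_labelled[of "{xs}" "Suc n" v m] Suc.prems by simp
  also have "\<dots> = msum (\<lambda>ys. labelled v n m {ys}) (face xs)" by (rule labelled_msum) simp
  also have "\<dots> = msum lab (face xs)"
  proof (rule msum_cong[OF refl])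
    fix ys assume ys: "ys \<in> face xs"
    have "distinct ys" "length ys = n" "ys = [] \<or> set ys \<in> K"
      using ys Suc.prems face_distinct[OF ys] face_length[OF ys] closed[OF K face_set[OF ys]] by auto
    then show "labelled v n m {ys} = lab ys" using Suc.IH by (simp add: lab_def)
  qed
  also have "\<dots> = del (set xs)" using Suc.prems by (simp add: msum_lab_face lab_def)
  also have "\<dots> \<noteq> {}" using ne by (cases xs) (auto simp: del_def)
  finally have "labelled v (Suc n) m {xs} \<noteq> {}" by auto
  then show ?case using sub by blast
qed

text \<open>Ordering every simplex by one fixed list of all vertices makes the passage from sets to
  lists commute with taking faces. In this way a cycle of sets becomes a cycle of lists.\<close>

lemma face_filter:
  assumes "distinct vs"
  shows "face (filter (\<lambda>x. x \<in> \<kappa>) vs) =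
    (\<lambda>x. filter (\<lambda>y. y \<in> \<kappa> - {x}) vs) ` (\<kappa> \<inter> set vs)"
  using assms
proof (induction vs)
  case (Cons y ys)
  let ?e = "\<lambda>ys \<tau>. filter (\<lambda>x. x \<in> \<tau>) ys"
  have IH: "face (?e ys \<kappa>) = (\<lambda>x. ?e ys (\<kappa> - {x})) ` (\<kappa> \<inter> set ys)" using Cons.IH Cons.prems by simp
  have ys: "y \<notin> set ys" using Cons.prems by auto
  show ?case
  proof (cases "y \<in> \<kappa>")
    case True
    have a: "?e ys (\<kappa> - {y}) = ?e ys \<kappa>"
      by (rule filter_cong[OF refl]) (use ys in blast)
    have b: "(\<lambda>x. y # ?e ys (\<kappa> - {x})) ` (\<kappa> \<inter> set ys) = (\<lambda>x. ?e (y # ys) (\<kappa> - {x})) ` (\<kappa> \<inter> set ys)"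
      by (rule image_cong[OF refl]) (use ys True in auto)
    have c: "\<kappa> \<inter> set (y # ys) = insert y (\<kappa> \<inter> set ys)" using True by auto
    have d: "?e ys \<kappa> \<notin> (\<lambda>x. y # ?e ys (\<kappa> - {x})) ` (\<kappa> \<inter> set ys)"
    proof
      assume "?e ys \<kappa> \<in> (\<lambda>x. y # ?e ys (\<kappa> - {x})) ` (\<kappa> \<inter> set ys)"
      then obtain x where "?e ys \<kappa> = y # ?e ys (\<kappa> - {x})" by blast
      then have "y \<in> set (?e ys \<kappa>)" by (metis list.set_intros(1))
      then show False using ys by simp
    qed
    have "face (?e (y # ys) \<kappa>) = sym_diff {?e ys \<kappa>} ((#) y ` face (?e ys \<kappa>))"
      using True by simp
    also have "(#) y ` face (?e ys \<kappa>) = (\<lambda>x. y # ?e ys (\<kappa> - {x})) ` (\<kappa> \<inter> set ys)"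
      by (simp only: IH image_image)
    also have "sym_diff {?e ys \<kappa>} \<dots> = insert (?e ys \<kappa>) \<dots>" using d by (simp add: insert_Diff_if)
    also have "\<dots> = (\<lambda>x. ?e (y # ys) (\<kappa> - {x})) ` (\<kappa> \<inter> set (y # ys))"
      unfolding b c image_insert using a by simp
    finally show ?thesis .
  next
    case False
    have "\<kappa> \<inter> set (y # ys) = \<kappa> \<inter> set ys" using False by auto
    then show ?thesis using IH False by simp
  qed
qed simp

text \<open>
  The cycle is coned off in the ambient space, the cone is subdivided until its simplices are small
  and pushed back along the labelling \<open>v\<close>, which does not change the cycle by Sperner's lemma.
\<close>

lemma finite_cycle_bounds:
  fixes z :: "'a::euclidean_space set set"
  assumes closed: "\<And>\<kappa> \<tau>. \<kappa> \<in> K \<Longrightarrow> \<tau> \<subseteq> \<kappa> \<Longrightarrow> \<tau> \<noteq> {} \<Longrightarrow> \<tau> \<in> K"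
    and small: "\<And>S. compact S \<Longrightarrow> \<exists>\<delta>>0. \<exists>v. (\<forall>\<kappa>\<in>K. \<forall>x\<in>S. x \<in> convex hull \<kappa> \<longrightarrow> v x \<in> \<kappa>) \<and>
       (\<forall>X. X \<subseteq> S \<and> X \<noteq> {} \<and> finite X \<and> (\<forall>x\<in>X. \<forall>y\<in>X. dist x y < \<delta>) \<longrightarrow> v ` X \<in> K)"
    and z: "finite z" "z \<subseteq> K" "\<And>\<kappa>. \<kappa> \<in> z \<Longrightarrow> finite \<kappa> \<and> card \<kappa> = n" "msum del z = {}" and n: "n > 0"
  shows "\<exists>w. finite w \<and> w \<subseteq> K \<and> (\<forall>\<kappa>\<in>w. card \<kappa> = Suc n) \<and> msum del w = z"
proof -
  have fV: "finite (\<Union>z)" using z(1,3) by (intro finite_Union) blast+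
  then obtain vs where vs: "distinct vs" "set vs = \<Union>z" using finite_distinct_list[OF fV] by metis
  define e where "e \<kappa> = filter (\<lambda>x. x \<in> \<kappa>) vs" for \<kappa>
  have e: "set (e \<kappa>) = \<kappa>" "distinct (e \<kappa>)" "length (e \<kappa>) = card \<kappa>" if "\<kappa> \<subseteq> \<Union>z" for \<kappa>
  proof -
    show 1: "set (e \<kappa>) = \<kappa>" "distinct (e \<kappa>)" using that vs by (auto simp: e_def)
    show "length (e \<kappa>) = card \<kappa>" using distinct_card[OF 1(2)] 1(1) by simp
  qed
  have zs: "\<kappa> \<subseteq> \<Union>z" if "\<kappa> \<in> z" for \<kappa> using that by blast
  have inj_e: "inj_on e (Pow (\<Union>z))" by (rule inj_onI) (metis PowD e(1))
  have face_e: "face (e \<kappa>) = msum (\<lambda>\<tau>. {e \<tau>}) (del \<kappa>)" if "\<kappa> \<in> z" for \<kappa>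
  proof -
    have "\<kappa> \<inter> set vs = \<kappa>" "del \<kappa> = (\<lambda>x. \<kappa> - {x}) ` \<kappa>"
      using zs[OF that] vs by (auto simp: del_def)
    then have "face (e \<kappa>) = e ` del \<kappa>"
      using face_filter[OF vs(1), of \<kappa>] by (simp only: e_def image_image)
    also have "inj_on e (del \<kappa>)"
      by (rule inj_on_subset[OF inj_e]) (use zs[OF that] in \<open>auto simp: del_def\<close>)
    then have "e ` del \<kappa> = msum (\<lambda>\<tau>. {e \<tau>}) (del \<kappa>)"
      using msum_image[of e "del \<kappa>" "\<lambda>x. {x}"] by (simp add: msum_ident)
    finally show ?thesis .
  qed
  have fdel: "finite (del \<kappa>)" if "\<kappa> \<in> z" for \<kappa>
  proof -
    have "del \<kappa> = (\<lambda>x. \<kappa> - {x}) ` \<kappa>" by (auto simp: del_def)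
    then show ?thesis using z(3)[OF that] by simp
  qed
  define Z where "Z = e ` z"
  have Zmsum: "msum f Z = msum (\<lambda>\<kappa>. f (e \<kappa>)) z" for f :: "'a list \<Rightarrow> 'b set"
    unfolding Z_def by (intro msum_image inj_on_subset[OF inj_e]) auto
  have finZ: "finite Z" and lenZ: "xs \<in> Z \<Longrightarrow> length xs = n" for xs
    using z e zs by (auto simp: Z_def)
  have "msum face Z = msum (\<lambda>\<kappa>. msum (\<lambda>\<tau>. {e \<tau>}) (del \<kappa>)) z"
    unfolding Zmsum using face_e by (intro msum_cong) auto
  also have "\<dots> = msum (\<lambda>\<tau>. {e \<tau>}) (msum del z)"
    using z(1) fdel by (intro msum_msum_finite[symmetric]) auto
  finally have bdZ: "msum face Z = {}" using z(4) by simp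
  \<comment> \<open>The apex is an arbitrary point of the ambient space; the labelling replaces it
    by a vertex.\<close>
  define p where "p = (0::'a)"
  define C where "C = (#) p ` Z"
  have bdC: "msum face C = Z" using bdZ finZ by (simp add: C_def msum_face_Cons)
  define S where "S = convex hull (insert p (\<Union>z))"
  have S: "compact S" "convex S" unfolding S_def
    using fV by (auto intro: compact_convex_hull finite_imp_compact)
  obtain \<delta> v where dv: "\<delta> > 0" "\<forall>\<kappa>\<in>K. \<forall>x\<in>S. x \<in> convex hull \<kappa> \<longrightarrow> v x \<in> \<kappa>"
     "\<forall>X. X \<subseteq> S \<and> X \<noteq> {} \<and> finite X \<and> (\<forall>x\<in>X. \<forall>y\<in>X. dist x y < \<delta>) \<longrightarrow> v ` X \<in> K"
    using small[OF S(1)] by blast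
  define D where "D = diameter S"
  have D: "dist x y \<le> D" if "x \<in> S" "y \<in> S" for x y
    unfolding D_def using diameter_bounded_bound[OF compact_imp_bounded[OF S(1)] that] .
  \<comment> \<open>The mesh tends to zero under repeated subdivision, so it eventually falls below
    the \<delta> at which the labels of a small set form a simplex of \<open>K\<close>.\<close>
  have "(\<lambda>m. (1 - 1 / real (Suc n)) ^ m * D) \<longlonglongrightarrow> 0 * D"
    by (intro tendsto_mult tendsto_const LIMSEQ_power_zero) (auto simp: field_simps)
  then obtain m where m: "(1 - 1 / real (Suc n)) ^ m * D < \<delta>"
    using order_tendstoD(2)[of _ "0 * D" sequentially \<delta>] dv(1)
    by (auto simp: eventually_sequentially)
  define w where "w = labelled v (Suc n) m C"
  have CS: "length xs = Suc n \<and> set xs \<subseteq> S \<and> (\<forall>x\<in>set xs. \<forall>y\<in>set xs. dist x y \<le> D)" if xs: "xs \<in> C" for xs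
  proof -
    obtain \<kappa> where k: "\<kappa> \<in> z" "xs = p # e \<kappa>" using xs unfolding C_def Z_def by blast
    have "set xs \<subseteq> insert p (\<Union>z)" using k e(1)[OF zs[OF k(1)]] by auto
    then have "set xs \<subseteq> S" unfolding S_def using hull_subset by fastforce
    moreover have "length xs = Suc n" using k lenZ by (auto simp: Z_def)
    ultimately show ?thesis using D by blast
  qed
  have "\<kappa> \<in> K \<and> card \<kappa> = Suc n" if kw: "\<kappa> \<in> w" for \<kappa>
  proof -
    obtain ys where ys: "ys \<in> iter_subdiv (Suc n) m C" "\<kappa> \<in> lab (map v ys)"
      using kw unfolding w_def labelled_def by (rule msumE)
    have k: "\<kappa> = v ` set ys" "card \<kappa> = length ys"
      using ys(2) distinct_card[of "map v ys"] by (auto simp: lab_def split: if_splits)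
    have y: "length ys = Suc n" "set ys \<subseteq> S" "\<forall>x\<in>set ys. \<forall>y\<in>set ys. dist x y < \<delta>"
      using iter_subdiv_props[OF CS S(2) ys(1)] m by fastforce+
    have "set ys \<noteq> {}" using y(1) by auto
    then show ?thesis using dv(3) y k by auto
  qed
  moreover have "finite w" unfolding w_def C_def using finZ by (intro finite_labelled) auto
  moreover have "msum del w = z"
  proof -
    have "msum del w = labelled v n m Z"
    proof -
      have "finite C" unfolding C_def using finZ by simp
      moreover have "length xs = Suc n" if "xs \<in> C" for xs using CS[OF that] by blast
      ultimately show ?thesis unfolding w_def using msum_del_labelled[of C "Suc n" v m] bdC by simp
    qed
    also have "\<dots> = msum (\<lambda>\<kappa>. labelled v n m {e \<kappa>}) z"
      by (subst labelled_msum[OF finZ]) (rule Zmsum)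
    also have "\<dots> = msum (\<lambda>\<kappa>. {\<kappa>}) z"
    proof (rule msum_cong[OF refl])
      fix \<kappa> assume k: "\<kappa> \<in> z"
      \<comment> \<open>The labelling is controlled on \<open>S\<close> only. Simplices with
        vertices in \<open>S\<close> have their hulls in \<open>S\<close> by convexity, so Sperner's
        lemma is applied to these.\<close>
      define K' where "K' = {\<kappa> \<in> K. \<kappa> \<subseteq> S}"
      have kS: "\<kappa> \<subseteq> S" unfolding S_def using zs[OF k] hull_subset by fastforce
      have "labelled v n m {e \<kappa>} = {set (e \<kappa>)}"
      proof (rule labelled_simplex[of K'])
        show "v x \<in> \<kappa>'" if "\<kappa>' \<in> K'" "x \<in> convex hull \<kappa>'" for \<kappa>' x
          using that dv(2) S(2) hull_minimal[of \<kappa>' S convex] by (auto simp: K'_def)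
        show "e \<kappa> = [] \<or> set (e \<kappa>) \<in> K'" using k e(1)[OF zs[OF k]] z(2) kS by (auto simp: K'_def)
        show "length (e \<kappa>) = n" using e(3)[OF zs[OF k]] z(3)[OF k] by simp
        show "distinct (e \<kappa>)" using e(2)[OF zs[OF k]] .
        show "\<tau> \<in> K'" if "\<kappa> \<in> K'" "\<tau> \<subseteq> \<kappa>" "\<tau> \<noteq> {}" for \<kappa> \<tau>
          using that closed by (auto simp: K'_def)
      qed
      then show "labelled v n m {e \<kappa>} = {\<kappa>}" using e(1)[OF zs[OF k]] by simp
    qed
    finally show ?thesis by (simp add: msum_ident)
  qed
  ultimately show ?thesis by blast
qed

section \<open>Geometry of the lattice\<close>

definition shift :: "'a::real_vector \<Rightarrow> 'a set set \<Rightarrow> 'a set set" where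
  "shift a C = (\<lambda>\<kappa>. (+) a ` \<kappa>) ` C"

lemma inj_plus_image: "inj (\<lambda>\<kappa>. (+) (a::'a::real_vector) ` \<kappa>)"
  by (auto intro!: injI simp: inj_image_eq_iff)

lemma mem_shift: "\<kappa> \<in> shift a C \<longleftrightarrow> (+) (- a) ` \<kappa> \<in> C"
proof
  assume "(+) (- a) ` \<kappa> \<in> C"
  then have "(+) a ` (+) (- a) ` \<kappa> \<in> shift a C" unfolding shift_def by (rule imageI)
  then show "\<kappa> \<in> shift a C" by (simp add: image_image)
qed (auto simp: shift_def image_image)

lemma image_plus_mem: "(+) a ` \<kappa> \<in> shift a C \<longleftrightarrow> \<kappa> \<in> C"
  by (simp add: mem_shift image_image)

lemma shift_shift: "shift a (shift b C) = shift (a + b) C"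
  by (simp add: shift_def image_image add.assoc)

lemma shift_0 [simp]: "shift 0 C = C"
  by (simp add: shift_def)

lemma shift_empty [simp]: "shift a {} = {}" and shift_eq_empty [simp]: "shift a C = {} \<longleftrightarrow> C = {}"
  by (auto simp: shift_def)

lemma Union_shift: "\<Union>(shift a C) = (+) a ` \<Union>C"
  by (auto simp: shift_def)

text \<open>Otherwise the sum of the points would change by \<open>card X\<close> times
  \<open>a\<close>. Hence a finite cluster differs from all its nontrivial translates.\<close>

lemma plus_image_eq_self:
  fixes a :: "'a::real_normed_vector"
  assumes "(+) a ` X = X" "finite X" "X \<noteq> {}"
  shows "a = 0"
proof -
  have "(\<Sum>x\<in>X. x) = (\<Sum>x\<in>(+) a ` X. x)" using assms by simp
  also have "\<dots> = (\<Sum>x\<in>X. a + x)" by (simp add: sum.reindex)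
  also have "\<dots> = real (card X) *\<^sub>R a + (\<Sum>x\<in>X. x)" by (simp add: sum.distrib sum_constant_scaleR)
  finally have "real (card X) *\<^sub>R a = 0" by simp
  then show ?thesis using assms by simp
qed

lemma finite_vec_coords:
  assumes "finite S" shows "finite {z :: 'a ^ 'n::finite. \<forall>i. z $ i \<in> S}"
proof -
  have "{z :: 'a ^ 'n. \<forall>i. z $ i \<in> S} \<subseteq> vec_lambda ` (PiE UNIV (\<lambda>_. S))"
  proof
    fix z :: "'a ^ 'n" assume "z \<in> {z. \<forall>i. z $ i \<in> S}"
    then have "vec_nth z \<in> PiE UNIV (\<lambda>_. S)" "z = vec_lambda (vec_nth z)" by auto
    then show "z \<in> vec_lambda ` (PiE UNIV (\<lambda>_. S))" by blast
  qed
  moreover have "finite (vec_lambda ` (PiE UNIV (\<lambda>_. S)) :: ('a ^ 'n) set)"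
    using assms by (intro finite_imageI finite_PiE) auto
  ultimately show ?thesis by (rule finite_subset)
qed

locale torus_triangulation =
  fixes \<L> :: "'d::finite torus_lattice"
  assumes valid: "valid_lattice \<L>"
begin

lemma inv_periods: "matrix_inv (periods \<L>) *v (periods \<L> *v z) = z"
proof -
  have "\<exists>B. periods \<L> ** B = mat 1 \<and> B ** periods \<L> = mat 1"
    using valid by (simp add: valid_lattice_def invertible_def)
  then have "matrix_inv (periods \<L>) ** periods \<L> = mat 1"
    unfolding matrix_inv_def by (rule someI2_ex) simp
  then show ?thesis by (simp add: matrix_vector_mul_assoc)
qed

lemma zero_shifts [simp]: "0 \<in> shifts \<L>"
  unfolding shifts_def by (auto intro!: exI[of _ 0])

lemma add_shifts: "a \<in> shifts \<L> \<Longrightarrow> b \<in> shifts \<L> \<Longrightarrow> a + b \<in> shifts \<L>"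
proof -
  assume "a \<in> shifts \<L>" "b \<in> shifts \<L>"
  then obtain y z where "a = periods \<L> *v y" "\<forall>i. y $ i \<in> \<int>" "b = periods \<L> *v z" "\<forall>i. z $ i \<in> \<int>"
    by (auto simp: shifts_def)
  then have "a + b = periods \<L> *v (y + z)" "\<forall>i. (y + z) $ i \<in> \<int>"
    by (auto simp: matrix_vector_right_distrib)
  then show ?thesis unfolding shifts_def by blast
qed

lemma uminus_shifts: "a \<in> shifts \<L> \<Longrightarrow> - a \<in> shifts \<L>"
proof -
  assume "a \<in> shifts \<L>"
  then obtain z where "a = periods \<L> *v z" "\<forall>i. z $ i \<in> \<int>" by (auto simp: shifts_def)
  moreover have "- (periods \<L> *v z) = periods \<L> *v (- z)"
    using matrix_vector_mult_diff_distrib[of "periods \<L>" 0 z] by simp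
  ultimately show ?thesis unfolding shifts_def by (auto intro!: exI[of _ "- z"])
qed

lemma diff_shifts: "a \<in> shifts \<L> \<Longrightarrow> b \<in> shifts \<L> \<Longrightarrow> a - b \<in> shifts \<L>"
  using add_shifts[of a "- b"] uminus_shifts[of b] by simp

text \<open>The inverse period matrix turns shifts of bounded norm into integer vectors with bounded
  coordinates.\<close>

lemma finite_bounded_shifts: "finite {a \<in> shifts \<L>. norm a \<le> r}"
proof -
  obtain B where B: "\<And>x. norm (matrix_inv (periods \<L>) *v x) \<le> B * norm x" "B > 0"
    using bounded_linear.pos_bounded[OF matrix_vector_mul_bounded_linear[of "matrix_inv (periods \<L>)"]]
    by (metis mult.commute)
  let ?Z = "{z :: real^'d. \<forall>i. z $ i \<in> {k \<in> \<int>. \<bar>k\<bar> \<le> B * r}}"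
  have "{a \<in> shifts \<L>. norm a \<le> r} \<subseteq> (*v) (periods \<L>) ` ?Z"
  proof
    fix a assume "a \<in> {a \<in> shifts \<L>. norm a \<le> r}"
    then obtain z where z: "a = periods \<L> *v z" "\<forall>i. z $ i \<in> \<int>" and r: "norm a \<le> r"
      by (auto simp: shifts_def)
    have "norm z \<le> B * norm a" using B(1)[of a] z(1) by (simp add: inv_periods)
    also have "\<dots> \<le> B * r" using r B(2) by simp
    finally have "\<bar>z $ i\<bar> \<le> B * r" for i using component_le_norm_cart[of z i] by linarith
    then show "a \<in> (*v) (periods \<L>) ` ?Z" using z by blast
  qed
  moreover have "finite ?Z" by (intro finite_vec_coords finite_abs_int_segment)
  ultimately show ?thesis by (meson finite_imageI finite_subset)
qed

lemma cell_finite: "\<kappa> \<in> cells \<L> \<Longrightarrow> finite \<kappa>"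
  and cell_nonempty: "\<kappa> \<in> cells \<L> \<Longrightarrow> \<kappa> \<noteq> {}"
  and cell_subset: "\<kappa> \<in> cells \<L> \<Longrightarrow> \<tau> \<subseteq> \<kappa> \<Longrightarrow> \<tau> \<noteq> {} \<Longrightarrow> \<tau> \<in> cells \<L>"
  and cell_Int: "\<kappa> \<in> cells \<L> \<Longrightarrow> \<tau> \<in> cells \<L> \<Longrightarrow> convex hull \<kappa> \<inter> convex hull \<tau> = convex hull (\<kappa> \<inter> \<tau>)"
  and cell_top: "\<kappa> \<in> cells \<L> \<Longrightarrow> \<exists>\<tau>\<in>cells \<L>. \<kappa> \<subseteq> \<tau> \<and> card \<tau> = CARD('d) + 1"
  and cells_cover: "\<exists>\<kappa>\<in>cells \<L>. x \<in> convex hull \<kappa>"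
  and finite_orbits: "finite (orbit \<L> ` cells \<L>)"
  and sweep_edge: "adjacent \<L> u v \<Longrightarrow> sweep_dir \<L> \<bullet> (v - u) \<noteq> 0"
proof -
  note v = valid[unfolded valid_lattice_def]
  have "\<forall>\<kappa>\<in>cells \<L>. finite \<kappa> \<and> \<kappa> \<noteq> {} \<and> \<not> affine_dependent \<kappa>" using v by (elim conjE) assumption
  then show "\<kappa> \<in> cells \<L> \<Longrightarrow> finite \<kappa>" "\<kappa> \<in> cells \<L> \<Longrightarrow> \<kappa> \<noteq> {}" by simp_all
  have "\<forall>\<kappa>\<in>cells \<L>. \<forall>\<tau>. \<tau> \<subseteq> \<kappa> \<and> \<tau> \<noteq> {} \<longrightarrow> \<tau> \<in> cells \<L>" using v by (elim conjE) assumption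
  then show "\<kappa> \<in> cells \<L> \<Longrightarrow> \<tau> \<subseteq> \<kappa> \<Longrightarrow> \<tau> \<noteq> {} \<Longrightarrow> \<tau> \<in> cells \<L>" by simp
  have "\<forall>\<kappa>\<in>cells \<L>. \<forall>\<tau>\<in>cells \<L>. convex hull \<kappa> \<inter> convex hull \<tau> = convex hull (\<kappa> \<inter> \<tau>)"
    using v by (elim conjE) assumption
  then show "\<kappa> \<in> cells \<L> \<Longrightarrow> \<tau> \<in> cells \<L> \<Longrightarrow> convex hull \<kappa> \<inter> convex hull \<tau> = convex hull (\<kappa> \<inter> \<tau>)"
    by blast
  have "\<forall>\<kappa>\<in>cells \<L>. \<exists>\<tau>\<in>cells \<L>. \<kappa> \<subseteq> \<tau> \<and> card \<tau> = CARD('d) + 1" using v by (elim conjE) assumption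
  then show "\<kappa> \<in> cells \<L> \<Longrightarrow> \<exists>\<tau>\<in>cells \<L>. \<kappa> \<subseteq> \<tau> \<and> card \<tau> = CARD('d) + 1" by (rule bspec)
  have "(\<Union>\<kappa>\<in>cells \<L>. convex hull \<kappa>) = UNIV" using v by (elim conjE) assumption
  then show "\<exists>\<kappa>\<in>cells \<L>. x \<in> convex hull \<kappa>" by (metis UN_iff UNIV_I)
  show "finite (orbit \<L> ` cells \<L>)" using v by (elim conjE) assumption
  have "\<forall>u v. adjacent \<L> u v \<longrightarrow> sweep_dir \<L> \<bullet> (v - u) \<noteq> 0" using v by (elim conjE) assumption
  then show "adjacent \<L> u v \<Longrightarrow> sweep_dir \<L> \<bullet> (v - u) \<noteq> 0" by blast
qed

lemma cell_shift: "\<kappa> \<in> cells \<L> \<Longrightarrow> a \<in> shifts \<L> \<Longrightarrow> (+) a ` \<kappa> \<in> cells \<L>"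
  using valid unfolding valid_lattice_def orbit_def by blast

lemma cell_vert: "\<kappa> \<in> cells \<L> \<Longrightarrow> v \<in> \<kappa> \<Longrightarrow> v \<in> verts \<L>"
  unfolding verts_def using cell_subset[of \<kappa> "{v}"] by auto

lemma cell_vert_shift: "v \<in> verts \<L> \<Longrightarrow> a \<in> shifts \<L> \<Longrightarrow> a + v \<in> verts \<L>"
  unfolding verts_def using cell_shift[of "{v}" a] by auto

lemma cell_adjacent: "\<kappa> \<in> cells \<L> \<Longrightarrow> u \<in> \<kappa> \<Longrightarrow> v \<in> \<kappa> \<Longrightarrow> u \<noteq> v \<Longrightarrow> adjacent \<L> u v"
  unfolding adjacent_def using cell_subset[of \<kappa> "{u, v}"] by auto

lemma adjacent_sym: "adjacent \<L> u v \<longleftrightarrow> adjacent \<L> v u"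
  unfolding adjacent_def by (auto simp: insert_commute)

lemma adjacent_verts: "adjacent \<L> u v \<Longrightarrow> u \<in> verts \<L> \<and> v \<in> verts \<L>"
  unfolding adjacent_def using cell_vert[of "{u, v}"] by auto

lemma adjacent_shift: "adjacent \<L> u v \<Longrightarrow> a \<in> shifts \<L> \<Longrightarrow> adjacent \<L> (a + u) (a + v)"
  unfolding adjacent_def using cell_shift[of "{u, v}" a] by auto

section \<open>Local finiteness, and labellings by open stars\<close>

lemma finite_cells_bounded:
  assumes "bounded B" shows "finite {\<kappa> \<in> cells \<L>. convex hull \<kappa> \<inter> B \<noteq> {}}"
proof -
  \<comment> \<open>With one representative per orbit, finitely many orbits fit into one ball of
    radius \<open>M\<close>. A cell that meets \<open>B\<close>, of radius \<open>N\<close>, is then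
    a representative moved by a shift of norm at most \<open>M + N\<close>.\<close>
  define rep where "rep q = (SOME \<kappa>. \<kappa> \<in> cells \<L> \<and> orbit \<L> \<kappa> = q)" for q
  let ?R = "rep ` orbit \<L> ` cells \<L>"
  have rep: "rep (orbit \<L> \<kappa>) \<in> cells \<L> \<and> orbit \<L> (rep (orbit \<L> \<kappa>)) = orbit \<L> \<kappa>" if "\<kappa> \<in> cells \<L>" for \<kappa>
    unfolding rep_def by (rule someI[of _ \<kappa>]) (use that in simp)
  have finR: "finite ?R" using finite_orbits by simp
  have "finite \<kappa>" if "\<kappa> \<in> ?R" for \<kappa> using that rep cell_finite by blast
  then have "bounded (\<Union>\<kappa>\<in>?R. convex hull \<kappa>)"
    using finR by (intro bounded_UN) (auto intro: bounded_convex_hull finite_imp_bounded)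
  then obtain M where "\<forall>x\<in>(\<Union>\<kappa>\<in>?R. convex hull \<kappa>). norm x \<le> M" unfolding bounded_iff by metis
  then have M: "norm x \<le> M" if "\<kappa> \<in> ?R" "x \<in> convex hull \<kappa>" for \<kappa> x using that by blast
  obtain N where N: "\<And>x. x \<in> B \<Longrightarrow> norm x \<le> N" using assms unfolding bounded_iff by blast
  have "{\<kappa> \<in> cells \<L>. convex hull \<kappa> \<inter> B \<noteq> {}} \<subseteq> (\<lambda>(a, \<kappa>). (+) a ` \<kappa>) ` ({a \<in> shifts \<L>. norm a \<le> M + N} \<times> ?R)"
  proof
    fix \<kappa> assume "\<kappa> \<in> {\<kappa> \<in> cells \<L>. convex hull \<kappa> \<inter> B \<noteq> {}}"
    then obtain x where k: "\<kappa> \<in> cells \<L>" "x \<in> convex hull \<kappa>" "x \<in> B" by blast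
    define \<tau> where "\<tau> = rep (orbit \<L> \<kappa>)"
    have \<tau>: "\<tau> \<in> ?R" "orbit \<L> \<tau> = orbit \<L> \<kappa>" using rep k(1) by (auto simp: \<tau>_def)
    have "\<kappa> \<in> orbit \<L> \<kappa>" unfolding orbit_def by (rule image_eqI[of _ _ 0]) auto
    then have "\<kappa> \<in> orbit \<L> \<tau>" using \<tau>(2) by simp
    then obtain a where a: "a \<in> shifts \<L>" "\<kappa> = (+) a ` \<tau>" unfolding orbit_def by blast
    have "x \<in> (+) a ` (convex hull \<tau>)" using k(2) unfolding a(2) by (simp add: convex_hull_translation)
    then obtain y where "y \<in> convex hull \<tau>" "x = a + y" by blast
    then have "norm a \<le> M + N" using M[OF \<tau>(1)] N[OF k(3)] norm_triangle_ineq4[of x y] by force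
    then show "\<kappa> \<in> (\<lambda>(a, \<kappa>). (+) a ` \<kappa>) ` ({a \<in> shifts \<L>. norm a \<le> M + N} \<times> ?R)"
      using a \<tau> by (auto intro!: image_eqI[of _ _ "(a, \<tau>)"])
  qed
  moreover have "finite ({a \<in> shifts \<L>. norm a \<le> M + N} \<times> ?R)"
    using finR finite_bounded_shifts by simp
  ultimately show ?thesis by (meson finite_imageI finite_subset)
qed

lemma finite_vertex_star: "finite {\<kappa> \<in> cells \<L>. v \<in> \<kappa>}"
  by (rule finite_subset[OF _ finite_cells_bounded[of "{v}"]]) (auto simp: hull_inc)

lemma finite_cells_above: "\<tau> \<noteq> {} \<Longrightarrow> finite {\<kappa> \<in> cells \<L>. \<tau> \<subseteq> \<kappa>}"
  by (rule finite_subset[OF _ finite_vertex_star[of "SOME v. v \<in> \<tau>"]]) (auto simp: some_in_eq)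

text \<open>The union may be infinite, but near a given point only the finitely many hulls that meet
  a unit ball matter.\<close>

lemma closed_Union_cells:
  assumes "K \<subseteq> cells \<L>" shows "closed (\<Union>\<kappa>\<in>K. convex hull \<kappa>)"
proof -
  have "open (- (\<Union>\<kappa>\<in>K. convex hull \<kappa>))"
  proof (subst open_subopen, intro ballI)
    fix x assume x: "x \<in> - (\<Union>\<kappa>\<in>K. convex hull \<kappa>)"
    define F where "F = {\<kappa> \<in> K. convex hull \<kappa> \<inter> ball x 1 \<noteq> {}}"
    have "finite F"
      by (rule finite_subset[OF _ finite_cells_bounded[of "ball x 1"]]) (use assms in \<open>auto simp: F_def\<close>)
    moreover have "closed (convex hull \<kappa>)" if "\<kappa> \<in> F" for \<kappa>
      using that assms cell_finite unfolding F_def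
      by (auto intro: compact_imp_closed finite_imp_compact_convex_hull)
    ultimately have "closed (\<Union>\<kappa>\<in>F. convex hull \<kappa>)" by (intro closed_UN) auto
    then have "open (ball x 1 - (\<Union>\<kappa>\<in>F. convex hull \<kappa>))" by (intro open_Diff) auto
    moreover have "x \<in> ball x 1 - (\<Union>\<kappa>\<in>F. convex hull \<kappa>)" using x by (auto simp: F_def)
    moreover have "ball x 1 - (\<Union>\<kappa>\<in>F. convex hull \<kappa>) \<subseteq> - (\<Union>\<kappa>\<in>K. convex hull \<kappa>)"
      unfolding F_def by blast
    ultimately show "\<exists>T. open T \<and> x \<in> T \<and> T \<subseteq> - (\<Union>\<kappa>\<in>K. convex hull \<kappa>)" by blast
  qed
  then show ?thesis by (simp add: open_closed)
qed

text \<open>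
  The label of \<open>x\<close> is a vertex \<open>u\<close> whose open star, the complement of the simplices without \<open>u\<close>,
  contains all points of \<open>S\<close> that are close to \<open>x\<close>.
\<close>

lemma small_sets_labelling:
  assumes "compact S"
  shows "\<exists>\<delta>>0. \<exists>v. (\<forall>\<kappa>\<in>cells \<L>. \<forall>x\<in>S. x \<in> convex hull \<kappa> \<longrightarrow> v x \<in> \<kappa>) \<and>
    (\<forall>X. X \<subseteq> S \<and> X \<noteq> {} \<and> finite X \<and> (\<forall>x\<in>X. \<forall>y\<in>X. dist x y < \<delta>) \<longrightarrow> v ` X \<in> cells \<L>)"
proof -
  define st where "st u = - (\<Union>\<kappa>\<in>{\<kappa> \<in> cells \<L>. u \<notin> \<kappa>}. convex hull \<kappa>)" for u
  have op: "open (st u)" for u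
    unfolding st_def using closed_Union_cells[of "{\<kappa> \<in> cells \<L>. u \<notin> \<kappa>}"] by (simp add: open_closed)
  have st: "u \<in> \<kappa>" if "x \<in> st u" "\<kappa> \<in> cells \<L>" "x \<in> convex hull \<kappa>" for x u \<kappa>
    using that unfolding st_def by blast
  have cover: "\<exists>u. x \<in> st u" for x
  proof -
    \<comment> \<open>This is the carrier of \<open>x\<close>. Any other cell over \<open>x\<close>
      meets it in a face whose hull still contains \<open>x\<close>, so by minimality it contains
      the whole carrier; therefore \<open>x\<close> is in the open star of every vertex of the
      carrier.\<close>
    define \<kappa> where "\<kappa> = arg_min card (\<lambda>\<kappa>. \<kappa> \<in> cells \<L> \<and> x \<in> convex hull \<kappa>)"
    obtain \<kappa>' where "\<kappa>' \<in> cells \<L> \<and> x \<in> convex hull \<kappa>'" using cells_cover by blast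
    then have k: "\<kappa> \<in> cells \<L> \<and> x \<in> convex hull \<kappa>"
      and min: "\<And>\<tau>. \<tau> \<in> cells \<L> \<and> x \<in> convex hull \<tau> \<Longrightarrow> card \<kappa> \<le> card \<tau>"
      unfolding \<kappa>_def by (auto intro: arg_min_nat_lemma[THEN conjunct1] dest: arg_min_nat_le)
        (metis (no_types, lifting) arg_min_nat_lemma)+
    obtain u where u: "u \<in> \<kappa>" using k cell_nonempty by blast
    have "u \<in> \<tau>" if t: "\<tau> \<in> cells \<L>" "x \<in> convex hull \<tau>" for \<tau>
    proof -
      have x: "x \<in> convex hull (\<kappa> \<inter> \<tau>)" using cell_Int[of \<kappa> \<tau>] k t by blast
      then have "\<kappa> \<inter> \<tau> \<noteq> {}" by auto
      then have "\<kappa> \<inter> \<tau> \<in> cells \<L>" using cell_subset[of \<kappa> "\<kappa> \<inter> \<tau>"] k by blast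
      then have "card \<kappa> \<le> card (\<kappa> \<inter> \<tau>)" using min x by blast
      then have "\<kappa> \<inter> \<tau> = \<kappa>" using card_seteq[of \<kappa> "\<kappa> \<inter> \<tau>"] k cell_finite by blast
      then show ?thesis using u by blast
    qed
    then have "x \<in> st u" unfolding st_def by blast
    then show ?thesis by blast
  qed
  obtain \<delta> where d: "0 < \<delta>" "\<And>T. \<lbrakk>T \<subseteq> S; diameter T < \<delta>\<rbrakk> \<Longrightarrow> \<exists>B\<in>range st. T \<subseteq> B"
  proof (rule Lebesgue_number_lemma[OF assms, of "range st"])
    show "S \<subseteq> \<Union> (range st)" using cover by blast
  qed (use op in auto)
  \<comment> \<open>A ball of radius \<delta> / 3 has diameter below the Lebesgue number \<delta>,
    so its part in \<open>S\<close> fits into a single open star.\<close>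
  define v where "v x = (SOME u. ball x (\<delta> / 3) \<inter> S \<subseteq> st u)" for x
  have v: "ball x (\<delta> / 3) \<inter> S \<subseteq> st (v x)" for x
  proof -
    have "diameter (ball x (\<delta> / 3) \<inter> S) \<le> diameter (ball x (\<delta> / 3))" by (intro diameter_subset) auto
    then have "diameter (ball x (\<delta> / 3) \<inter> S) < \<delta>" using d(1) by simp
    then have "\<exists>u. ball x (\<delta> / 3) \<inter> S \<subseteq> st u" using d(2)[of "ball x (\<delta> / 3) \<inter> S"] by blast
    then show ?thesis unfolding v_def by (rule someI_ex)
  qed
  have "v x \<in> \<kappa>" if "\<kappa> \<in> cells \<L>" "x \<in> S" "x \<in> convex hull \<kappa>" for \<kappa> x
  proof -
    have "x \<in> st (v x)" using v[of x] that(2) d(1) by auto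
    then show ?thesis using st that by blast
  qed
  moreover have "v ` X \<in> cells \<L>"
    if X: "X \<subseteq> S" "X \<noteq> {}" "\<forall>x\<in>X. \<forall>y\<in>X. dist x y < \<delta> / 3" for X
  proof -
    \<comment> \<open>Because all points of \<open>X\<close> are within \<delta> / 3 of
      \<open>x0\<close>, the open star of each label contains \<open>x0\<close>. So any cell over
      \<open>x0\<close> has all the labels among its vertices.\<close>
    obtain x0 where x0: "x0 \<in> X" using X(2) by blast
    obtain \<kappa> where k: "\<kappa> \<in> cells \<L>" "x0 \<in> convex hull \<kappa>" using cells_cover by blast
    have "v x \<in> \<kappa>" if "x \<in> X" for x
    proof -
      have "x0 \<in> ball x (\<delta> / 3) \<inter> S" using X x0 that by auto
      then show ?thesis using v st k by blast
    qed
    then show ?thesis using cell_subset[OF k(1), of "v ` X"] X(2) by blast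
  qed
  ultimately show ?thesis using d(1) by (intro exI[of _ "\<delta> / 3"] conjI exI[of _ v]) auto
qed

section \<open>Boundaries in the lattice and the filling of finite cycles\<close>

lemma boundary_msum: "boundary \<L> k c = msum (\<lambda>\<kappa>. {\<tau> \<in> cells \<L>. card \<tau> = k \<and> \<tau> \<subseteq> \<kappa>}) c"
proof -
  have "{\<kappa> \<in> c. \<tau> \<in> {\<tau> \<in> cells \<L>. card \<tau> = k \<and> \<tau> \<subseteq> \<kappa>}} =
      (if \<tau> \<in> cells \<L> \<and> card \<tau> = k then {\<kappa> \<in> c. \<tau> \<subseteq> \<kappa>} else {})" for \<tau> by auto
  then show ?thesis unfolding boundary_def msum_def by auto
qed

text \<open>\<open>del\<close> of a single vertex contains the empty set, which is not a cell. With
  \<open>k \<ge> 1\<close> the simplex has at least two vertices, and all members of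
  \<open>del\<close> are cells.\<close>

lemma cell_del:
  assumes "\<kappa> \<in> cells \<L>" "card \<kappa> = k + 1" "k \<ge> 1"
  shows "{\<tau> \<in> cells \<L>. card \<tau> = k \<and> \<tau> \<subseteq> \<kappa>} = del \<kappa>"
proof -
  have fin: "finite \<kappa>" using assms cell_finite by blast
  have "\<kappa> - {x} \<in> cells \<L> \<and> card (\<kappa> - {x}) = k" if "x \<in> \<kappa>" for x
  proof -
    have c: "card (\<kappa> - {x}) = k" using that assms fin by simp
    then have "\<kappa> - {x} \<noteq> {}" using assms(3) by (metis card.empty not_one_le_zero)
    then show ?thesis using c cell_subset[OF assms(1), of "\<kappa> - {x}"] by blast
  qed
  moreover have "\<tau> \<in> del \<kappa>" if "card \<tau> = k" "\<tau> \<subseteq> \<kappa>" for \<tau>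
  proof -
    have "card (\<kappa> - \<tau>) = 1" using that fin assms by (simp add: card_Diff_subset finite_subset)
    then obtain x where "\<kappa> - \<tau> = {x}" by (auto simp: card_1_singleton_iff)
    then have "\<tau> = \<kappa> - {x}" "x \<in> \<kappa>" using that(2) by auto
    then show ?thesis by (auto simp: del_def)
  qed
  ultimately show ?thesis by (auto simp: del_def)
qed

lemma boundary_del:
  assumes "c \<subseteq> {\<kappa> \<in> cells \<L>. card \<kappa> = k + 1}" "k \<ge> 1"
  shows "boundary \<L> k c = msum del c"
  unfolding boundary_msum by (rule msum_cong[OF refl]) (use cell_del assms in blast)

theorem finite_cycle_is_boundary:
  assumes z: "finite z" "z \<subseteq> {\<kappa> \<in> cells \<L>. card \<kappa> = k + 1}" "boundary \<L> k z = {}" and k: "k \<ge> 1"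
  shows "\<exists>w. finite w \<and> w \<subseteq> {\<kappa> \<in> cells \<L>. card \<kappa> = k + 2} \<and> boundary \<L> (k + 1) w = z"
proof -
  have "\<exists>w. finite w \<and> w \<subseteq> cells \<L> \<and> (\<forall>\<kappa>\<in>w. card \<kappa> = Suc (k + 1)) \<and> msum del w = z"
  proof (rule finite_cycle_bounds)
    show "\<And>\<kappa> \<tau>. \<kappa> \<in> cells \<L> \<Longrightarrow> \<tau> \<subseteq> \<kappa> \<Longrightarrow> \<tau> \<noteq> {} \<Longrightarrow> \<tau> \<in> cells \<L>" by (rule cell_subset)
    show "msum del z = {}" using z boundary_del[OF z(2) k] by simp
  qed (use z cell_finite small_sets_labelling in auto)
  then obtain w where w: "finite w" "w \<subseteq> {\<kappa> \<in> cells \<L>. card \<kappa> = (k + 1) + 1}" "msum del w = z" by auto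
  have "boundary \<L> (k + 1) w = z" using boundary_del[OF w(2)] w(3) by simp
  then show ?thesis using w by auto
qed

subsection \<open>Graph distance\<close>

lemma edge_path_singleton [simp]: "edge_path \<L> [v] \<longleftrightarrow> v \<in> verts \<L>"
  by (simp add: edge_path_def)

lemma edge_path_Cons: "edge_path \<L> (u # p) \<longleftrightarrow> u \<in> verts \<L> \<and> (p = [] \<or> adjacent \<L> u (hd p) \<and> edge_path \<L> p)"
  by (auto simp: edge_path_def successively_Cons)

lemma edge_path_append:
  assumes "edge_path \<L> p" "edge_path \<L> q" "last p = hd q"
  shows "edge_path \<L> (p @ tl q)" "hd (p @ tl q) = hd p" "last (p @ tl q) = last q"
    "path_length (p @ tl q) = path_length p + path_length q"
proof -
  obtain x q' where q: "q = x # q'" using assms(2) by (cases q) (auto simp: edge_path_def)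
  show "hd (p @ tl q) = hd p" using assms by (simp add: edge_path_def)
  show "last (p @ tl q) = last q" using assms q by (auto simp: edge_path_def)
  show "edge_path \<L> (p @ tl q)" using assms q
    by (auto simp: edge_path_def successively_append_iff successively_Cons)
  have "length p \<ge> 1" using assms(1) by (cases p) (auto simp: edge_path_def)
  then show "path_length (p @ tl q) = path_length p + path_length q" by (simp add: path_length_def q)
qed

lemma edge_path_rev: "edge_path \<L> p \<Longrightarrow> edge_path \<L> (rev p)"
  unfolding edge_path_def by (auto simp: adjacent_sym)

lemma edge_path_shift:
  assumes "edge_path \<L> p" "a \<in> shifts \<L>" shows "edge_path \<L> (map ((+) a) p)"
proof -
  have "successively (\<lambda>x y. adjacent \<L> (a + x) (a + y)) p"
    using assms adjacent_shift unfolding edge_path_def by (auto intro: successively_mono)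
  then show ?thesis
    using assms cell_vert_shift unfolding edge_path_def by (auto simp: successively_map)
qed

lemma edge_path_ends: "edge_path \<L> p \<Longrightarrow> hd p \<in> verts \<L> \<and> last p \<in> verts \<L>"
  unfolding edge_path_def by auto

lemma gdist_le:
  assumes "edge_path \<L> p" "hd p = u" "last p = v"
  shows "gdist \<L> u v \<le> path_length p"
  unfolding gdist_def using assms by (intro wellorder_Inf_le1) blast

text \<open>Labels of closely spaced points on the segment from \<open>u\<close> to \<open>v\<close>
  give an edge path, up to repetitions: consecutive labels lie in a common cell, and each end of the
  segment is its own label.\<close>

lemma connected_skeleton:
  assumes "u \<in> verts \<L>" "v \<in> verts \<L>"
  shows "\<exists>p. edge_path \<L> p \<and> hd p = u \<and> last p = v"
proof -
  define conn where "conn x y \<longleftrightarrow> (\<exists>p. edge_path \<L> p \<and> hd p = x \<and> last p = y)" for x y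
  from small_sets_labelling[OF compact_segment, of u v] obtain \<delta> w where d: "\<delta> > 0"
    and w: "\<forall>\<kappa>\<in>cells \<L>. \<forall>x\<in>closed_segment u v. x \<in> convex hull \<kappa> \<longrightarrow> w x \<in> \<kappa>"
      "\<forall>X. X \<subseteq> closed_segment u v \<and> X \<noteq> {} \<and> finite X \<and> (\<forall>x\<in>X. \<forall>y\<in>X. dist x y < \<delta>) \<longrightarrow> w ` X \<in> cells \<L>"
    by (elim exE conjE)
  have w1: "w x \<in> \<kappa>" if "\<kappa> \<in> cells \<L>" "x \<in> closed_segment u v" "x \<in> convex hull \<kappa>" for \<kappa> x
    using that w(1) by simp
  have w2: "w ` X \<in> cells \<L>"
    if "X \<subseteq> closed_segment u v" "X \<noteq> {}" "finite X" "\<forall>x\<in>X. \<forall>y\<in>X. dist x y < \<delta>" for X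
    using that w(2) by simp
  obtain N where N: "norm (v - u) / \<delta> < real N" using reals_Archimedean2 by blast
  have N0: "N > 0" using N d by (metis divide_nonneg_pos gr0I norm_ge_zero not_less of_nat_0)
  define x where "x i = u + (real i / real N) *\<^sub>R (v - u)" for i
  have seg: "x i \<in> closed_segment u v" if "i \<le> N" for i
    unfolding closed_segment_def x_def using that N0
    by (auto intro!: exI[of _ "real i / real N"] simp: algebra_simps)
  have step: "x (Suc i) - x i = (1 / real N) *\<^sub>R (v - u)" for i
    by (simp add: x_def scaleR_left_diff_distrib[symmetric] add_divide_distrib)
  have dist: "dist (x (Suc i)) (x i) < \<delta>" for i
  proof -
    have "dist (x (Suc i)) (x i) = norm (v - u) / real N" by (simp add: dist_norm step)
    also have "\<dots> < \<delta>" using N N0 d by (simp add: field_simps)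
    finally show ?thesis .
  qed
  have "conn u (w (x i))" if "i \<le> N" for i
    using that
  proof (induction i)
    case 0
    have "w (x 0) \<in> {u}" using w1[of "{u}" "x 0"] assms seg[of 0] by (simp add: verts_def x_def)
    then show ?case using assms by (auto simp: conn_def intro!: exI[of _ "[u]"])
  next
    case (Suc i)
    then obtain p where p: "edge_path \<L> p" "hd p = u" "last p = w (x i)" by (auto simp: conn_def)
    have c: "w ` {x i, x (Suc i)} \<in> cells \<L>"
      using Suc seg[of i] seg[of "Suc i"] dist[of i] d by (intro w2) (auto simp: dist_commute)
    show ?case
    proof (cases "w (x i) = w (x (Suc i))")
      case True then show ?thesis using p by (auto simp: conn_def)
    next
      case False
      have "adjacent \<L> (w (x i)) (w (x (Suc i)))" using cell_adjacent[OF c] False by simp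
      then have e: "edge_path \<L> [w (x i), w (x (Suc i))]" using adjacent_verts by (simp add: edge_path_Cons)
      show ?thesis using edge_path_append(1,2,3)[OF p(1) e] p by (auto simp: conn_def)
    qed
  qed
  moreover have "w (x N) \<in> {v}" using w1[of "{v}" "x N"] assms seg[of N] N0 by (simp add: verts_def x_def)
  ultimately show ?thesis by (force simp: conn_def)
qed

lemma gdist_path:
  assumes "u \<in> verts \<L>" "v \<in> verts \<L>"
  obtains p where "edge_path \<L> p" "hd p = u" "last p = v" "path_length p = gdist \<L> u v"
proof -
  have "{path_length p |p. edge_path \<L> p \<and> hd p = u \<and> last p = v} \<noteq> {}"
    using connected_skeleton[OF assms] by blast
  from Inf_nat_def1[OF this] show ?thesis using that unfolding gdist_def by auto
qed

lemma gdist_self [simp]: "v \<in> verts \<L> \<Longrightarrow> gdist \<L> v v = 0"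
  using gdist_le[of "[v]" v v] by (simp add: path_length_def)

lemma gdist_eq_0:
  assumes "u \<in> verts \<L>" "v \<in> verts \<L>" "gdist \<L> u v = 0" shows "u = v"
proof -
  obtain p where "edge_path \<L> p" "hd p = u" "last p = v" "path_length p = 0"
    using gdist_path[OF assms(1,2)] assms(3) by metis
  then show ?thesis by (cases p) (auto simp: path_length_def edge_path_def)
qed

lemma gdist_triangle:
  assumes "u \<in> verts \<L>" "v \<in> verts \<L>" "w \<in> verts \<L>"
  shows "gdist \<L> u w \<le> gdist \<L> u v + gdist \<L> v w"
proof -
  obtain p where p: "edge_path \<L> p" "hd p = u" "last p = v" "path_length p = gdist \<L> u v"
    using gdist_path[OF assms(1,2)] by metis
  obtain q where q: "edge_path \<L> q" "hd q = v" "last q = w" "path_length q = gdist \<L> v w"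
    using gdist_path[OF assms(2,3)] by metis
  have "last p = hd q" using p q by simp
  from edge_path_append[OF p(1) q(1) this] show ?thesis using gdist_le p q by metis
qed

lemma gdist_commute_le:
  assumes "u \<in> verts \<L>" "v \<in> verts \<L>" shows "gdist \<L> v u \<le> gdist \<L> u v"
proof -
  obtain p where p: "edge_path \<L> p" "hd p = u" "last p = v" "path_length p = gdist \<L> u v"
    using gdist_path[OF assms] by metis
  then have "gdist \<L> v u \<le> path_length (rev p)"
    by (intro gdist_le edge_path_rev) (auto simp: edge_path_def hd_rev last_rev)
  then show ?thesis using p by (simp add: path_length_def)
qed

lemma gdist_commute: "u \<in> verts \<L> \<Longrightarrow> v \<in> verts \<L> \<Longrightarrow> gdist \<L> u v = gdist \<L> v u"
  using gdist_commute_le by (simp add: antisym)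

lemma gdist_shift_le:
  assumes "u \<in> verts \<L>" "v \<in> verts \<L>" "a \<in> shifts \<L>"
  shows "gdist \<L> (a + u) (a + v) \<le> gdist \<L> u v"
proof -
  obtain p where p: "edge_path \<L> p" "hd p = u" "last p = v" "path_length p = gdist \<L> u v"
    using gdist_path[OF assms(1,2)] by metis
  then have "gdist \<L> (a + u) (a + v) \<le> path_length (map ((+) a) p)"
    using assms(3) by (intro gdist_le edge_path_shift) (auto simp: edge_path_def hd_map last_map)
  then show ?thesis using p by (simp add: path_length_def)
qed

lemma gdist_shift:
  assumes "u \<in> verts \<L>" "v \<in> verts \<L>" "a \<in> shifts \<L>"
  shows "gdist \<L> (a + u) (a + v) = gdist \<L> u v"
  using gdist_shift_le[OF assms] gdist_shift_le[of "a + u" "a + v" "- a"] assms cell_vert_shift uminus_shifts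
  by (simp add: antisym)

lemma gdist_adjacent:
  assumes "adjacent \<L> u v" shows "gdist \<L> u v \<le> 1"
  using gdist_le[of "[u, v]" u v] assms adjacent_verts by (auto simp: edge_path_Cons path_length_def)

lemma gdist_cell:
  assumes "\<kappa> \<in> cells \<L>" "u \<in> \<kappa>" "v \<in> \<kappa>" shows "gdist \<L> u v \<le> 1"
  using gdist_adjacent[OF cell_adjacent[OF assms]] gdist_self[OF cell_vert[OF assms(1,3)]] by fastforce

subsection \<open>Closed paths on the torus\<close>

lemma polygonal_path:
  assumes "p \<noteq> []"
  shows "path (polygonal_path p) \<and> pathstart (polygonal_path p) = hd p \<and> pathfinish (polygonal_path p) = last p"
  using assms by (induction p rule: polygonal_path.induct) auto

lemma winding_number_constant_loop:
  fixes c :: complex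
  assumes "c \<noteq> 0" shows "winding_number (linepath c c) 0 = 0"
proof -
  have "linepath c c = exp \<circ> linepath (Ln c) (Ln c)"
    using assms by (auto simp: linepath_def fun_eq_iff algebra_simps)
  then show ?thesis using winding_number_compose_exp[of "linepath (Ln c) (Ln c)"] by simp
qed

text \<open>If coordinate \<open>i\<close> of the displacement in units of the periods is not zero,
  then coordinate \<open>i\<close> of the projected path is a loop around the origin with that
  winding number. A contractible loop has winding number 0.\<close>

lemma noncontractible_displacement:
  assumes p: "edge_path \<L> p" and a: "last p = a + hd p" "a \<in> shifts \<L>" "a \<noteq> 0"
  shows "noncontractible \<L> p"
proof -
  obtain z where z: "a = periods \<L> *v z" "\<forall>i. z $ i \<in> \<int>" using a(2) by (auto simp: shifts_def)
  have "z \<noteq> 0" using z(1) a(3) by auto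
  then obtain i where i: "z $ i \<noteq> 0" by (auto simp: vec_eq_iff)
  have inv: "matrix_inv (periods \<L>) *v (a + x) = z + matrix_inv (periods \<L>) *v x" for x
    by (simp add: z(1) matrix_vector_right_distrib inv_periods)
  have "cis (2 * pi * (z $ j + t)) = cis (2 * pi * t)" for j t
  proof -
    have "cis (2 * pi * z $ j) = 1" using z(2) by (metis Ints_cases cis_multiple_2pi Ints_of_int)
    then show ?thesis by (simp add: ring_distribs cis_mult[symmetric])
  qed
  then have ends: "torus_proj \<L> (hd p) = torus_proj \<L> (last p)"
    unfolding torus_proj_def a(1) inv by simp
  have "\<not> homotopic_loops torus (torus_proj \<L> \<circ> polygonal_path p) (linepath c c)" for c
  proof
    assume hom: "homotopic_loops torus (torus_proj \<L> \<circ> polygonal_path p) (linepath c c)"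
    \<comment> \<open>\<open>g\<close> is a continuous logarithm of coordinate \<open>i\<close> of
      the projected path, so the winding number can be read off from its ends.\<close>
    define g where "g t = 2 * of_real pi * \<i> * of_real ((matrix_inv (periods \<L>) *v polygonal_path p t) $ i)" for t
    have pp: "path (polygonal_path p)" "pathstart (polygonal_path p) = hd p" "pathfinish (polygonal_path p) = last p"
      using polygonal_path[of p] p by (auto simp: edge_path_def)
    have "path g"
      unfolding path_def g_def using pp(1) unfolding path_def
      by (intro continuous_intros continuous_on_component)
        (auto intro: continuous_on_compose2[OF matrix_vector_mult_linear_continuous_on])
    have "homotopic_loops (- {0}) ((\<lambda>x. x $ i) \<circ> (torus_proj \<L> \<circ> polygonal_path p)) ((\<lambda>x. x $ i) \<circ> linepath c c)"
      by (rule homotopic_loops_continuous_image[OF hom])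
        (auto intro!: continuous_intros simp: torus_def, metis norm_zero zero_neq_one)
    moreover have "(\<lambda>x. x $ i) \<circ> (torus_proj \<L> \<circ> polygonal_path p) = exp \<circ> g"
      by (auto simp: torus_proj_def fun_eq_iff cis_conv_exp g_def mult_ac)
    moreover have "(\<lambda>x. x $ i) \<circ> linepath c c = linepath (c $ i) (c $ i)"
      by (auto simp: linepath_def fun_eq_iff algebra_simps)
    ultimately have hl: "homotopic_loops (- {0}) (exp \<circ> g) (linepath (c $ i) (c $ i))" by simp
    have "c $ i \<noteq> 0" using homotopic_loops_imp_subset[OF hl] by auto
    then have "winding_number (exp \<circ> g) 0 = 0"
      using winding_number_homotopic_loops[OF hl] winding_number_constant_loop by simp
    then have "pathfinish g = pathstart g"
      using winding_number_compose_exp[OF \<open>path g\<close>] by simp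
    then have "(matrix_inv (periods \<L>) *v last p) $ i = (matrix_inv (periods \<L>) *v hd p) $ i"
      using pp unfolding g_def pathfinish_def pathstart_def by simp
    then show False using i unfolding a(1) inv by simp
  qed
  then show ?thesis using p ends unfolding noncontractible_def by blast
qed

text \<open>A path to a nontrivial translate projects to a noncontractible loop. The bound keeps
  cells of one orbit apart, so that a small tree meets each orbit at most once.\<close>

lemma linear_size_le_gdist:
  assumes "v \<in> verts \<L>" "a \<in> shifts \<L>" "a \<noteq> 0"
  shows "linear_size \<L> \<le> gdist \<L> v (a + v)"
proof -
  obtain p where p: "edge_path \<L> p" "hd p = v" "last p = a + v" "path_length p = gdist \<L> v (a + v)"
    using gdist_path[OF assms(1) cell_vert_shift[OF assms(1,2)]] by metis
  have "noncontractible \<L> p" using noncontractible_displacement[OF p(1) _ assms(2,3)] p by simp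
  then have "linear_size \<L> \<le> path_length p"
    unfolding linear_size_def by (intro wellorder_Inf_le1) blast
  then show ?thesis using p by simp
qed

end

section \<open>Sweeping\<close>

lemma restr_subset: "restr \<sigma> v \<subseteq> \<sigma>" and mem_restr: "\<kappa> \<in> restr \<sigma> v \<longleftrightarrow> \<kappa> \<in> \<sigma> \<and> v \<in> \<kappa>"
  by (auto simp: restr_def)

context torus_triangulation
begin

section \<open>Diameters, local regions and ascending paths\<close>

lemma gdist_le_diam: "u \<in> V \<Longrightarrow> v \<in> V \<Longrightarrow> enat (gdist \<L> u v) \<le> diam \<L> V"
  unfolding diam_def by (meson SUP_upper2 order_refl)

lemma diam_le: "(\<And>u v. u \<in> V \<Longrightarrow> v \<in> V \<Longrightarrow> gdist \<L> u v \<le> n) \<Longrightarrow> diam \<L> V \<le> enat n"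
  unfolding diam_def by (intro SUP_least) simp

lemma local_regionI:
  assumes "V \<subseteq> verts \<L>" "\<And>u v. u \<in> V \<Longrightarrow> v \<in> V \<Longrightarrow> gdist \<L> u v \<le> n" "real n \<le> l * real (linear_size \<L>)"
  shows "local_region \<L> l V"
proof -
  have "ereal_of_enat (diam \<L> V) \<le> ereal_of_enat (enat n)"
    using diam_le[of V n] assms(2) by (simp only: ereal_of_enat_le_iff)
  also have "\<dots> \<le> ereal (l * real (linear_size \<L>))" using assms(3) by simp
  finally show ?thesis using assms(1) by (simp add: local_region_def)
qed

text \<open>This is \<open>precedes\<close> with the number of edges retained, because that number
  limits the lifetime of a syndrome.\<close>

definition ascends :: "real ^ 'd \<Rightarrow> real ^ 'd \<Rightarrow> nat \<Rightarrow> bool" where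
  "ascends u w n \<longleftrightarrow> (\<exists>p. edge_path \<L> p \<and> hd p = u \<and> last p = w \<and> path_length p = n \<and>
     successively (\<lambda>x y. sweep_dir \<L> \<bullet> (y - x) > 0) p)"

lemma precedes_ascends: "precedes \<L> u w \<longleftrightarrow> (\<exists>n. ascends u w n)"
  unfolding precedes_def causal_path_def ascends_def by blast

lemma ascends_append: "ascends u v m \<Longrightarrow> ascends v w n \<Longrightarrow> ascends u w (m + n)"
proof -
  assume "ascends u v m" "ascends v w n"
  then obtain p q where p: "edge_path \<L> p" "hd p = u" "last p = v" "path_length p = m"
     "successively (\<lambda>x y. sweep_dir \<L> \<bullet> (y - x) > 0) p"
   and q: "edge_path \<L> q" "hd q = v" "last q = w" "path_length q = n"
     "successively (\<lambda>x y. sweep_dir \<L> \<bullet> (y - x) > 0) q"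
    unfolding ascends_def by blast
  have e: "last p = hd q" using p q by simp
  obtain x q' where q': "q = x # q'" using q(1) by (cases q) (auto simp: edge_path_def)
  have "successively (\<lambda>x y. sweep_dir \<L> \<bullet> (y - x) > 0) (p @ tl q)"
    using p(5) q(5) e q' by (auto simp: successively_append_iff successively_Cons)
  then show ?thesis
    unfolding ascends_def using edge_path_append[OF p(1) q(1) e] p q by metis
qed

lemma ascends_edge: "adjacent \<L> u v \<Longrightarrow> sweep_dir \<L> \<bullet> (v - u) > 0 \<Longrightarrow> ascends u v 1"
  unfolding ascends_def
  by (intro exI[of _ "[u, v]"]) (auto simp: edge_path_Cons path_length_def adjacent_verts)

lemma ascends_verts: "ascends u v n \<Longrightarrow> u \<in> verts \<L> \<and> v \<in> verts \<L>"
  unfolding ascends_def using edge_path_ends by blast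

lemma ascends_sweep: "ascends u v n \<Longrightarrow> 0 \<le> sweep_dir \<L> \<bullet> (v - u)"
proof -
  have *: "successively (\<lambda>x y. sweep_dir \<L> \<bullet> (y - x) > 0) p \<Longrightarrow> p \<noteq> [] \<Longrightarrow>
     sweep_dir \<L> \<bullet> hd p \<le> sweep_dir \<L> \<bullet> last p" for p
    by (induction p) (fastforce simp: successively_Cons inner_diff_right)+
  assume "ascends u v n"
  then show ?thesis using * unfolding ascends_def by (fastforce simp: inner_diff_right edge_path_def)
qed

lemma precedes_refl: "v \<in> verts \<L> \<Longrightarrow> precedes \<L> v v"
  unfolding precedes_ascends ascends_def by (intro exI[of _ 0] exI[of _ "[v]"]) (auto simp: path_length_def)

lemma precedes_trans: "precedes \<L> u v \<Longrightarrow> precedes \<L> v w \<Longrightarrow> precedes \<L> u w"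
  unfolding precedes_ascends using ascends_append by blast

lemma precedes_verts: "precedes \<L> u v \<Longrightarrow> u \<in> verts \<L> \<and> v \<in> verts \<L>"
  unfolding precedes_ascends using ascends_verts by blast

text \<open>The path that witnesses the order need not be the edge. It makes the sweep component of
  the edge nonnegative, and on an edge this component is never zero.\<close>

lemma adjacent_precedes_ascends: "adjacent \<L> u v \<Longrightarrow> precedes \<L> u v \<Longrightarrow> ascends u v 1"
  using sweep_edge[of u v] ascends_sweep[of u v] ascends_edge[of u v] unfolding precedes_ascends by fastforce

lemma adjacent_precedes_cases:
  assumes "adjacent \<L> u v" shows "precedes \<L> u v \<or> precedes \<L> v u"
proof -
  have "sweep_dir \<L> \<bullet> (v - u) > 0 \<or> sweep_dir \<L> \<bullet> (u - v) > 0"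
    using sweep_edge[OF assms] by (auto simp: inner_diff_right)
  then show ?thesis using ascends_edge[of u v] ascends_edge[of v u] assms adjacent_sym[of u v] precedes_ascends by blast
qed

lemma ascends_shift: "ascends u v n \<Longrightarrow> a \<in> shifts \<L> \<Longrightarrow> ascends (a + u) (a + v) n"
proof -
  assume "ascends u v n" and a: "a \<in> shifts \<L>"
  then obtain p where p: "edge_path \<L> p" "hd p = u" "last p = v" "path_length p = n"
     "successively (\<lambda>x y. sweep_dir \<L> \<bullet> (y - x) > 0) p" unfolding ascends_def by blast
  have "p \<noteq> []" using p(1) by (simp add: edge_path_def)
  then show ?thesis unfolding ascends_def using p edge_path_shift[OF p(1) a]
    by (intro exI[of _ "map ((+) a) p"]) (auto simp: hd_map last_map path_length_def successively_map)
qed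

lemma precedes_shift:
  assumes "a \<in> shifts \<L>" shows "precedes \<L> (a + u) (a + v) \<longleftrightarrow> precedes \<L> u v"
  using ascends_shift[of u v _ a] ascends_shift[of "a + u" "a + v" _ "- a"] assms uminus_shifts
  unfolding precedes_ascends by auto

lemma cell_shift_iff: "a \<in> shifts \<L> \<Longrightarrow> (+) a ` \<kappa> \<in> cells \<L> \<longleftrightarrow> \<kappa> \<in> cells \<L>"
  using cell_shift[of \<kappa> a] cell_shift[of "(+) a ` \<kappa>" "- a"] uminus_shifts[of a] by (auto simp: image_image)

lemma future_shift:
  assumes "a \<in> shifts \<L>" shows "future \<L> (a + v) = shift a (future \<L> v)"
proof -
  have 1: "(+) (- a) ` \<kappa> \<in> cells \<L> \<longleftrightarrow> \<kappa> \<in> cells \<L>" for \<kappa>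
    using cell_shift_iff[OF uminus_shifts[OF assms]] .
  have 2: "precedes \<L> (a + v) u \<longleftrightarrow> precedes \<L> v (- a + u)" for u
    using precedes_shift[OF assms, of v "- a + u"] by simp
  have "\<kappa> \<in> future \<L> (a + v) \<longleftrightarrow> \<kappa> \<in> shift a (future \<L> v)" for \<kappa>
    unfolding mem_shift future_def mem_Collect_eq 1 ball_simps 2 by blast
  then show ?thesis by blast
qed

lemma restr_shift: "restr (shift a \<sigma>) (a + v) = shift a (restr \<sigma> v)"
  by (auto simp: mem_restr mem_shift image_iff algebra_simps)

section \<open>Invariant chains and locally finite sums of translates\<close>

lemma boundary_subset: "boundary \<L> k c \<subseteq> {\<tau> \<in> cells \<L>. card \<tau> = k}"
  by (auto simp: boundary_def)

lemma boundary_mem_subset: "\<tau> \<in> boundary \<L> k c \<Longrightarrow> \<exists>\<kappa>\<in>c. \<tau> \<subseteq> \<kappa>"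
  unfolding boundary_msum by (auto elim!: msumE)

lemma finite_boundary: assumes "finite c" "c \<subseteq> cells \<L>" shows "finite (boundary \<L> k c)"
proof -
  have "boundary \<L> k c \<subseteq> Pow (\<Union>c)" using boundary_mem_subset by blast
  moreover have "finite (\<Union>c)" using assms cell_finite by blast
  ultimately show ?thesis by (meson finite_Pow_iff finite_subset)
qed

lemma finite_above: "c \<subseteq> cells \<L> \<Longrightarrow> finite {\<kappa> \<in> c. \<tau> \<in> {\<tau> \<in> cells \<L>. card \<tau> = k \<and> \<tau> \<subseteq> \<kappa>}}"
proof (cases "\<tau> \<in> cells \<L>")
  case True
  assume "c \<subseteq> cells \<L>"
  then have "{\<kappa> \<in> c. \<tau> \<in> {\<tau> \<in> cells \<L>. card \<tau> = k \<and> \<tau> \<subseteq> \<kappa>}} \<subseteq> {\<kappa> \<in> cells \<L>. \<tau> \<subseteq> \<kappa>}"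
    by auto
  then show ?thesis using finite_cells_above[OF cell_nonempty[OF True]] by (rule finite_subset)
qed simp

lemma boundary_sym_diff:
  assumes "c \<subseteq> cells \<L>" "c' \<subseteq> cells \<L>"
  shows "boundary \<L> k (sym_diff c c') = sym_diff (boundary \<L> k c) (boundary \<L> k c')"
  unfolding boundary_msum by (intro msum_sym_diff finite_above assms)

lemma boundary_shift:
  assumes a: "a \<in> shifts \<L>" shows "boundary \<L> k (shift a c) = shift a (boundary \<L> k c)"
proof -
  let ?f = "\<lambda>\<kappa>. {\<tau> \<in> cells \<L>. card \<tau> = k \<and> \<tau> \<subseteq> \<kappa>}"
  have "?f ((+) a ` \<kappa>) = shift a (?f \<kappa>)" for \<kappa>
  proof -
    have "(+) (- a) ` \<tau> \<subseteq> \<kappa> \<longleftrightarrow> \<tau> \<subseteq> (+) a ` \<kappa>" for \<tau>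
    proof -
      have "\<tau> = (+) a ` (+) (- a) ` \<tau>" by (simp add: image_image)
      then have "\<tau> \<subseteq> (+) a ` \<kappa> \<longleftrightarrow> (+) a ` (+) (- a) ` \<tau> \<subseteq> (+) a ` \<kappa>" by simp
      also have "\<dots> \<longleftrightarrow> (+) (- a) ` \<tau> \<subseteq> \<kappa>" by (intro inj_image_subset_iff) simp
      finally show ?thesis by simp
    qed
    then show ?thesis
      using cell_shift_iff[OF uminus_shifts[OF a]] by (auto simp: mem_shift card_image)
  qed
  then have "boundary \<L> k (shift a c) = msum (\<lambda>\<kappa>. shift a (?f \<kappa>)) c"
    unfolding boundary_msum shift_def[of a c] by (subst msum_image) (auto intro: inj_on_subset[OF inj_plus_image])
  then show ?thesis unfolding boundary_msum unfolding shift_def by (simp add: image_msum inj_plus_image)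
qed

lemma chains_iff:
  "c \<in> chains \<L> i \<longleftrightarrow> c \<subseteq> {\<kappa> \<in> cells \<L>. card \<kappa> = i + 1} \<and> (\<forall>a\<in>shifts \<L>. shift a c \<subseteq> c)"
proof
  assume "c \<in> chains \<L> i"
  then obtain S where S: "S \<subseteq> simplices \<L> i" "c = \<Union>S" by (auto simp: chains_def)
  have *: "\<kappa> \<in> cells \<L> \<and> card \<kappa> = i + 1 \<and> (+) b ` \<kappa> \<in> c" if k: "\<kappa> \<in> c" "b \<in> shifts \<L>" for \<kappa> b
  proof -
    obtain \<tau> where t: "\<tau> \<in> cells \<L>" "card \<tau> = i + 1" "orbit \<L> \<tau> \<in> S" "\<kappa> \<in> orbit \<L> \<tau>"
      using k S unfolding simplices_def by blast
    then obtain a where a: "a \<in> shifts \<L>" "\<kappa> = (+) a ` \<tau>" by (auto simp: orbit_def)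
    have "(+) b ` \<kappa> = (+) (b + a) ` \<tau>" by (simp add: a(2) image_image add.assoc)
    then have "(+) b ` \<kappa> \<in> orbit \<L> \<tau>" using add_shifts[OF k(2) a(1)] by (auto simp: orbit_def)
    then show ?thesis using a t cell_shift S(2) by (auto simp: card_image)
  qed
  show "c \<subseteq> {\<kappa> \<in> cells \<L>. card \<kappa> = i + 1} \<and> (\<forall>a\<in>shifts \<L>. shift a c \<subseteq> c)"
    using *[OF _ zero_shifts] * unfolding shift_def by blast
next
  assume c: "c \<subseteq> {\<kappa> \<in> cells \<L>. card \<kappa> = i + 1} \<and> (\<forall>a\<in>shifts \<L>. shift a c \<subseteq> c)"
  have "orbit \<L> \<kappa> \<subseteq> c" if "\<kappa> \<in> c" for \<kappa> using c that unfolding orbit_def shift_def by blast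
  moreover have "\<kappa> \<in> orbit \<L> \<kappa>" for \<kappa> unfolding orbit_def by (rule image_eqI[of _ _ 0]) auto
  ultimately have "c = \<Union>(orbit \<L> ` c)" by blast
  moreover have "orbit \<L> ` c \<subseteq> simplices \<L> i" using c by (auto simp: simplices_def)
  ultimately show "c \<in> chains \<L> i" unfolding chains_def by blast
qed

lemma shift_inverse_subset:
  assumes "\<forall>a\<in>shifts \<L>. shift a c \<subseteq> c" "a \<in> shifts \<L>" shows "shift a c = c"
proof
  have "shift (- a) c \<subseteq> c" using assms(1) uminus_shifts[OF assms(2)] by blast
  then have "shift a (shift (- a) c) \<subseteq> shift a c" unfolding shift_def[of a] by (rule image_mono)
  then show "c \<subseteq> shift a c" by (simp add: shift_shift)
qed (use assms in auto)

text \<open>The chain of the torus whose lift consists of all translates of the finite chains \<open>f r\<close>.\<close>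

definition periodic :: "'r set \<Rightarrow> ('r \<Rightarrow> (real ^ 'd) set set) \<Rightarrow> (real ^ 'd) set set" where
  "periodic R f = msum (\<lambda>(a, r). shift a (f r)) (shifts \<L> \<times> R)"

text \<open>A cell is the translate of a given cell \<tau> by at most one shift. So the terms that
  contain \<kappa> are determined by pairs of an index \<open>r\<close> and a member \<tau> of
  \<open>f r\<close>, of which there are finitely many.\<close>

lemma periodic_locally_finite:
  fixes f :: "'r \<Rightarrow> (real ^ 'd) set set"
  assumes "finite R" "\<And>r. r \<in> R \<Longrightarrow> finite (f r) \<and> f r \<subseteq> cells \<L>"
  shows "finite {x \<in> shifts \<L> \<times> R. \<kappa> \<in> (case x of (a, r) \<Rightarrow> shift a (f r))}"
proof -
  define g where "g = (\<lambda>(r :: 'r, \<tau>). (SOME a. \<kappa> = (+) a ` \<tau>, r))"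
  have "{x \<in> shifts \<L> \<times> R. \<kappa> \<in> (case x of (a, r) \<Rightarrow> shift a (f r))} \<subseteq> g ` (Sigma R f)"
  proof
    fix x assume "x \<in> {x \<in> shifts \<L> \<times> R. \<kappa> \<in> (case x of (a, r) \<Rightarrow> shift a (f r))}"
    then obtain a r \<tau> where x: "x = (a, r)" "r \<in> R" "\<tau> \<in> f r" "\<kappa> = (+) a ` \<tau>"
      by (auto simp: shift_def)
    have \<tau>: "finite \<tau>" "\<tau> \<noteq> {}" using assms(2)[OF x(2)] x(3) cell_finite cell_nonempty by auto
    have "b = a" if "\<kappa> = (+) b ` \<tau>" for b
    proof -
      have "(+) (b - a) ` \<tau> = (+) (- a) ` (+) b ` \<tau>" by (simp add: image_image algebra_simps)
      also have "\<dots> = \<tau>" using that x(4) by (simp add: image_image flip: that)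
      finally show ?thesis using plus_image_eq_self[of "b - a" \<tau>] \<tau> by simp
    qed
    then have "(SOME b. \<kappa> = (+) b ` \<tau>) = a" using x(4) by (intro some_equality) auto
    then have "g (r, \<tau>) = x" using x(1) by (simp add: g_def)
    then show "x \<in> g ` (Sigma R f)" using x by (metis SigmaI imageI)
  qed
  moreover have "finite (g ` Sigma R f)" using assms by (intro finite_imageI finite_SigmaI) auto
  ultimately show ?thesis by (rule finite_subset)
qed

lemma periodic_cong: "(\<And>r. r \<in> R \<Longrightarrow> f r = g r) \<Longrightarrow> periodic R f = periodic R g"
  unfolding periodic_def by (rule msum_cong) auto

lemma periodic_empty: "(\<And>r. r \<in> R \<Longrightarrow> f r = {}) \<Longrightarrow> periodic R f = {}"
proof -
  assume "\<And>r. r \<in> R \<Longrightarrow> f r = {}"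
  then have "(\<Union>x\<in>shifts \<L> \<times> R. case x of (a, r) \<Rightarrow> shift a (f r)) = {}" by auto
  then show ?thesis unfolding periodic_def using msum_subset[of "\<lambda>(a, r). shift a (f r)" "shifts \<L> \<times> R"]
    by (metis subset_empty)
qed

lemma periodic_sym_diff:
  assumes "finite R" "\<And>r. r \<in> R \<Longrightarrow> finite (f r) \<and> f r \<subseteq> cells \<L>" "\<And>r. r \<in> R \<Longrightarrow> finite (g r) \<and> g r \<subseteq> cells \<L>"
  shows "periodic R (\<lambda>r. sym_diff (f r) (g r)) = sym_diff (periodic R f) (periodic R g)"
proof -
  have "periodic R (\<lambda>r. sym_diff (f r) (g r)) =
    msum (\<lambda>x. sym_diff (case x of (a, r) \<Rightarrow> shift a (f r)) (case x of (a, r) \<Rightarrow> shift a (g r))) (shifts \<L> \<times> R)"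
    unfolding periodic_def by (rule msum_cong[OF refl]) (auto simp: mem_shift)
  then show ?thesis unfolding periodic_def using periodic_locally_finite[OF assms(1)] assms(2,3)
    by (subst (asm) msum_fun_sym_diff) auto
qed

text \<open>The sums may be interchanged because \<tau> lies below finitely many cells and each of
  these occurs in finitely many translates.\<close>

lemma boundary_periodic:
  assumes "finite R" "\<And>r. r \<in> R \<Longrightarrow> finite (f r) \<and> f r \<subseteq> cells \<L>"
  shows "boundary \<L> j (periodic R f) = periodic R (\<lambda>r. boundary \<L> j (f r))"
proof -
  let ?b = "\<lambda>\<kappa>. {\<tau> \<in> cells \<L>. card \<tau> = j \<and> \<tau> \<subseteq> \<kappa>}"
  let ?f = "\<lambda>(a, r). shift a (f r)"
  have fin: "finite {(x, \<kappa>). x \<in> shifts \<L> \<times> R \<and> \<kappa> \<in> ?f x \<and> \<tau> \<in> ?b \<kappa>}" for \<tau>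
  proof (cases "\<tau> \<in> cells \<L>")
    case True
    have "?f x \<subseteq> cells \<L>" if xR: "x \<in> shifts \<L> \<times> R" for x
    proof -
      obtain a r where x: "x = (a, r)" "a \<in> shifts \<L>" "r \<in> R" using xR by blast
      have "shift a (f r) \<subseteq> cells \<L>" unfolding shift_def using assms(2)[OF x(3)] cell_shift[OF _ x(2)] by blast
      then show ?thesis using x by simp
    qed
    then have sub: "\<kappa> \<in> cells \<L>" if "x \<in> shifts \<L> \<times> R" "\<kappa> \<in> ?f x" for x \<kappa> using that by blast
    have "{(x, \<kappa>). x \<in> shifts \<L> \<times> R \<and> \<kappa> \<in> ?f x \<and> \<tau> \<in> ?b \<kappa>} \<subseteq>
      (\<lambda>(\<kappa>, x). (x, \<kappa>)) ` (SIGMA \<kappa> : {\<kappa> \<in> cells \<L>. \<tau> \<subseteq> \<kappa>}. {x \<in> shifts \<L> \<times> R. \<kappa> \<in> ?f x})"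
    proof
      fix y assume "y \<in> {(x, \<kappa>). x \<in> shifts \<L> \<times> R \<and> \<kappa> \<in> ?f x \<and> \<tau> \<in> ?b \<kappa>}"
      then obtain x \<kappa> where y: "y = (x, \<kappa>)" "x \<in> shifts \<L> \<times> R" "\<kappa> \<in> ?f x" "\<tau> \<subseteq> \<kappa>" by blast
      then have "(\<kappa>, x) \<in> (SIGMA \<kappa> : {\<kappa> \<in> cells \<L>. \<tau> \<subseteq> \<kappa>}. {x \<in> shifts \<L> \<times> R. \<kappa> \<in> ?f x})"
        using sub by blast
      then show "y \<in> (\<lambda>(\<kappa>, x). (x, \<kappa>)) ` (SIGMA \<kappa> : {\<kappa> \<in> cells \<L>. \<tau> \<subseteq> \<kappa>}. {x \<in> shifts \<L> \<times> R. \<kappa> \<in> ?f x})"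
        unfolding y(1) by (rule rev_image_eqI) simp
    qed
    moreover have "finite (SIGMA \<kappa> : {\<kappa> \<in> cells \<L>. \<tau> \<subseteq> \<kappa>}. {x \<in> shifts \<L> \<times> R. \<kappa> \<in> ?f x})"
      using periodic_locally_finite[OF assms(1), of f] assms(2) finite_cells_above[OF cell_nonempty[OF True]]
      by (intro finite_SigmaI) auto
    ultimately show ?thesis using finite_subset by blast
  qed simp
  have "boundary \<L> j (periodic R f) = msum (\<lambda>x. msum ?b (?f x)) (shifts \<L> \<times> R)"
    unfolding boundary_msum periodic_def by (rule msum_msum[OF fin])
  also have "\<dots> = periodic R (\<lambda>r. boundary \<L> j (f r))"
    unfolding periodic_def by (rule msum_cong[OF refl]) (auto simp: boundary_msum[symmetric] boundary_shift)
  finally show ?thesis .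
qed

lemma shift_periodic:
  assumes "b \<in> shifts \<L>" shows "shift b (periodic R f) = periodic R f"
proof -
  have inj: "inj_on (\<lambda>(a, r). (b + a, r)) (shifts \<L> \<times> R)" by (auto intro!: inj_onI)
  have "(\<lambda>(a, r). (b + a, r)) ` (shifts \<L> \<times> R) = shifts \<L> \<times> R"
  proof
    show "shifts \<L> \<times> R \<subseteq> (\<lambda>(a, r). (b + a, r)) ` (shifts \<L> \<times> R)"
      using diff_shifts[OF _ assms] by (auto intro!: image_eqI[of _ _ "(_ - b, _)"])
  qed (use add_shifts[OF assms] in auto)
  then have "periodic R f = msum (\<lambda>(a, r). shift (b + a) (f r)) (shifts \<L> \<times> R)"
    unfolding periodic_def using msum_image[OF inj, of "\<lambda>(a, r). shift a (f r)"] by (simp add: case_prod_unfold)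
  also have "\<dots> = msum (\<lambda>x. shift b (case x of (a, r) \<Rightarrow> shift a (f r))) (shifts \<L> \<times> R)"
    by (rule msum_cong) (auto simp: shift_shift)
  also have "\<dots> = shift b (periodic R f)"
    unfolding periodic_def shift_def[of b] by (rule image_msum[OF inj_plus_image, symmetric])
  finally show ?thesis by simp
qed

lemma periodic_chain:
  assumes "\<And>r. r \<in> R \<Longrightarrow> f r \<subseteq> {\<kappa> \<in> cells \<L>. card \<kappa> = i + 1}"
  shows "periodic R f \<in> chains \<L> i"
proof -
  have "\<kappa> \<in> cells \<L> \<and> card \<kappa> = i + 1" if k: "\<kappa> \<in> periodic R f" for \<kappa>
  proof -
    obtain a r \<tau> where "a \<in> shifts \<L>" "r \<in> R" "\<tau> \<in> f r" "\<kappa> = (+) a ` \<tau>"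
      using k unfolding periodic_def shift_def by (auto elim!: msumE)
    then show ?thesis using assms cell_shift by (fastforce simp: card_image)
  qed
  then show ?thesis by (auto simp: chains_iff shift_periodic)
qed

end

text \<open>\<open>large\<close> makes the star of a vertex, of diameter at most 2, a local region,
  so that the infima and suprema behind the diamonds of the Sweep Rule exist.\<close>

locale sweeping = torus_triangulation \<L> for \<L> :: "'d::finite torus_lattice" +
  fixes k :: nat and l c\<^sub>B c\<^sub>D c\<^sub>P :: real
    and \<phi> :: "(real ^ 'd) set set \<Rightarrow> real ^ 'd \<Rightarrow> (real ^ 'd) set set"
  assumes causal: "causal \<L> k l c\<^sub>B c\<^sub>D c\<^sub>P"
    and sweep_rule: "sweep_rule \<L> k \<phi>"
    and k: "k \<ge> 1"
    and large: "2 \<le> l * real (linear_size \<L>)"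
begin

section \<open>Consequences of causality\<close>

lemma inf_exists: "V \<noteq> {} \<Longrightarrow> local_region \<L> l V \<Longrightarrow> is_inf \<L> V (THE m. is_inf \<L> V m)"
  and sup_exists: "V \<noteq> {} \<Longrightarrow> local_region \<L> l V \<Longrightarrow> is_sup \<L> V (THE m. is_sup \<L> V m)"
proof -
  assume V: "V \<noteq> {}" "local_region \<L> l V"
  have "\<forall>V. V \<noteq> {} \<and> local_region \<L> l V \<longrightarrow> (\<exists>!m. is_inf \<L> V m) \<and> (\<exists>!m. is_sup \<L> V m)"
    using causal unfolding causal_def by (elim conjE) assumption
  from mp[OF spec[OF this] conjI[OF V]]
  have ex: "\<exists>!m. is_inf \<L> V m" "\<exists>!m. is_sup \<L> V m" by (rule conjunct1, rule conjunct2)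
  show "is_inf \<L> V (THE m. is_inf \<L> V m)" using ex(1) by (rule theI')
  show "is_sup \<L> V (THE m. is_sup \<L> V m)" using ex(2) by (rule theI')
qed

lemma diam_diamond: "V \<noteq> {} \<Longrightarrow> local_region \<L> l V \<Longrightarrow>
    ereal_of_enat (diam \<L> (\<Union>(diamond \<L> V))) \<le> ereal c\<^sub>D * ereal_of_enat (diam \<L> V)"
proof -
  have "\<forall>V. V \<noteq> {} \<and> local_region \<L> l V \<longrightarrow>
        ereal_of_enat (diam \<L> (\<Union>(diamond \<L> V))) \<le> ereal c\<^sub>D * ereal_of_enat (diam \<L> V)"
    using causal unfolding causal_def by (elim conjE) assumption
  then show "V \<noteq> {} \<Longrightarrow> local_region \<L> l V \<Longrightarrow>
    ereal_of_enat (diam \<L> (\<Union>(diamond \<L> V))) \<le> ereal c\<^sub>D * ereal_of_enat (diam \<L> V)" by simp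
qed

lemma ascends_length:
  assumes "local_region \<L> l {u, v}" "ascends u v n"
  shows "real n \<le> c\<^sub>P * real (gdist \<L> u v)"
proof -
  have *: "\<forall>u v p. local_region \<L> l {u, v} \<and> precedes \<L> u v \<and>
        causal_path \<L> p \<and> hd p = u \<and> last p = v \<longrightarrow>
        real (path_length p) \<le> c\<^sub>P * real (gdist \<L> u v)"
    using causal unfolding causal_def by (elim conjE) assumption
  obtain p where "edge_path \<L> p" "hd p = u" "last p = v" "path_length p = n"
     "successively (\<lambda>x y. sweep_dir \<L> \<bullet> (y - x) > 0) p"
    using assms(2) unfolding ascends_def by blast
  then show ?thesis using * assms precedes_ascends by (metis causal_path_def)
qed

lemma mem_diamond:
  assumes "V \<noteq> {}" "local_region \<L> l V"
  shows "{u} \<in> diamond \<L> V \<longleftrightarrow> precedes \<L> (THE m. is_inf \<L> V m) u \<and> precedes \<L> u (THE m. is_sup \<L> V m)"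
  unfolding diamond_def future_def past_def using precedes_verts by (auto simp: verts_def)

lemma exists_edge: "\<exists>u v. adjacent \<L> u v"
proof -
  obtain \<kappa> where "\<kappa> \<in> cells \<L>" using cells_cover by blast
  then obtain \<tau> where \<tau>: "\<tau> \<in> cells \<L>" "card \<tau> = CARD('d) + 1" using cell_top by blast
  then have "card \<tau> \<noteq> 1" "\<tau> \<noteq> {}" by auto
  then obtain u where u: "u \<in> \<tau>" by blast
  moreover obtain v where "v \<in> \<tau>" "v \<noteq> u"
  proof -
    have "\<not> \<tau> \<subseteq> {u}" using u \<open>card \<tau> \<noteq> 1\<close> by (auto simp: subset_singleton_iff)
    then show thesis using that by blast
  qed
  ultimately show ?thesis using cell_adjacent[OF \<tau>(1)] by blast
qed

text \<open>An edge is the test case: its ends have distance 1, are joined by an ascending path of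
  length 1, and both belong to their own diamond.\<close>

lemma constants_ge_1: "c\<^sub>D \<ge> 1" "c\<^sub>P \<ge> 1"
proof -
  obtain u v where uv: "adjacent \<L> u v" "precedes \<L> u v"
    using exists_edge adjacent_precedes_cases adjacent_sym by metis
  have V: "u \<in> verts \<L>" "v \<in> verts \<L>" "u \<noteq> v" using adjacent_verts[OF uv(1)] uv(1) by (auto simp: adjacent_def)
  have g: "gdist \<L> u v = 1" using gdist_adjacent[OF uv(1)] gdist_eq_0[OF V(1,2)] V(3) by linarith
  have le1: "gdist \<L> x y \<le> 1" if "x \<in> {u, v}" "y \<in> {u, v}" for x y
    using that g gdist_commute[OF V(1,2)] V by auto
  have reg: "local_region \<L> l {u, v}"
    using V le1 large by (intro local_regionI[of _ 1]) auto
  have "real 1 \<le> c\<^sub>P * real (gdist \<L> u v)"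
    using ascends_length[OF reg adjacent_precedes_ascends[OF uv]] .
  then show "c\<^sub>P \<ge> 1" by (simp add: g)
  have ne: "{u, v} \<noteq> {}" by simp
  have "is_inf \<L> {u, v} (THE m. is_inf \<L> {u, v} m)" "is_sup \<L> {u, v} (THE m. is_sup \<L> {u, v} m)"
    using inf_exists[OF ne reg] sup_exists[OF ne reg] .
  then have "{u} \<in> diamond \<L> {u, v}" "{v} \<in> diamond \<L> {u, v}"
    unfolding mem_diamond[OF ne reg] is_inf_def[of _ _ "The _"] is_sup_def[of _ _ "The _"] by blast+
  then have "ereal_of_enat (enat (gdist \<L> u v)) \<le> ereal_of_enat (diam \<L> (\<Union>(diamond \<L> {u, v})))"
    unfolding ereal_of_enat_le_iff by (intro gdist_le_diam) auto
  also have "\<dots> \<le> ereal c\<^sub>D * ereal_of_enat (diam \<L> {u, v})" using diam_diamond[OF ne reg] .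
  also have "diam \<L> {u, v} = enat 1"
    using diam_le[of "{u, v}" 1] le1 gdist_le_diam[of u "{u, v}" v] g by (intro antisym) auto
  finally show "c\<^sub>D \<ge> 1" by (simp add: g)
qed

lemma pos: "c\<^sub>D > 0" "c\<^sub>P > 0"
  using constants_ge_1 by linarith+

section \<open>The Sweep Rule at a vertex and on a finite piece of the syndrome\<close>

lemma local_region_star:
  assumes "v \<in> verts \<L>" "c \<subseteq> {\<kappa> \<in> cells \<L>. \<exists>\<tau>\<in>cells \<L>. \<kappa> \<subseteq> \<tau> \<and> v \<in> \<tau>}"
  shows "local_region \<L> l (\<Union>c)"
proof (rule local_regionI[of _ 2])
  show "\<Union>c \<subseteq> verts \<L>" using assms cell_vert by blast
  fix u w assume "u \<in> \<Union>c" "w \<in> \<Union>c"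
  then have "gdist \<L> u v \<le> 1" "gdist \<L> v w \<le> 1" "u \<in> verts \<L>" "w \<in> verts \<L>"
    using assms gdist_cell cell_vert by blast+
  then show "gdist \<L> u w \<le> 2" using gdist_triangle[of u v w] assms(1) by linarith
qed (use large in simp)

text \<open>\<open>flip_sup\<close> is what the equality of diamonds is for. Both vertex sets lie in
  cells around \<open>v\<close> and are therefore local; a vertex of the new boundary lies in the
  diamond of the old syndrome at \<open>v\<close>, so it is below the supremum of the latter and
  below every other upper bound \<open>M\<close>.\<close>

lemma flip:
  assumes \<sigma>: "\<sigma> \<in> boundary \<L> k ` chains \<L> k" and tr: "trailing \<L> \<sigma> v"
  shows flip_star: "\<phi> \<sigma> v \<subseteq> star \<L> k v" and flip_future: "\<phi> \<sigma> v \<subseteq> future \<L> v"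
    and flip_restr: "restr (boundary \<L> k (\<phi> \<sigma> v)) v = restr \<sigma> v"
    and flip_shift: "a \<in> shifts \<L> \<Longrightarrow> \<phi> \<sigma> (a + v) = shift a (\<phi> \<sigma> v)"
    and flip_sup: "w \<in> \<Union>(boundary \<L> k (\<phi> \<sigma> v)) \<Longrightarrow>
      (\<And>u. u \<in> \<Union>(restr \<sigma> v) \<Longrightarrow> precedes \<L> u M) \<Longrightarrow> precedes \<L> w M"
proof -
  have *: "\<phi> \<sigma> v \<subseteq> star \<L> k v \<inter> future \<L> v \<and>
        restr (boundary \<L> k (\<phi> \<sigma> v)) v = restr \<sigma> v \<and>
        diamond \<L> (\<Union>(boundary \<L> k (\<phi> \<sigma> v))) = diamond \<L> (\<Union>(restr \<sigma> v)) \<and>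
        (\<forall>a\<in>shifts \<L>. \<phi> \<sigma> (a + v) = (\<lambda>\<kappa>. (+) a ` \<kappa>) ` \<phi> \<sigma> v)"
    using sweep_rule \<sigma> tr unfolding sweep_rule_def by blast
  then show "\<phi> \<sigma> v \<subseteq> star \<L> k v" "\<phi> \<sigma> v \<subseteq> future \<L> v"
    "restr (boundary \<L> k (\<phi> \<sigma> v)) v = restr \<sigma> v"
    "a \<in> shifts \<L> \<Longrightarrow> \<phi> \<sigma> (a + v) = shift a (\<phi> \<sigma> v)" by (auto simp: shift_def)
  have v: "v \<in> verts \<L>" "restr \<sigma> v \<noteq> {}" using tr by (auto simp: trailing_def)
  let ?X = "\<Union>(boundary \<L> k (\<phi> \<sigma> v))" and ?Y = "\<Union>(restr \<sigma> v)"
  have star: "\<phi> \<sigma> v \<subseteq> {\<kappa> \<in> cells \<L>. v \<in> \<kappa>}" using * by (auto simp: star_def)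
  have "\<tau> \<in> {\<kappa> \<in> cells \<L>. \<exists>\<tau>\<in>cells \<L>. \<kappa> \<subseteq> \<tau> \<and> v \<in> \<tau>}" if t: "\<tau> \<in> boundary \<L> k (\<phi> \<sigma> v)" for \<tau>
    using boundary_mem_subset[OF t] subsetD[OF boundary_subset t] star by blast
  then have X: "local_region \<L> l ?X" by (intro local_region_star[OF v(1)] subsetI)
  have "\<tau> \<in> {\<kappa> \<in> cells \<L>. \<exists>\<tau>\<in>cells \<L>. \<kappa> \<subseteq> \<tau> \<and> v \<in> \<tau>}" if t: "\<tau> \<in> restr \<sigma> v" for \<tau>
    using t \<sigma> boundary_subset[of k] by (auto simp: mem_restr)
  then have Y: "local_region \<L> l ?Y" by (intro local_region_star[OF v(1)] subsetI)
  obtain \<tau> where "\<tau> \<in> restr \<sigma> v" using v(2) by blast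
  moreover from this have "\<tau> \<in> boundary \<L> k (\<phi> \<sigma> v)" "v \<in> \<tau>" using * by (auto simp: mem_restr)
  ultimately have Yne: "?Y \<noteq> {}" and Xne: "?X \<noteq> {}" by blast+
  assume w: "w \<in> ?X" and M: "\<And>u. u \<in> ?Y \<Longrightarrow> precedes \<L> u M"
  have "{w} \<in> diamond \<L> ?X"
    unfolding mem_diamond[OF Xne X] using inf_exists[OF Xne X] sup_exists[OF Xne X] w
    unfolding is_inf_def[of _ _ "The _"] is_sup_def[of _ _ "The _"] by blast
  then have "precedes \<L> w (THE m. is_sup \<L> ?Y m)" using * mem_diamond[OF Yne Y] by simp
  moreover have "precedes \<L> (THE m. is_sup \<L> ?Y m) M"
  proof -
    obtain u where "u \<in> ?Y" using Yne by blast
    then have "M \<in> verts \<L>" using M precedes_verts by blast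
    then show ?thesis using sup_exists[OF Yne Y] M unfolding is_sup_def by blast
  qed
  ultimately show "precedes \<L> w M" by (rule precedes_trans)
qed

text \<open>The flips are collected over the vertices of a finite piece \<open>s\<close>, but which
  vertices are trailing and what is flipped there depends on the whole syndrome \<sigma>.\<close>

definition partial_sweep :: "(real ^ 'd) set set \<Rightarrow> (real ^ 'd) set set \<Rightarrow> (real ^ 'd) set set" where
  "partial_sweep \<sigma> s = msum (\<phi> \<sigma>) {v \<in> \<Union>s. trailing \<L> \<sigma> v}"

context
  fixes \<sigma> s :: "(real ^ 'd) set set"
  assumes \<sigma>: "\<sigma> \<in> boundary \<L> k ` chains \<L> k" and s: "finite s" "s \<subseteq> cells \<L>"
begin

lemma finite_trailing: "finite {v \<in> \<Union>s. trailing \<L> \<sigma> v}"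
proof -
  have "finite (\<Union>s)" using s cell_finite by blast
  then show ?thesis by (rule finite_subset[rotated]) blast
qed

lemma flip_cells:
  assumes "trailing \<L> \<sigma> v"
  shows "\<phi> \<sigma> v \<subseteq> {\<kappa> \<in> cells \<L>. card \<kappa> = k + 1 \<and> v \<in> \<kappa>}" "finite (\<phi> \<sigma> v)"
proof -
  show 1: "\<phi> \<sigma> v \<subseteq> {\<kappa> \<in> cells \<L>. card \<kappa> = k + 1 \<and> v \<in> \<kappa>}"
    using flip_star[OF \<sigma> assms] by (auto simp: star_def)
  show "finite (\<phi> \<sigma> v)" using 1 finite_subset[OF _ finite_vertex_star[of v]] by blast
qed

lemma partial_sweep_cells:
  "finite (partial_sweep \<sigma> s)" "partial_sweep \<sigma> s \<subseteq> {\<kappa> \<in> cells \<L>. card \<kappa> = k + 1}"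
proof -
  show "finite (partial_sweep \<sigma> s)"
    unfolding partial_sweep_def using finite_trailing flip_cells(2) by (intro finite_msum) auto
  show "partial_sweep \<sigma> s \<subseteq> {\<kappa> \<in> cells \<L>. card \<kappa> = k + 1}"
    unfolding partial_sweep_def using flip_cells(1) by (fast elim!: msumE)
qed

lemma boundary_partial_sweep:
  "boundary \<L> k (partial_sweep \<sigma> s) = msum (\<lambda>v. boundary \<L> k (\<phi> \<sigma> v)) {v \<in> \<Union>s. trailing \<L> \<sigma> v}"
  unfolding partial_sweep_def boundary_msum
  by (rule msum_msum_finite[OF finite_trailing]) (simp add: flip_cells(2))

lemma swept_vertex:
  assumes "u \<in> \<Union>(sym_diff s (boundary \<L> k (partial_sweep \<sigma> s)))"
  obtains "u \<in> \<Union>s"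
  | v where "v \<in> \<Union>s" "trailing \<L> \<sigma> v" "u \<in> \<Union>(boundary \<L> k (\<phi> \<sigma> v))" "u \<in> \<Union>(\<phi> \<sigma> v)"
proof -
  obtain \<tau> where \<tau>: "u \<in> \<tau>" "\<tau> \<in> s \<or> \<tau> \<in> boundary \<L> k (partial_sweep \<sigma> s)" using assms by blast
  show thesis
  proof (cases "\<tau> \<in> s")
    case False
    then have "\<tau> \<in> boundary \<L> k (partial_sweep \<sigma> s)" using \<tau> by blast
    then obtain v where v: "v \<in> \<Union>s" "trailing \<L> \<sigma> v" "\<tau> \<in> boundary \<L> k (\<phi> \<sigma> v)"
      unfolding boundary_partial_sweep by (auto elim!: msumE)
    then show thesis using that(2) \<tau>(1) boundary_mem_subset by blast
  qed (use that \<tau> in blast)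
qed

lemma swept_near:
  assumes "u \<in> \<Union>(sym_diff s (boundary \<L> k (partial_sweep \<sigma> s)))"
  shows "\<exists>v\<in>\<Union>s. gdist \<L> v u \<le> 1"
  using assms
proof (cases rule: swept_vertex)
  case 1
  then have "u \<in> verts \<L>" using s cell_vert by blast
  then show ?thesis using 1 gdist_self by force
next
  case (2 v)
  then obtain \<kappa> where "\<kappa> \<in> \<phi> \<sigma> v" "u \<in> \<kappa>" by blast
  then show ?thesis using gdist_cell[of \<kappa> v u] 2 flip_cells(1) by blast
qed

text \<open>At a vertex of \<open>s\<close> the syndrome agrees with \<open>s\<close>, so
  \<open>M\<close> bounds all that the flip there has to match, and by the diamond condition also
  the boundary of the flip.\<close>

lemma swept_sup:
  assumes u: "u \<in> \<Union>(sym_diff s (boundary \<L> k (partial_sweep \<sigma> s)))"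
    and isolated: "\<And>v. v \<in> \<Union>s \<Longrightarrow> restr \<sigma> v = restr s v"
    and M: "\<And>v. v \<in> \<Union>s \<Longrightarrow> precedes \<L> v M"
  shows "precedes \<L> u M"
  using u
proof (cases rule: swept_vertex)
  case (2 v)
  have "\<Union>(restr \<sigma> v) \<subseteq> \<Union>s" unfolding isolated[OF 2(1)] using restr_subset[of s v] by blast
  then show ?thesis using flip_sup[OF \<sigma> 2(2,3)] M by blast
qed (use M in blast)

text \<open>
  A vertex of the syndrome without long ascending paths from \<open>m\<close> can only have later neighbours,
  so it is trailing and is removed by the sweep.
\<close>

lemma swept_ascends:
  assumes u: "u \<in> \<Union>(sym_diff s (boundary \<L> k (partial_sweep \<sigma> s)))"
    and isolated: "\<And>v. v \<in> \<Union>s \<Longrightarrow> restr \<sigma> v = restr s v"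
    and asc: "\<And>v. v \<in> \<Union>s \<Longrightarrow> \<exists>n\<ge>t. ascends m v n"
  shows "\<exists>n\<ge>Suc t. ascends m u n"
proof (rule ccontr)
  assume neg: "\<not> (\<exists>n\<ge>Suc t. ascends m u n)"
  have no_pred: False if v: "v \<in> \<Union>s" "adjacent \<L> v u" "precedes \<L> v u" for v
  proof -
    obtain n where n: "n \<ge> t" "ascends m v n" using asc[OF v(1)] by blast
    then have "ascends m u (n + 1)" using ascends_append adjacent_precedes_ascends[OF v(2,3)] by blast
    then show False using neg n by auto
  qed
  \<comment> \<open>A flip at another vertex \<open>v\<close> lies in the future of
    \<open>v\<close>, so \<open>v\<close> would be an earlier neighbour of \<open>u\<close> in
    \<open>s\<close>.\<close>
  have only: "v = u" if v: "v \<in> \<Union>s" "trailing \<L> \<sigma> v" "u \<in> \<Union>(\<phi> \<sigma> v)" for v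
  proof (rule ccontr)
    assume "v \<noteq> u"
    obtain \<kappa> where \<kappa>: "\<kappa> \<in> \<phi> \<sigma> v" "u \<in> \<kappa>" using v by blast
    then have "adjacent \<L> v u" using flip_cells(1)[OF v(2)] cell_adjacent[of \<kappa> v u] \<open>v \<noteq> u\<close> by blast
    moreover have "precedes \<L> v u" using flip_future[OF \<sigma> v(2)] \<kappa> by (auto simp: future_def)
    ultimately show False using no_pred v by blast
  qed
  have us: "u \<in> \<Union>s" using u by (cases rule: swept_vertex) (use only in auto)
  then have uv: "u \<in> verts \<L>" using s cell_vert by blast
  have "\<kappa> \<in> future \<L> u" if \<kappa>: "\<kappa> \<in> restr s u" for \<kappa>
  proof -
    have c: "\<kappa> \<in> cells \<L>" "\<kappa> \<in> s" "u \<in> \<kappa>" using \<kappa> s by (auto simp: mem_restr)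
    have "precedes \<L> u w" if w: "w \<in> \<kappa>" for w
    proof (cases "w = u")
      case False
      then have "adjacent \<L> w u" using cell_adjacent c w by blast
      then show ?thesis using adjacent_precedes_cases no_pred[of w] c w by blast
    qed (use uv precedes_refl in simp)
    then show ?thesis using c by (simp add: future_def)
  qed
  then have tr: "trailing \<L> \<sigma> u"
    unfolding trailing_def isolated[OF us] using uv us by (auto simp: restr_def)
  obtain \<tau> where \<tau>: "u \<in> \<tau>" "\<tau> \<in> sym_diff s (boundary \<L> k (partial_sweep \<sigma> s))" using u by blast
  define P where "P = {v \<in> \<Union>s. trailing \<L> \<sigma> v}"
  have P: "v = u" if "v \<in> P" "\<tau> \<in> boundary \<L> k (\<phi> \<sigma> v)" for v
    using that only[of v] boundary_mem_subset[OF that(2)] \<tau>(1) unfolding P_def by blast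
  have uP: "u \<in> P" using us tr by (simp add: P_def)
  \<comment> \<open>Only the flip at \<open>u\<close> can contribute to \<tau>, so the sum modulo 2
    has at most one term. As this flip matches \<open>s\<close> at \<open>u\<close>, the simplex
    \<tau> is in both or in neither of the two chains and cannot be left over.\<close>
  have "{v \<in> P. \<tau> \<in> boundary \<L> k (\<phi> \<sigma> v)} = (if \<tau> \<in> boundary \<L> k (\<phi> \<sigma> u) then {u} else {})"
  proof (cases "\<tau> \<in> boundary \<L> k (\<phi> \<sigma> u)")
    case True
    then have "{v \<in> P. \<tau> \<in> boundary \<L> k (\<phi> \<sigma> v)} = {u}" using P uP by blast
    then show ?thesis by (simp only: True if_True)
  next
    case False
    then have "{v \<in> P. \<tau> \<in> boundary \<L> k (\<phi> \<sigma> v)} = {}" using P by blast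
    then show ?thesis by (simp only: False if_False)
  qed
  then have "\<tau> \<in> boundary \<L> k (partial_sweep \<sigma> s) \<longleftrightarrow> \<tau> \<in> boundary \<L> k (\<phi> \<sigma> u)"
    unfolding boundary_partial_sweep P_def[symmetric] by (simp add: msum_def)
  also have "\<dots> \<longleftrightarrow> \<tau> \<in> restr (boundary \<L> k (\<phi> \<sigma> u)) u" using \<tau>(1) by (simp add: mem_restr)
  also have "\<dots> \<longleftrightarrow> \<tau> \<in> s" unfolding flip_restr[OF \<sigma> tr] isolated[OF us] using \<tau>(1) by (simp add: mem_restr)
  finally have "\<tau> \<in> boundary \<L> k (partial_sweep \<sigma> s) \<longleftrightarrow> \<tau> \<in> s" .
  then show False using \<tau>(2) by simp
qed

end

end

context sweeping
begin

section \<open>Decomposition of a sweep into isolated pieces\<close>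

lemma syndrome_shift:
  assumes \<sigma>: "\<sigma> \<in> boundary \<L> k ` chains \<L> k" and a: "a \<in> shifts \<L>"
  shows "shift a \<sigma> = \<sigma>"
proof -
  obtain c where c: "c \<in> chains \<L> k" "\<sigma> = boundary \<L> k c" using \<sigma> by blast
  have "shift a c = c" using c(1) a shift_inverse_subset by (simp add: chains_iff)
  then show ?thesis using boundary_shift[OF a, of k c] c(2) by simp
qed

lemma trailing_shift:
  assumes \<sigma>: "\<sigma> \<in> boundary \<L> k ` chains \<L> k" and a: "a \<in> shifts \<L>"
  shows "trailing \<L> \<sigma> (a + v) \<longleftrightarrow> trailing \<L> \<sigma> v"
proof -
  have 1: "restr \<sigma> (a + v) = shift a (restr \<sigma> v)"
    using restr_shift[of a \<sigma> v] syndrome_shift[OF \<sigma> a] by simp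
  have 2: "shift a X \<subseteq> shift a Y \<longleftrightarrow> X \<subseteq> Y" for X Y :: "(real ^ 'd) set set"
    unfolding shift_def by (rule inj_image_subset_iff[OF inj_plus_image])
  have 3: "a + v \<in> verts \<L> \<longleftrightarrow> v \<in> verts \<L>"
    using cell_vert_shift[of v a] cell_vert_shift[of "a + v" "- a"] a uminus_shifts by auto
  show ?thesis unfolding trailing_def 1 future_shift[OF a] 2 3 by simp
qed

lemma partial_sweep_shift:
  assumes \<sigma>: "\<sigma> \<in> boundary \<L> k ` chains \<L> k" and a: "a \<in> shifts \<L>"
  shows "partial_sweep \<sigma> (shift a s) = shift a (partial_sweep \<sigma> s)"
proof -
  have "{v \<in> \<Union>(shift a s). trailing \<L> \<sigma> v} = (+) a ` {v \<in> \<Union>s. trailing \<L> \<sigma> v}"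
    unfolding Union_shift using trailing_shift[OF \<sigma> a] by blast
  then have "partial_sweep \<sigma> (shift a s) = msum (\<lambda>v. \<phi> \<sigma> (a + v)) {v \<in> \<Union>s. trailing \<L> \<sigma> v}"
    unfolding partial_sweep_def by (simp add: msum_image)
  also have "\<dots> = msum (\<lambda>v. shift a (\<phi> \<sigma> v)) {v \<in> \<Union>s. trailing \<L> \<sigma> v}"
    by (rule msum_cong[OF refl]) (use flip_shift[OF \<sigma> _ a] in blast)
  also have "\<dots> = shift a (partial_sweep \<sigma> s)"
    unfolding partial_sweep_def shift_def by (rule image_msum[OF inj_plus_image, symmetric])
  finally show ?thesis .
qed

context
  fixes \<sigma> :: "(real ^ 'd) set set" and R :: "'r set" and s :: "'r \<Rightarrow> (real ^ 'd) set set"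
  assumes \<sigma>: "\<sigma> \<in> boundary \<L> k ` chains \<L> k" and R: "finite R"
    and s: "\<And>r. r \<in> R \<Longrightarrow> finite (s r) \<and> s r \<subseteq> cells \<L>"
    and \<sigma>s: "\<sigma> = periodic R s"
    and disj: "\<And>a b r r'. a \<in> shifts \<L> \<Longrightarrow> b \<in> shifts \<L> \<Longrightarrow> r \<in> R \<Longrightarrow> r' \<in> R \<Longrightarrow> (a, r) \<noteq> (b, r') \<Longrightarrow>
      \<Union>(shift a (s r)) \<inter> \<Union>(shift b (s r')) = {}"
begin

lemma syndrome_Union: "\<sigma> = (\<Union>(a, r)\<in>shifts \<L> \<times> R. shift a (s r))"
proof -
  have *: "shift a (s r) \<inter> shift b (s r') = {}"
    if ab: "a \<in> shifts \<L>" "b \<in> shifts \<L>" "r \<in> R" "r' \<in> R" "(a, r) \<noteq> (b, r')" for a b r r'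
  proof (rule ccontr)
    assume "shift a (s r) \<inter> shift b (s r') \<noteq> {}"
    then obtain \<kappa> where \<kappa>: "\<kappa> \<in> shift a (s r)" "\<kappa> \<in> shift b (s r')" by blast
    then obtain \<tau> where "\<tau> \<in> s r" "\<kappa> = (+) a ` \<tau>" by (auto simp: shift_def)
    then have "\<kappa> \<noteq> {}" using s[OF ab(3)] cell_nonempty by auto
    then show False using disj[OF ab] \<kappa> by blast
  qed
  have "(case x of (a, r) \<Rightarrow> shift a (s r)) \<inter> (case y of (a, r) \<Rightarrow> shift a (s r)) = {}"
    if "x \<in> shifts \<L> \<times> R" "y \<in> shifts \<L> \<times> R" "x \<noteq> y" for x y
    using that *[of "fst x" "fst y" "snd x" "snd y"] by (cases x; cases y) simp
  then show ?thesis unfolding \<sigma>s periodic_def by (rule msum_disjoint)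
qed

lemma restr_isolated:
  assumes r: "r \<in> R" and v: "v \<in> \<Union>(s r)"
  shows "restr \<sigma> v = restr (s r) v"
proof -
  have "\<tau> \<in> s r" if \<tau>: "\<tau> \<in> \<sigma>" "v \<in> \<tau>" for \<tau>
  proof -
    obtain a r' where a: "a \<in> shifts \<L>" "r' \<in> R" "\<tau> \<in> shift a (s r')" using \<tau>(1) syndrome_Union by auto
    then have "v \<in> \<Union>(shift a (s r')) \<inter> \<Union>(shift 0 (s r))" using v \<tau>(2) by auto
    then have "(a, r') = (0, r)" using disj[OF a(1) zero_shifts a(2) r] by blast
    then show ?thesis using a(3) by simp
  qed
  moreover have "\<tau> \<in> \<sigma>" if "\<tau> \<in> s r" for \<tau>
    unfolding syndrome_Union by (rule UN_I[of "(0, r)"]) (use that r in auto)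
  ultimately show ?thesis by (auto simp: mem_restr)
qed

text \<open>Each trailing vertex belongs to exactly one translate of one piece, since the vertex
  sets are disjoint, and the rule commutes with shifts.\<close>

lemma sweep_periodic: "sweep \<L> \<phi> \<sigma> = periodic R (\<lambda>r. partial_sweep \<sigma> (s r))"
proof -
  define P where "P = (\<lambda>(a, r). {v \<in> \<Union>(shift a (s r)). trailing \<L> \<sigma> v})"
  have "{v. trailing \<L> \<sigma> v} = (\<Union>x\<in>shifts \<L> \<times> R. P x)"
  proof -
    have "v \<in> (\<Union>x\<in>shifts \<L> \<times> R. P x)" if tr: "trailing \<L> \<sigma> v" for v
    proof -
      obtain \<tau> where "\<tau> \<in> \<sigma>" "v \<in> \<tau>" using tr by (auto simp: trailing_def mem_restr)
      then obtain a r where "a \<in> shifts \<L>" "r \<in> R" "\<tau> \<in> shift a (s r)" "v \<in> \<tau>"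
        using syndrome_Union by auto
      then show ?thesis using tr by (auto simp: P_def intro!: bexI[of _ a] bexI[of _ r])
    qed
    then show ?thesis by (auto simp: P_def)
  qed
  also have "\<dots> = msum P (shifts \<L> \<times> R)"
  proof (rule msum_disjoint[symmetric])
    fix x y assume "x \<in> shifts \<L> \<times> R" "y \<in> shifts \<L> \<times> R" "x \<noteq> y"
    then show "P x \<inter> P y = {}" using disj unfolding P_def by (cases x; cases y) blast
  qed
  finally have P: "{v. trailing \<L> \<sigma> v} = msum P (shifts \<L> \<times> R)" .
  have "sweep \<L> \<phi> \<sigma> = msum (\<phi> \<sigma>) {v. trailing \<L> \<sigma> v}" by (simp add: sweep_def msum_def)
  also have "\<dots> = msum (\<lambda>x. msum (\<phi> \<sigma>) (P x)) (shifts \<L> \<times> R)"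
    unfolding P
  proof (rule msum_msum)
    fix \<kappa>
    let ?A = "{(x, v). x \<in> shifts \<L> \<times> R \<and> v \<in> P x \<and> \<kappa> \<in> \<phi> \<sigma> v}"
    show "finite ?A"
    proof (cases "?A = {}")
      case False
      then obtain v where "trailing \<L> \<sigma> v" "\<kappa> \<in> \<phi> \<sigma> v" by (auto simp: P_def)
      then have \<kappa>: "finite \<kappa>" using flip_star[OF \<sigma>] cell_finite by (auto simp: star_def)
      \<comment> \<open>By disjointness the vertex alone determines the translate and the piece. It
        is one of the finitely many vertices of \<kappa>, so the double sum is locally
        finite.\<close>
      have "inj_on snd ?A"
      proof (rule inj_onI)
        fix p q assume pq: "p \<in> ?A" "q \<in> ?A" "snd p = snd q"
        then obtain a r b r' v where e: "p = ((a, r), v)" "q = ((b, r'), v)" by (cases p; cases q) auto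
        then have "(a, r) = (b, r')" using pq disj[of a b r r'] unfolding P_def by blast
        then show "p = q" using e by simp
      qed
      moreover have "snd ` ?A \<subseteq> \<kappa>"
        using flip_star[OF \<sigma>] by (fastforce simp: star_def P_def)
      ultimately show ?thesis using \<kappa> by (meson finite_imageD finite_subset)
    qed (simp only: finite.emptyI)
  qed
  also have "\<dots> = periodic R (\<lambda>r. partial_sweep \<sigma> (s r))"
    unfolding periodic_def
  proof (rule msum_cong[OF refl])
    fix x assume "x \<in> shifts \<L> \<times> R"
    then obtain a r where x: "x = (a, r)" "a \<in> shifts \<L>" by blast
    have "msum (\<phi> \<sigma>) (P x) = partial_sweep \<sigma> (shift a (s r))" by (simp add: x P_def partial_sweep_def)
    then show "msum (\<phi> \<sigma>) (P x) = (case x of (a, r) \<Rightarrow> shift a (partial_sweep \<sigma> (s r)))"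
      using partial_sweep_shift[OF \<sigma> x(2)] x(1) by simp
  qed
  finally show ?thesis .
qed

end

end

text \<open>
  A syndrome spreads by at most one edge per step, and the cluster \<open>r\<close> is removed after at most
  \<open>c\<^sub>P * c\<^sub>D * \<Delta> r + 1\<close> steps.  So the separation guarantees that one of two clusters has vanished before
  they could meet.
\<close>

locale clustered_error = sweeping \<L> k l c\<^sub>B c\<^sub>D c\<^sub>P \<phi>
  for \<L> :: "'d::finite torus_lattice" and k l c\<^sub>B c\<^sub>D c\<^sub>P \<phi> +
  fixes R :: "(real ^ 'd) set set set" and \<Delta> :: "(real ^ 'd) set set \<Rightarrow> nat" and Tm :: real
  assumes R: "finite R"
    and cluster: "\<And>r. r \<in> R \<Longrightarrow> finite r \<and> r \<noteq> {} \<and> r \<subseteq> {\<kappa> \<in> cells \<L>. card \<kappa> = k + 1}"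
    and cluster_diam: "\<And>r u v. r \<in> R \<Longrightarrow> u \<in> \<Union>r \<Longrightarrow> v \<in> \<Union>r \<Longrightarrow> gdist \<L> u v \<le> \<Delta> r"
    and cluster_local: "\<And>r. r \<in> R \<Longrightarrow> real (\<Delta> r) \<le> l * real (linear_size \<L>)"
      "\<And>r. r \<in> R \<Longrightarrow> c\<^sub>D * real (\<Delta> r) \<le> l * real (linear_size \<L>)"
    and cluster_time: "\<And>r. r \<in> R \<Longrightarrow> c\<^sub>P * c\<^sub>D * real (\<Delta> r) + 2 \<le> Tm" "2 \<le> Tm"
    and separated: "\<And>a b r r' u v. a \<in> shifts \<L> \<Longrightarrow> b \<in> shifts \<L> \<Longrightarrow> r \<in> R \<Longrightarrow> r' \<in> R \<Longrightarrow> (a, r) \<noteq> (b, r') \<Longrightarrow>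
      u \<in> \<Union>(shift a r) \<Longrightarrow> v \<in> \<Union>(shift b r') \<Longrightarrow>
      2 * (c\<^sub>P * c\<^sub>D * real (min (\<Delta> r) (\<Delta> r'))) < real (gdist \<L> u v)"
begin

definition lower :: "(real ^ 'd) set set \<Rightarrow> real ^ 'd" where "lower r = (THE m. is_inf \<L> (\<Union>r) m)"
definition upper :: "(real ^ 'd) set set \<Rightarrow> real ^ 'd" where "upper r = (THE m. is_sup \<L> (\<Union>r) m)"

lemma cluster_region: assumes "r \<in> R" shows "local_region \<L> l (\<Union>r)" "\<Union>r \<noteq> {}"
proof -
  show "local_region \<L> l (\<Union>r)"
    using cluster_diam[OF assms] cluster_local(1)[OF assms] cluster[OF assms] cell_vert
    by (intro local_regionI[of _ "\<Delta> r"]) auto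
  obtain \<kappa> where "\<kappa> \<in> r" using cluster[OF assms] by blast
  then have "\<kappa> \<noteq> {}" using cluster[OF assms] cell_nonempty by blast
  then show "\<Union>r \<noteq> {}" using \<open>\<kappa> \<in> r\<close> by blast
qed

lemma lower_le: "r \<in> R \<Longrightarrow> v \<in> \<Union>r \<Longrightarrow> precedes \<L> (lower r) v"
  and le_upper: "r \<in> R \<Longrightarrow> v \<in> \<Union>r \<Longrightarrow> precedes \<L> v (upper r)"
  using inf_exists[OF cluster_region(2,1)] sup_exists[OF cluster_region(2,1)]
  unfolding lower_def upper_def is_inf_def[of _ _ "The _"] is_sup_def[of _ _ "The _"] by blast+

text \<open>A vertex between infimum and supremum lies in the diamond of the cluster, hence at
  distance at most \<open>c\<^sub>D * \<Delta> r\<close> from the infimum; the bound on causal paths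
  contributes the factor \<open>c\<^sub>P\<close>.\<close>

lemma ascends_in_diamond:
  assumes r: "r \<in> R" and u: "precedes \<L> u (upper r)" and n: "ascends (lower r) u n"
  shows "real n \<le> c\<^sub>P * c\<^sub>D * real (\<Delta> r)"
proof -
  note reg = cluster_region[OF r]
  obtain w where w: "w \<in> \<Union>r" using reg by blast
  have lu: "precedes \<L> (lower r) u" using n precedes_ascends by blast
  have lo: "lower r \<in> verts \<L>" "u \<in> verts \<L>" using precedes_verts[OF lu] by auto
  have "precedes \<L> (lower r) (upper r)" using precedes_trans[OF lower_le[OF r w] le_upper[OF r w]] .
  then have "lower r \<in> \<Union>(diamond \<L> (\<Union>r))" "u \<in> \<Union>(diamond \<L> (\<Union>r))"
    using mem_diamond[OF reg(2,1), of "lower r"] mem_diamond[OF reg(2,1), of u] lu u precedes_refl[OF lo(1)]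
    unfolding lower_def[symmetric] upper_def[symmetric] by blast+
  then have "ereal_of_enat (enat (gdist \<L> (lower r) u)) \<le> ereal_of_enat (diam \<L> (\<Union>(diamond \<L> (\<Union>r))))"
    by (simp only: ereal_of_enat_le_iff gdist_le_diam)
  also have "\<dots> \<le> ereal c\<^sub>D * ereal_of_enat (diam \<L> (\<Union>r))" using diam_diamond[OF reg(2,1)] .
  also have "\<dots> \<le> ereal c\<^sub>D * ereal_of_enat (enat (\<Delta> r))"
    using diam_le[of "\<Union>r" "\<Delta> r"] cluster_diam[OF r] pos
    by (intro ereal_mult_left_mono) (simp_all only: ereal_of_enat_le_iff ereal_less_eq)
  finally have g: "real (gdist \<L> (lower r) u) \<le> c\<^sub>D * real (\<Delta> r)" by simp
  have "local_region \<L> l {lower r, u}"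
  proof (rule local_regionI[of _ "gdist \<L> (lower r) u"])
    show "real (gdist \<L> (lower r) u) \<le> l * real (linear_size \<L>)" using g cluster_local(2)[OF r] by simp
    show "gdist \<L> x y \<le> gdist \<L> (lower r) u" if "x \<in> {lower r, u}" "y \<in> {lower r, u}" for x y
      using that lo gdist_commute[of u "lower r"] by auto
  qed (use lo in auto)
  then have "real n \<le> c\<^sub>P * real (gdist \<L> (lower r) u)" using n by (rule ascends_length)
  also have "\<dots> \<le> c\<^sub>P * (c\<^sub>D * real (\<Delta> r))" using g pos by (intro mult_left_mono) auto
  finally show ?thesis by (simp add: mult.assoc)
qed

section \<open>Invariant and success of the decoder\<close>

definition error :: "(real ^ 'd) set set" where
  "error = periodic R (\<lambda>r. r)"

text \<open>\<open>q r\<close> is the correction made so far on behalf of \<open>r\<close>, and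
  \<open>s r\<close> is the syndrome that remains. The counter starts at 1, so \<open>T - 1\<close>
  sweeps precede the value \<open>T\<close>: hence the strict bound
  \<open>gdist \<L> w u < T\<close> and the path length \<open>T - 1\<close>.\<close>

definition cluster_inv where
  "cluster_inv T s q r \<longleftrightarrow> finite (q r) \<and> q r \<subseteq> {\<kappa> \<in> cells \<L>. card \<kappa> = k + 1} \<and>
     s r = boundary \<L> k (sym_diff (q r) r) \<and>
     (\<forall>u\<in>\<Union>(s r). (\<exists>w\<in>\<Union>r. gdist \<L> w u < T) \<and> precedes \<L> u (upper r) \<and>
        (\<exists>n\<ge>T - 1. ascends (lower r) u n))"

text \<open>Keeping \<open>real T \<le> Tm\<close> in the invariant means that the loop can only end
  with an empty syndrome, never with \<open>FAIL\<close>.\<close>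

definition decoder_inv where
  "decoder_inv = (\<lambda>(T, \<sigma>, \<rho>). T \<ge> 1 \<and> real T \<le> Tm \<and>
     (\<exists>s q. \<sigma> = periodic R s \<and> \<rho> = periodic R q \<and> (\<forall>r\<in>R. cluster_inv T s q r)))"

lemma cells_of_card: "C \<subseteq> {\<kappa> \<in> cells \<L>. card \<kappa> = i} \<Longrightarrow> C \<subseteq> cells \<L>"
  by blast

lemma sum_periodic:
  assumes "\<And>r. r \<in> R \<Longrightarrow> cluster_inv T s q r"
  shows "sym_diff (periodic R q) error = periodic R (\<lambda>r. sym_diff (q r) r)"
proof -
  have "finite (q r) \<and> q r \<subseteq> cells \<L>" if "r \<in> R" for r
    using assms[OF that] cells_of_card unfolding cluster_inv_def by blast
  moreover have "finite r \<and> r \<subseteq> cells \<L>" if "r \<in> R" for r using cluster[OF that] by blast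
  ultimately show ?thesis unfolding error_def by (intro periodic_sym_diff[OF R, symmetric])
qed

lemma inv_cells:
  assumes "cluster_inv T s q r" "r \<in> R"
  shows "finite (sym_diff (q r) r)" "sym_diff (q r) r \<subseteq> {\<kappa> \<in> cells \<L>. card \<kappa> = k + 1}"
    "finite (s r)" "s r \<subseteq> cells \<L>"
proof -
  show *: "finite (sym_diff (q r) r)" "sym_diff (q r) r \<subseteq> {\<kappa> \<in> cells \<L>. card \<kappa> = k + 1}"
    using assms cluster[OF assms(2)] by (auto simp: cluster_inv_def)
  have "s r = boundary \<L> k (sym_diff (q r) r)" using assms(1) by (simp add: cluster_inv_def)
  then show "finite (s r)" "s r \<subseteq> cells \<L>"
    using finite_boundary[OF *(1) cells_of_card[OF *(2)], of k]
      cells_of_card[OF boundary_subset[of k "sym_diff (q r) r"]] by simp_all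
qed

text \<open>The second part keeps the syndrome among the boundaries of invariant chains, where the
  Sweep Rule is specified.\<close>

lemma inv_syndrome:
  assumes inv: "\<And>r. r \<in> R \<Longrightarrow> cluster_inv T s q r"
  shows "periodic R s = boundary \<L> k (sym_diff (periodic R q) error)"
    and "periodic R s \<in> boundary \<L> k ` chains \<L> k"
proof -
  have sum: "sym_diff (periodic R q) error = periodic R (\<lambda>r. sym_diff (q r) r)"
    using inv by (rule sum_periodic)
  have "boundary \<L> k (periodic R (\<lambda>r. sym_diff (q r) r)) = periodic R (\<lambda>r. boundary \<L> k (sym_diff (q r) r))"
    using inv_cells(1)[OF inv] cells_of_card[OF inv_cells(2)[OF inv]]
    by (intro boundary_periodic[OF R]) simp
  also have "\<dots> = periodic R s"
    by (rule periodic_cong) (use inv in \<open>auto simp: cluster_inv_def\<close>)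
  finally show *: "periodic R s = boundary \<L> k (sym_diff (periodic R q) error)"
    unfolding sum by (rule sym)
  have "periodic R (\<lambda>r. sym_diff (q r) r) \<in> chains \<L> k"
    by (rule periodic_chain) (rule inv_cells(2)[OF inv])
  then show "periodic R s \<in> boundary \<L> k ` chains \<L> k"
    unfolding * sum by (rule imageI)
qed

lemma inv_time:
  assumes "cluster_inv T s q r" "r \<in> R" "u \<in> \<Union>(s r)"
  shows "real (T - 1) \<le> c\<^sub>P * c\<^sub>D * real (\<Delta> r)"
proof -
  obtain n where "n \<ge> T - 1" "ascends (lower r) u n" "precedes \<L> u (upper r)"
    using assms unfolding cluster_inv_def by blast
  then show ?thesis using ascends_in_diamond[OF assms(2), of u n] by linarith
qed

lemma inv_disjoint:
  assumes inv: "\<And>r. r \<in> R \<Longrightarrow> cluster_inv T s q r" and T: "T \<ge> 1"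
    and ab: "a \<in> shifts \<L>" "b \<in> shifts \<L>" "r \<in> R" "r' \<in> R" "(a, r) \<noteq> (b, r')"
  shows "\<Union>(shift a (s r)) \<inter> \<Union>(shift b (s r')) = {}"
proof (rule ccontr)
  assume "\<Union>(shift a (s r)) \<inter> \<Union>(shift b (s r')) \<noteq> {}"
  then obtain x where x: "x \<in> \<Union>(shift a (s r))" "x \<in> \<Union>(shift b (s r'))" by blast
  have near: "\<exists>w\<in>\<Union>(shift a r). gdist \<L> w x < T \<and> w \<in> verts \<L> \<and> x \<in> verts \<L> \<and> real (T - 1) \<le> c\<^sub>P * c\<^sub>D * real (\<Delta> r)"
    if r: "r \<in> R" and a: "a \<in> shifts \<L>" and x: "x \<in> \<Union>(shift a (s r))" for r a
  proof -
    obtain u where u: "u \<in> \<Union>(s r)" "x = a + u" using x unfolding Union_shift by blast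
    then obtain w where w: "w \<in> \<Union>r" "gdist \<L> w u < T" using inv[OF r] unfolding cluster_inv_def by blast
    have v: "w \<in> verts \<L>" "u \<in> verts \<L>"
      using w(1) u(1) cluster[OF r] inv_cells(4)[OF inv[OF r] r] cell_vert by blast+
    show ?thesis
      using gdist_shift[OF v a] w u v cell_vert_shift a inv_time[OF inv[OF r] r u(1)] unfolding Union_shift
      by (intro bexI[of _ "a + w"]) auto
  qed
  obtain w where w: "w \<in> \<Union>(shift a r)" "gdist \<L> w x < T" "w \<in> verts \<L>" "x \<in> verts \<L>" "real (T - 1) \<le> c\<^sub>P * c\<^sub>D * real (\<Delta> r)"
    using near[OF ab(3,1) x(1)] by blast
  obtain w' where w': "w' \<in> \<Union>(shift b r')" "gdist \<L> w' x < T" "w' \<in> verts \<L>" "real (T - 1) \<le> c\<^sub>P * c\<^sub>D * real (\<Delta> r')"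
    using near[OF ab(4,2) x(2)] by blast
  have "gdist \<L> w w' \<le> gdist \<L> w x + gdist \<L> w' x"
    using gdist_triangle[OF w(3,4) w'(3)] gdist_commute[OF w(4) w'(3)] by simp
  also have "\<dots> \<le> 2 * (T - 1)" using w(2) w'(2) by linarith
  finally have "real (gdist \<L> w w') \<le> real (2 * (T - 1))" by (simp only: of_nat_le_iff)
  also have "\<dots> = 2 * real (T - 1)" by simp
  \<comment> \<open>Both syndromes are still nonempty, so \<open>T - 1\<close> is bounded by both
    lifetimes, in particular by the smaller one.\<close>
  also have "\<dots> \<le> 2 * (c\<^sub>P * c\<^sub>D * real (min (\<Delta> r) (\<Delta> r')))"
    using w(5) w'(4) by (cases "\<Delta> r \<le> \<Delta> r'") (auto simp: min_def)
  finally show False using separated[OF ab w(1) w'(1)] by simp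
qed

lemma inv_init: "decoder_inv (1, boundary \<L> k error, {})"
proof -
  define s where "s r = boundary \<L> k r" for r
  have inv: "cluster_inv 1 s (\<lambda>_. {}) r" if r: "r \<in> R" for r
  proof -
    have "(\<exists>w\<in>\<Union>r. gdist \<L> w u < 1) \<and> precedes \<L> u (upper r) \<and> (\<exists>n\<ge>0. ascends (lower r) u n)"
      if u: "u \<in> \<Union>(s r)" for u
    proof -
      have ur: "u \<in> \<Union>r" using u boundary_mem_subset unfolding s_def by blast
      then have "u \<in> verts \<L>" using cluster[OF r] cell_vert by blast
      then show ?thesis
        using ur le_upper[OF r ur] lower_le[OF r ur] gdist_self precedes_ascends by force
    qed
    then show ?thesis unfolding cluster_inv_def by (simp add: s_def)
  qed
  have e: "periodic R (\<lambda>_. {}) = {}" by (rule periodic_empty) simp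
  have "boundary \<L> k error = periodic R s" using inv_syndrome(1)[OF inv] by (simp add: e)
  then show ?thesis
    unfolding decoder_inv_def prod.case using inv e[symmetric] cluster_time(2)
    by (intro conjI exI[of _ s] exI[of _ "\<lambda>_. {}"] ballI) simp_all
qed

lemma inv_step:
  assumes inv: "decoder_inv (T, \<sigma>, \<rho>)" and ne: "\<sigma> \<noteq> {}"
  shows "decoder_inv (T + 1, sym_diff \<sigma> (boundary \<L> k (sweep \<L> \<phi> \<sigma>)), sym_diff \<rho> (sweep \<L> \<phi> \<sigma>))"
proof -
  obtain s q where T: "T \<ge> 1" and \<sigma>: "\<sigma> = periodic R s" and \<rho>: "\<rho> = periodic R q"
    and ci: "\<And>r. r \<in> R \<Longrightarrow> cluster_inv T s q r"
    using inv unfolding decoder_inv_def by auto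
  have \<sigma>b: "\<sigma> \<in> boundary \<L> k ` chains \<L> k" using inv_syndrome(2)[OF ci] \<sigma> by simp
  have sc: "finite (s r) \<and> s r \<subseteq> cells \<L>" if "r \<in> R" for r using inv_cells(3,4)[OF ci[OF that] that] by simp
  note disj = inv_disjoint[OF ci T]
  define p where "p r = partial_sweep \<sigma> (s r)" for r
  define s' where "s' r = sym_diff (s r) (boundary \<L> k (p r))" for r
  define q' where "q' r = sym_diff (q r) (p r)" for r
  have pc: "finite (p r) \<and> p r \<subseteq> {\<kappa> \<in> cells \<L>. card \<kappa> = k + 1}" if "r \<in> R" for r
    unfolding p_def using partial_sweep_cells[OF \<sigma>b] sc[OF that] by simp
  have sw: "sweep \<L> \<phi> \<sigma> = periodic R p"
    unfolding p_def by (rule sweep_periodic[OF \<sigma>b R sc \<sigma> disj])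
  have iso: "restr \<sigma> v = restr (s r) v" if "r \<in> R" "v \<in> \<Union>(s r)" for r v
    by (rule restr_isolated[OF \<sigma>b R sc \<sigma> disj that])
  have "boundary \<L> k (periodic R p) = periodic R (\<lambda>r. boundary \<L> k (p r))"
    using pc by (intro boundary_periodic[OF R]) blast
  then have s': "sym_diff \<sigma> (boundary \<L> k (sweep \<L> \<phi> \<sigma>)) = periodic R s'"
  proof -
    have "finite (boundary \<L> k (p r)) \<and> boundary \<L> k (p r) \<subseteq> cells \<L>" if "r \<in> R" for r
      using finite_boundary[of "p r" k] cells_of_card[of "p r"] pc[OF that]
        cells_of_card[OF boundary_subset] by blast
    then have "periodic R s' = sym_diff (periodic R s) (periodic R (\<lambda>r. boundary \<L> k (p r)))"
      unfolding s'_def by (intro periodic_sym_diff[OF R sc])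
    then show ?thesis unfolding sw \<open>boundary \<L> k (periodic R p) = _\<close> using \<sigma> by simp
  qed
  have q': "sym_diff \<rho> (sweep \<L> \<phi> \<sigma>) = periodic R q'"
  proof -
    have "finite (q r) \<and> q r \<subseteq> cells \<L>" "finite (p r) \<and> p r \<subseteq> cells \<L>" if "r \<in> R" for r
      using ci[OF that] pc[OF that] cells_of_card unfolding cluster_inv_def by blast+
    then have "periodic R q' = sym_diff (periodic R q) (periodic R p)"
      unfolding q'_def by (intro periodic_sym_diff[OF R])
    then show ?thesis unfolding sw using \<rho> by simp
  qed
  have "cluster_inv (T + 1) s' q' r" if r: "r \<in> R" for r
  proof -
    have fin: "finite (s r)" "s r \<subseteq> cells \<L>" using sc[OF r] by auto
    have cq: "q r \<subseteq> {\<kappa> \<in> cells \<L>. card \<kappa> = k + 1}" "finite (q r)" "s r = boundary \<L> k (sym_diff (q r) r)"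
      using ci[OF r] by (auto simp: cluster_inv_def)
    have "sym_diff (q' r) r = sym_diff (sym_diff (q r) r) (p r)" unfolding q'_def by blast
    moreover have "boundary \<L> k (sym_diff (sym_diff (q r) r) (p r)) = s' r"
      unfolding s'_def cq(3) using cells_of_card[OF inv_cells(2)[OF ci[OF r] r]] pc[OF r]
      by (intro boundary_sym_diff) auto
    ultimately have "s' r = boundary \<L> k (sym_diff (q' r) r)" by simp
    moreover have "(\<exists>w\<in>\<Union>r. gdist \<L> w u < T + 1) \<and> precedes \<L> u (upper r) \<and> (\<exists>n\<ge>T. ascends (lower r) u n)"
      if u: "u \<in> \<Union>(s' r)" for u
    proof (intro conjI)
      have u': "u \<in> \<Union>(sym_diff (s r) (boundary \<L> k (partial_sweep \<sigma> (s r))))"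
        using u by (simp add: s'_def p_def)
      obtain v where v: "v \<in> \<Union>(s r)" "gdist \<L> v u \<le> 1" using swept_near[OF \<sigma>b fin u'] by blast
      obtain w where w: "w \<in> \<Union>r" "gdist \<L> w v < T" using ci[OF r] v(1) unfolding cluster_inv_def by blast
      have "w \<in> verts \<L>" "v \<in> verts \<L>" using w(1) v(1) cluster[OF r] fin(2) cell_vert by blast+
      moreover show "precedes \<L> u (upper r)"
      proof (rule swept_sup[OF \<sigma>b fin u' iso[OF r]])
        show "precedes \<L> v (upper r)" if "v \<in> \<Union>(s r)" for v
          using ci[OF r] that unfolding cluster_inv_def by blast
      qed
      ultimately have "gdist \<L> w u \<le> gdist \<L> w v + gdist \<L> v u"
        using gdist_triangle precedes_verts by blast
      then show "\<exists>w\<in>\<Union>r. gdist \<L> w u < T + 1" using w v by (intro bexI[of _ w]) auto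
      have "\<exists>n\<ge>T - 1. ascends (lower r) v n" if "v \<in> \<Union>(s r)" for v
        using ci[OF r] that unfolding cluster_inv_def by blast
      from swept_ascends[OF \<sigma>b fin u' iso[OF r] this] T
      show "\<exists>n\<ge>T. ascends (lower r) u n" by simp
    qed
    moreover have "finite (q' r) \<and> q' r \<subseteq> {\<kappa> \<in> cells \<L>. card \<kappa> = k + 1}"
      using cq pc[OF r] by (auto simp: q'_def)
    ultimately show ?thesis unfolding cluster_inv_def by simp
  qed
  moreover have "real (T + 1) \<le> Tm"
  proof -
    \<comment> \<open>Some cluster is still alive, so \<open>T - 1\<close> is within its lifetime.
      The 2 in \<open>cluster_time\<close> covers the start of the counter at 1 and the step being
      made.\<close>
    obtain r where r: "r \<in> R" "s r \<noteq> {}" using ne \<sigma> periodic_empty[of R s] by blast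
    then obtain \<tau> where \<tau>: "\<tau> \<in> s r" by blast
    then obtain u where "u \<in> \<tau>" using sc[OF r(1)] cell_nonempty by blast
    then have "real (T - 1) \<le> c\<^sub>P * c\<^sub>D * real (\<Delta> r)" using inv_time[OF ci[OF r(1)] r(1)] \<tau> by blast
    then show ?thesis using cluster_time(1)[OF r(1)] T by linarith
  qed
  ultimately show ?thesis unfolding decoder_inv_def s' q' using T by auto
qed

text \<open>The pieces of an empty syndrome are disjoint and hence empty one by one. Each cluster
  plus its correction is then a finite cycle of the lift, and all translates of the fillings
  together form an invariant chain.\<close>

lemma inv_success:
  assumes inv: "decoder_inv (T, {}, \<rho>)"
  shows "sym_diff \<rho> error \<in> boundary \<L> (k + 1) ` chains \<L> (k + 1)"
proof -
  obtain s q where T: "T \<ge> 1" and \<sigma>: "{} = periodic R s" and \<rho>: "\<rho> = periodic R q"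
    and ci: "\<And>r. r \<in> R \<Longrightarrow> cluster_inv T s q r"
    using inv unfolding decoder_inv_def by auto
  have \<sigma>b: "{} \<in> boundary \<L> k ` chains \<L> k" using inv_syndrome(2)[OF ci] \<sigma> by simp
  have sc: "finite (s r) \<and> s r \<subseteq> cells \<L>" if "r \<in> R" for r using inv_cells(3,4)[OF ci[OF that] that] by simp
  have se: "s r = {}" if "r \<in> R" for r
    using syndrome_Union[OF \<sigma>b R sc \<sigma> inv_disjoint[OF ci T]] that zero_shifts by fastforce
  have "\<forall>r\<in>R. \<exists>w. finite w \<and> w \<subseteq> {\<kappa> \<in> cells \<L>. card \<kappa> = k + 2} \<and> boundary \<L> (k + 1) w = sym_diff (q r) r"
  proof
    fix r assume r: "r \<in> R"
    show "\<exists>w. finite w \<and> w \<subseteq> {\<kappa> \<in> cells \<L>. card \<kappa> = k + 2} \<and> boundary \<L> (k + 1) w = sym_diff (q r) r"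
    using finite_cycle_is_boundary[OF inv_cells(1,2)[OF ci[OF r] r] _ k] se[OF r] ci[OF r]
    by (simp add: cluster_inv_def)
  qed
  from bchoice[OF this] obtain w where w: "\<forall>r\<in>R. finite (w r) \<and> w r \<subseteq> {\<kappa> \<in> cells \<L>. card \<kappa> = k + 2} \<and>
      boundary \<L> (k + 1) (w r) = sym_diff (q r) r" ..
  have "boundary \<L> (k + 1) (periodic R w) = periodic R (\<lambda>r. boundary \<L> (k + 1) (w r))"
    using w by (intro boundary_periodic[OF R]) blast
  also have "\<dots> = periodic R (\<lambda>r. sym_diff (q r) r)" using w by (intro periodic_cong) simp
  also have "\<dots> = sym_diff \<rho> error" unfolding \<rho> using sum_periodic[of T s q] ci by simp
  finally have "sym_diff \<rho> error = boundary \<L> (k + 1) (periodic R w)" by (rule sym)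
  moreover have "periodic R w \<in> chains \<L> (k + 1)" by (rule periodic_chain) (use w in auto)
  ultimately show ?thesis by (rule image_eqI)
qed

theorem decoder_succeeds: "\<not> decoder_fails \<L> k \<phi> Tm error"
proof -
  define b where "b = (\<lambda>(T :: nat, \<sigma> :: (real ^ 'd) set set, \<rho> :: (real ^ 'd) set set). \<not> (real T > Tm \<or> \<sigma> = {}))"
  define c where "c = (\<lambda>(T :: nat, \<sigma>, \<rho>). let \<rho>\<^sub>T = sweep \<L> \<phi> \<sigma> in
     (T + 1, sym_diff \<sigma> (boundary \<L> k \<rho>\<^sub>T), sym_diff \<rho> \<rho>\<^sub>T))"
  define st where "st = while b c (1, boundary \<L> k error, {})"
  have "case st of (T, \<sigma>, \<rho>) \<Rightarrow> \<sigma> = {} \<and> decoder_inv (T, \<sigma>, \<rho>)"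
    unfolding st_def
  proof (rule while_rule[where P = decoder_inv and r = "Wellfounded.measure (\<lambda>(T, _, _). nat \<lceil>Tm\<rceil> + 1 - T)"])
    fix st assume *: "decoder_inv st" "b st"
    obtain T \<sigma> \<rho> where st: "st = (T, \<sigma>, \<rho>)" by (cases st)
    have "\<sigma> \<noteq> {}" "real T \<le> Tm" using * by (auto simp: st b_def)
    then show "decoder_inv (c st)" using inv_step[of T \<sigma> \<rho>] * by (simp add: st c_def Let_def)
    have "T \<le> nat \<lceil>Tm\<rceil>" using \<open>real T \<le> Tm\<close> by linarith
    then show "(c st, st) \<in> Wellfounded.measure (\<lambda>(T, _, _). nat \<lceil>Tm\<rceil> + 1 - T)" by (simp add: st c_def Let_def)
  next
    fix st assume "decoder_inv st" "\<not> b st"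
    then show "case st of (T, \<sigma>, \<rho>) \<Rightarrow> \<sigma> = {} \<and> decoder_inv (T, \<sigma>, \<rho>)"
      by (cases st) (auto simp: b_def decoder_inv_def)
  qed (use inv_init in auto)
  then obtain T \<rho> where st: "st = (T, {}, \<rho>)" "decoder_inv (T, {}, \<rho>)" by (cases st) auto
  have "sweep_decoder \<L> k \<phi> Tm (boundary \<L> k error) = Some \<rho>"
    using st unfolding sweep_decoder_def st_def b_def c_def decoder_inv_def by simp
  then show ?thesis unfolding decoder_fails_def using inv_success[OF st(2)] by simp
qed

end

section \<open>Clusters\<close>

text \<open>\<open>D\<close> will be the largest distance between vertices of two simplices, so a
  simplex may have distance 1 from itself. \<open>Q \<ge> 5\<close> gives
  \<open>4 * Q ^ i \<le> (Q - 1) * Q ^ i\<close>, which brings two clusters of one level that meet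
  into the range controlled by isolation.\<close>

locale scaled_clusters =
  fixes C :: "'a set" and D :: "'a \<Rightarrow> 'a \<Rightarrow> nat" and Q :: nat
  assumes D_refl: "x \<in> C \<Longrightarrow> D x x \<le> 1"
    and D_sym: "x \<in> C \<Longrightarrow> y \<in> C \<Longrightarrow> D x y = D y x"
    and D_triangle: "x \<in> C \<Longrightarrow> y \<in> C \<Longrightarrow> z \<in> C \<Longrightarrow> D x z \<le> D x y + D y z"
    and Q: "Q \<ge> 5"
begin

section \<open>Hierarchical clusters\<close>

definition cl :: "nat \<Rightarrow> 'a set \<Rightarrow> 'a \<Rightarrow> 'a set" where
  "cl i E u = {v \<in> E. D u v \<le> 2 * Q ^ i}"

text \<open>No point may lie in the gap between \<open>2 * Q ^ i\<close> and
  \<open>(Q - 1) * Q ^ i\<close>. The lower end makes two trees of radius \<open>Q ^ i\<close>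
  disjoint if their roots are farther apart; the upper end keeps their union within radius
  \<open>Q ^ (i + 1)\<close>.\<close>

definition isolated :: "nat \<Rightarrow> 'a set \<Rightarrow> 'a \<Rightarrow> bool" where
  "isolated i E u \<longleftrightarrow> u \<in> E \<and> (\<forall>v\<in>E. D u v \<le> (Q - 1) * Q ^ i \<longrightarrow> D u v \<le> 2 * Q ^ i)"

lemma isolatedD: "isolated i E u \<Longrightarrow> v \<in> E \<Longrightarrow> D u v \<le> (Q - 1) * Q ^ i \<Longrightarrow> D u v \<le> 2 * Q ^ i"
  unfolding isolated_def by blast

primrec level :: "nat \<Rightarrow> 'a set \<Rightarrow> 'a set" where
  "level 0 E = E"
| "level (Suc i) E = level i E - \<Union>(cl i (level i E) ` {u. isolated i (level i E) u})"

definition level_cluster :: "nat \<Rightarrow> 'a set \<Rightarrow> 'a set \<Rightarrow> bool" where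
  "level_cluster i E c \<longleftrightarrow> c \<in> cl i (level i E) ` {u. isolated i (level i E) u}"

lemma level_antimono: "i \<le> j \<Longrightarrow> level j E \<subseteq> level i E"
  by (induction rule: dec_induct) auto

lemma level_subset: "level i E \<subseteq> E"
  using level_antimono[of 0 i E] by simp

lemma level_cluster_subset: "level_cluster i E c \<Longrightarrow> c \<subseteq> level i E"
  by (auto simp: level_cluster_def cl_def)

lemma level_Suc_disjoint: "level_cluster i E c \<Longrightarrow> c \<inter> level (Suc i) E = {}"
  by (auto simp: level_cluster_def)

lemma clusters_cover:
  assumes "level m E = {}" "x \<in> E"
  shows "\<exists>i<m. \<exists>c. level_cluster i E c \<and> x \<in> c"
proof -
  have "x \<in> level m E \<or> (\<exists>i<m. \<exists>c. level_cluster i E c \<and> x \<in> c)"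
  proof (induction m)
    case (Suc m)
    then show ?case
    proof
      assume "x \<in> level m E"
      then show ?thesis by (cases "x \<in> level (Suc m) E") (auto simp: level_cluster_def)
    qed (auto intro: less_SucI)
  qed (use assms in simp)
  then show ?thesis using assms by simp
qed

context
  fixes E assumes E: "E \<subseteq> C"
begin

lemma level_C: "x \<in> level i E \<Longrightarrow> x \<in> C"
  using level_subset E by blast

lemma isolated_in_cl: "isolated i (level i E) u \<Longrightarrow> u \<in> cl i (level i E) u"
  using D_refl[of u] level_C[of u] Q by (auto simp: isolated_def cl_def intro: order_trans)

lemma level_cluster_nonempty: "level_cluster i E c \<Longrightarrow> c \<noteq> {}"
  unfolding level_cluster_def using isolated_in_cl by fastforce

lemma level_cluster_diam:
  assumes "level_cluster i E c" "x \<in> c" "y \<in> c" shows "D x y \<le> 4 * Q ^ i"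
proof -
  obtain u where u: "u \<in> level i E" "c = cl i (level i E) u"
    using assms(1) by (auto simp: level_cluster_def isolated_def)
  then have "D u x \<le> 2 * Q ^ i" "D u y \<le> 2 * Q ^ i" "x \<in> C" "y \<in> C" "u \<in> C"
    using assms level_C by (auto simp: cl_def)
  then show ?thesis using D_triangle[of x u y] D_sym[of x u] by linarith
qed

text \<open>The centres are within \<open>4 * Q ^ i\<close> of each other, which isolation sharpens
  to \<open>2 * Q ^ i\<close>; the same sharpening then applies to any point of \<open>c\<close>.
  Equality follows by exchanging the clusters.\<close>

lemma same_level_clusters:
  assumes c: "level_cluster i E c" "level_cluster i E c'" and x: "x \<in> c" "x \<in> c'"
  shows "c \<subseteq> c'"
proof
  let ?L = "level i E"
  obtain u where u: "isolated i ?L u" "c = cl i ?L u" using c(1) by (auto simp: level_cluster_def)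
  obtain u' where u': "isolated i ?L u'" "c' = cl i ?L u'" using c(2) by (auto simp: level_cluster_def)
  have C: "u \<in> C" "u' \<in> C" "x \<in> C" "u \<in> ?L" "u' \<in> ?L"
    using u u' x level_C by (auto simp: isolated_def cl_def)
  have q: "4 * Q ^ i \<le> (Q - 1) * Q ^ i" using Q by (intro mult_right_mono) auto
  have "D u' u \<le> 4 * Q ^ i"
    using D_triangle[OF C(2,3,1)] D_sym[OF C(3,1)] x u u' by (auto simp: cl_def)
  then have uu: "D u' u \<le> 2 * Q ^ i" using isolatedD[OF u'(1) C(4)] q by linarith
  fix z assume z: "z \<in> c"
  then have zC: "z \<in> C" "z \<in> ?L" "D u z \<le> 2 * Q ^ i" using u level_C by (auto simp: cl_def)
  then have "D u' z \<le> 4 * Q ^ i" using D_triangle[OF C(2,1) zC(1)] uu by linarith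
  then have "D u' z \<le> 2 * Q ^ i" using isolatedD[OF u'(1) zC(2)] q by linarith
  then show "z \<in> c'" using u'(2) zC by (simp add: cl_def)
qed

text \<open>The point \<open>y\<close> is still present at level \<open>i\<close> but not in
  \<open>c\<close>, so by isolation it is more than \<open>(Q - 1) * Q ^ i\<close> away from the
  centre of \<open>c\<close>. The triangle inequality costs the radius \<open>2 * Q ^ i\<close> of
  \<open>c\<close>.\<close>

lemma clusters_separated:
  assumes c: "level_cluster i E c" and c': "level_cluster j E c'" and ij: "i \<le> j" "c \<noteq> c'"
    and xy: "x \<in> c" "y \<in> c'"
  shows "(Q - 3) * Q ^ i < D x y"
proof -
  let ?L = "level i E"
  obtain u where u: "isolated i ?L u" "c = cl i ?L u" using c by (auto simp: level_cluster_def)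
  have yL: "y \<in> level j E" "y \<in> ?L" using xy(2) level_cluster_subset[OF c'] level_antimono[OF ij(1)] by auto
  have C: "u \<in> C" "x \<in> C" "y \<in> C" using u xy(1) level_C yL by (auto simp: isolated_def cl_def)
  have "y \<notin> c"
  proof
    assume y: "y \<in> c"
    show False
    proof (cases "i = j")
      case True
      then show False
        using same_level_clusters[OF c _ y xy(2)] same_level_clusters[OF _ c xy(2) y] c' ij(2) by blast
    next
      case False
      then have "y \<in> level (Suc i) E" using yL level_antimono[of "Suc i" j E] ij(1) by auto
      then show False using level_Suc_disjoint[OF c] y by blast
    qed
  qed
  then have "(Q - 1) * Q ^ i < D u y"
    using u yL(2) unfolding isolated_def cl_def by (metis (no_types, lifting) mem_Collect_eq not_le)
  moreover have "D u y \<le> D u x + D x y" using D_triangle[OF C] .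
  moreover have "D u x \<le> 2 * Q ^ i" using xy(1) u by (simp add: cl_def)
  moreover have "(Q - 1) * Q ^ i = (Q - 3) * Q ^ i + 2 * Q ^ i"
  proof -
    have "Q - 1 = (Q - 3) + 2" using Q by simp
    then show ?thesis by (simp only: distrib_right)
  qed
  ultimately show ?thesis by linarith
qed

text \<open>Separation applied to a common point of two different clusters would give
  \<open>D x x > 1\<close>.\<close>

lemma clusters_meet:
  assumes "level_cluster i E c" "level_cluster j E c'" "x \<in> c" "x \<in> c'"
  shows "c = c'"
proof (rule ccontr)
  assume ne: "c \<noteq> c'"
  have x: "D x x \<le> 1" using D_refl level_C level_cluster_subset assms(1,3) by blast
  have "1 \<le> (Q - 3) * Q ^ n" for n
    using Q by (simp add: Suc_le_eq)
  moreover have "\<exists>n. (Q - 3) * Q ^ n < D x x"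
    using clusters_separated[OF assms(1,2) _ ne assms(3,4)] clusters_separated[OF assms(2,1) _ _ assms(4,3)] ne
    by (cases "i \<le> j") auto
  ultimately show False using x by (metis leD order_trans)
qed

text \<open>An isometry of \<open>E\<close> onto itself preserves isolation and so permutes the
  clusters of each level. Applied to shifts, this makes the decomposition descend to the
  torus.\<close>

lemma level_image:
  assumes f: "f ` E = E" "inj_on f E" "\<And>x y. x \<in> E \<Longrightarrow> y \<in> E \<Longrightarrow> D (f x) (f y) = D x y"
  shows "f ` level i E = level i E"
    and "level_cluster i E c \<Longrightarrow> level_cluster i E (f ` c)"
proof -
  have cl: "cl j L (f u) = f ` cl j L u"
    and iso: "isolated j L (f u) \<longleftrightarrow> isolated j L u"
    if "f ` L = L" "L \<subseteq> E" "u \<in> L" for j L u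
  proof -
    have D: "D (f u) (f v) = D u v" if "v \<in> L" for v
      using that \<open>L \<subseteq> E\<close> \<open>u \<in> L\<close> by (intro f(3)) auto
    have "cl j L (f u) = {v \<in> f ` L. D (f u) v \<le> 2 * Q ^ j}" by (simp only: cl_def \<open>f ` L = L\<close>)
    also have "\<dots> = f ` {v \<in> L. D (f u) (f v) \<le> 2 * Q ^ j}" by blast
    also have "\<dots> = f ` cl j L u" unfolding cl_def using D by (metis (mono_tags, lifting))
    finally show "cl j L (f u) = f ` cl j L u" .
    have fu: "f u \<in> L" using that by blast
    have "isolated j L (f u) \<longleftrightarrow> f u \<in> L \<and> (\<forall>v\<in>f ` L. D (f u) v \<le> (Q - 1) * Q ^ j \<longrightarrow> D (f u) v \<le> 2 * Q ^ j)"
      by (simp only: isolated_def \<open>f ` L = L\<close>)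
    also have "\<dots> \<longleftrightarrow> (\<forall>v\<in>L. D u v \<le> (Q - 1) * Q ^ j \<longrightarrow> D u v \<le> 2 * Q ^ j)" using fu D by simp
    also have "\<dots> \<longleftrightarrow> isolated j L u" using \<open>u \<in> L\<close> by (simp add: isolated_def)
    finally show "isolated j L (f u) \<longleftrightarrow> isolated j L u" .
  qed
  have clusters: "(\<lambda>c. f ` c) ` (cl j L ` {u. isolated j L u}) = cl j L ` {u. isolated j L u}"
    if L: "f ` L = L" "L \<subseteq> E" for j L
  proof -
    have "{u. isolated j L u} = f ` {u. isolated j L u}"
    proof (intro set_eqI iffI)
      fix u assume u: "u \<in> {u. isolated j L u}"
      then obtain w where "w \<in> L" "u = f w" using L(1) by (auto simp: isolated_def)
      then show "u \<in> f ` {u. isolated j L u}" using u iso[OF L] by auto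
    next
      fix u assume "u \<in> f ` {u. isolated j L u}"
      then show "u \<in> {u. isolated j L u}" using iso[OF L] by (auto simp: isolated_def)
    qed
    then have "cl j L ` {u. isolated j L u} = cl j L ` f ` {u. isolated j L u}" by (rule arg_cong)
    also have "\<dots> = (\<lambda>u. cl j L (f u)) ` {u. isolated j L u}" by (rule image_image)
    also have "\<dots> = (\<lambda>u. f ` cl j L u) ` {u. isolated j L u}"
      by (rule image_cong[OF refl]) (use cl[OF L] in \<open>auto simp: isolated_def\<close>)
    finally have e: "cl j L ` {u. isolated j L u} = (\<lambda>u. f ` cl j L u) ` {u. isolated j L u}" .
    show ?thesis unfolding image_image by (rule e[symmetric])
  qed
  show lev: "f ` level i E = level i E" for i
  proof (induction i)
    case (Suc i)
    have sub: "cl i (level i E) u \<subseteq> E" for u using level_subset by (auto simp: cl_def)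
    have "f ` level (Suc i) E = f ` level i E - f ` \<Union>(cl i (level i E) ` {u. isolated i (level i E) u})"
      unfolding level.simps using sub level_subset by (intro inj_on_image_set_diff[OF f(2)]) blast+
    also have "f ` \<Union>(cl i (level i E) ` {u. isolated i (level i E) u}) =
        \<Union>((\<lambda>c. f ` c) ` (cl i (level i E) ` {u. isolated i (level i E) u}))" by blast
    also have "\<dots> = \<Union>(cl i (level i E) ` {u. isolated i (level i E) u})"
      using clusters[OF Suc level_subset] by simp
    finally show ?case using Suc by simp
  qed (use f in simp)
  show "level_cluster i E c \<Longrightarrow> level_cluster i E (f ` c)"
    unfolding level_cluster_def using clusters[OF lev level_subset, of i i] by blast
qed

end

section \<open>Witness trees of surviving points\<close>

primrec trees :: "nat \<Rightarrow> 'a \<Rightarrow> 'a set set" where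
  "trees 0 v = {{v}}"
| "trees (Suc i) v = (\<Union>w\<in>{w \<in> C. 2 * Q ^ i < D v w \<and> D v w \<le> (Q - 1) * Q ^ i}.
     (\<lambda>(A, B). A \<union> B) ` (trees i v \<times> trees i w))"

text \<open>A tree is recorded by the set of its leaves. Two subtrees of radius \<open>Q ^ i\<close>
  whose roots are more than \<open>2 * Q ^ i\<close> apart share no leaf, so the number of leaves
  doubles exactly.\<close>

lemma trees_props:
  "v \<in> C \<Longrightarrow> A \<in> trees i v \<Longrightarrow> finite A \<and> A \<subseteq> C \<and> card A = 2 ^ i \<and> (\<forall>x\<in>A. D v x \<le> Q ^ i)"
proof (induction i arbitrary: v A)
  case 0 then show ?case using D_refl by simp
next
  case (Suc i)
  then obtain w A1 A2 where w: "w \<in> C" "2 * Q ^ i < D v w" "D v w \<le> (Q - 1) * Q ^ i"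
    and A: "A1 \<in> trees i v" "A2 \<in> trees i w" "A = A1 \<union> A2" by auto
  have 1: "finite A1 \<and> A1 \<subseteq> C \<and> card A1 = 2 ^ i \<and> (\<forall>x\<in>A1. D v x \<le> Q ^ i)"
    using Suc.IH Suc.prems A by blast
  have 2: "finite A2 \<and> A2 \<subseteq> C \<and> card A2 = 2 ^ i \<and> (\<forall>x\<in>A2. D w x \<le> Q ^ i)"
    using Suc.IH w A by blast
  have "A1 \<inter> A2 = {}"
  proof (rule ccontr)
    assume "A1 \<inter> A2 \<noteq> {}"
    then obtain x where x: "x \<in> A1" "x \<in> A2" by blast
    then have "x \<in> C" "D v x \<le> Q ^ i" "D w x \<le> Q ^ i" using 1 2 by auto
    then show False using D_triangle[of v x w] D_sym[of x w] w Suc.prems by auto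
  qed
  then have "card A = 2 ^ Suc i" using 1 2 A by (simp add: card_Un_disjoint)
  moreover have "D v x \<le> Q ^ Suc i" if "x \<in> A" for x
  proof (cases "x \<in> A1")
    case True
    then have "D v x \<le> Q ^ i" using 1 by blast
    also have "\<dots> \<le> Q ^ Suc i" using Q by simp
    finally show ?thesis .
  next
    case False
    then have "x \<in> C" "D w x \<le> Q ^ i" using that A 2 by auto
    then have "D v x \<le> (Q - 1) * Q ^ i + Q ^ i" using D_triangle[of v w x] w Suc.prems by linarith
    also have "\<dots> = Q ^ Suc i" using Q by (cases Q) auto
    finally show ?thesis .
  qed
  ultimately show ?case using 1 2 A by simp
qed

text \<open>An isolated point belongs to its own cluster and is removed. A survivor thus has a
  partner \<open>w\<close> in the gap, present at the same level, and the trees of the two are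
  joined.\<close>

lemma level_tree:
  assumes "E \<subseteq> C" shows "v \<in> level i E \<Longrightarrow> \<exists>A\<in>trees i v. A \<subseteq> E"
proof (induction i arbitrary: v)
  case (Suc i)
  then have v: "v \<in> level i E" "v \<notin> cl i (level i E) v \<or> \<not> isolated i (level i E) v" by auto
  then have "\<not> isolated i (level i E) v" using isolated_in_cl[OF assms] by blast
  then obtain w where w: "w \<in> level i E" "D v w \<le> (Q - 1) * Q ^ i" "2 * Q ^ i < D v w"
    using v(1) by (auto simp: isolated_def not_le)
  obtain A B where "A \<in> trees i v" "A \<subseteq> E" "B \<in> trees i w" "B \<subseteq> E"
    using Suc.IH[OF v(1)] Suc.IH[OF w(1)] by blast
  then show ?case using w level_C[OF assms w(1)] by (intro bexI[of _ "A \<union> B"]) auto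
qed auto

lemma card_trees:
  fixes B q :: real
  assumes B: "B \<ge> 1" and q: "q \<ge> 1"
    and balls: "\<And>v i. v \<in> C \<Longrightarrow> i < m \<Longrightarrow> finite {w \<in> C. D v w \<le> (Q - 1) * Q ^ i} \<and>
      real (card {w \<in> C. D v w \<le> (Q - 1) * Q ^ i}) \<le> B * q ^ (i + 1)"
    and v: "v \<in> C" and i: "i \<le> m"
  shows "finite (trees i v)" "real (card (trees i v)) \<le> (B * q\<^sup>2) ^ (2 ^ i)"
proof -
  \<comment> \<open>The numbers \<open>N i\<close> of trees obey
    \<open>N (i + 1) \<le> B * q ^ (i + 1) * (N i)\<^sup>2\<close>. The weight
    \<open>B * q ^ (i + 2)\<close> turns this into plain squaring, starting from
    \<open>B * q\<^sup>2\<close>.\<close>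
  have "finite (trees i v) \<and> real (card (trees i v)) * (B * q ^ (i + 2)) \<le> (B * q\<^sup>2) ^ (2 ^ i)"
    using v i
  proof (induction i arbitrary: v)
    case (Suc i)
    define W where "W = {w \<in> C. 2 * Q ^ i < D v w \<and> D v w \<le> (Q - 1) * Q ^ i}"
    define M where "M = (B * q\<^sup>2) ^ (2 ^ i) / (B * q ^ (i + 2))"
    have pos: "B * q ^ n > 0" for n using B q by simp
    have IH: "finite (trees i w)" "real (card (trees i w)) \<le> M" if "w \<in> C" for w
      using Suc.IH[OF that] Suc.prems pos[of "i + 2"] unfolding M_def by (auto simp: le_divide_eq)
    have W: "W \<subseteq> {w \<in> C. D v w \<le> (Q - 1) * Q ^ i}" by (auto simp: W_def)
    have fW: "finite W" using finite_subset[OF W] balls[of v i] Suc.prems by simp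
    have "real (card W) \<le> real (card {w \<in> C. D v w \<le> (Q - 1) * Q ^ i})"
      using card_mono[OF _ W] balls[of v i] Suc.prems by simp
    also have "\<dots> \<le> B * q ^ (i + 1)" using balls[of v i] Suc.prems by simp
    finally have cW: "real (card W) \<le> B * q ^ (i + 1)" .
    have M0: "M \<ge> 0" using IH[OF Suc.prems(1)] by linarith
    define g where "g w = (\<lambda>(A, B). A \<union> B) ` (trees i v \<times> trees i w)" for w
    have trees: "trees (Suc i) v = (\<Union>w\<in>W. g w)" by (simp add: W_def g_def)
    have fin: "finite (g w)" if "w \<in> W" for w
      unfolding g_def using IH(1) Suc.prems that by (auto simp: W_def)
    have "real (card (trees (Suc i) v)) \<le> (\<Sum>w\<in>W. real (card (g w)))"
      unfolding trees using card_UN_le[OF fW, of g] by (simp flip: of_nat_sum)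
    also have "\<dots> \<le> (\<Sum>w\<in>W. M * M)"
    proof (rule sum_mono)
      fix w assume "w \<in> W"
      then have w: "w \<in> C" by (simp add: W_def)
      have "card (g w) \<le> card (trees i v \<times> trees i w)"
        unfolding g_def by (intro card_image_le finite_cartesian_product IH(1) w Suc.prems)
      then have "real (card (g w)) \<le> real (card (trees i v)) * real (card (trees i w))"
        by (simp add: card_cartesian_product flip: of_nat_mult)
      also have "\<dots> \<le> M * M" using IH(2)[OF Suc.prems(1)] IH(2)[OF w] M0 by (intro mult_mono) auto
      finally show "real (card (g w)) \<le> M * M" .
    qed
    also have "\<dots> \<le> (B * q ^ (i + 1)) * (M * M)"
      using cW M0 by (simp add: mult_right_mono)
    finally have "real (card (trees (Suc i) v)) * (B * q ^ (Suc i + 2)) \<le>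
       (B * q ^ (i + 1)) * (M * M) * (B * q ^ (Suc i + 2))"
      using pos[of "Suc i + 2"] by (intro mult_right_mono) auto
    also have "\<dots> = (M * (B * q ^ (i + 2)))\<^sup>2"
      by (simp add: power2_eq_square power_add algebra_simps)
    also have "\<dots> = (B * q\<^sup>2) ^ (2 ^ Suc i)"
      using pos[of "i + 2"] unfolding M_def by (simp add: power_mult[symmetric] mult.commute)
    finally show ?case using fin fW unfolding trees by blast
  qed (use B q in \<open>simp add: power2_eq_square\<close>)
  then show "finite (trees i v)" and *: "real (card (trees i v)) \<le> (B * q\<^sup>2) ^ (2 ^ i)"
  proof -
    assume h: "finite (trees i v) \<and> real (card (trees i v)) * (B * q ^ (i + 2)) \<le> (B * q\<^sup>2) ^ (2 ^ i)"
    have "1 * 1 \<le> B * q ^ (i + 2)" using B q by (intro mult_mono one_le_power) auto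
    then have "real (card (trees i v)) * 1 \<le> real (card (trees i v)) * (B * q ^ (i + 2))"
      by (intro mult_left_mono) auto
    then show "real (card (trees i v)) \<le> (B * q\<^sup>2) ^ (2 ^ i)" using h by simp
  qed simp
qed

end

context torus_triangulation
begin

text \<open>The largest distance between vertices satisfies the triangle inequality, which the
  smallest does not; the price is that cells with several vertices have distance 1 from
  themselves.\<close>

definition cdist :: "(real ^ 'd) set \<Rightarrow> (real ^ 'd) set \<Rightarrow> nat" where
  "cdist \<kappa> \<tau> = Max ((\<lambda>(u, v). gdist \<L> u v) ` (\<kappa> \<times> \<tau>))"

lemma gdist_le_cdist:
  "\<kappa> \<in> cells \<L> \<Longrightarrow> \<tau> \<in> cells \<L> \<Longrightarrow> u \<in> \<kappa> \<Longrightarrow> v \<in> \<tau> \<Longrightarrow> gdist \<L> u v \<le> cdist \<kappa> \<tau>"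
  unfolding cdist_def using cell_finite by (intro Max_ge) auto

lemma cdist_attained:
  assumes "\<kappa> \<in> cells \<L>" "\<tau> \<in> cells \<L>"
  obtains u v where "u \<in> \<kappa>" "v \<in> \<tau>" "cdist \<kappa> \<tau> = gdist \<L> u v"
proof -
  have "cdist \<kappa> \<tau> \<in> (\<lambda>(u, v). gdist \<L> u v) ` (\<kappa> \<times> \<tau>)"
    unfolding cdist_def using assms cell_finite cell_nonempty by (intro Max_in) auto
  then show thesis using that by auto
qed

lemma cdist_sym:
  assumes "\<kappa> \<in> cells \<L>" "\<tau> \<in> cells \<L>" shows "cdist \<kappa> \<tau> = cdist \<tau> \<kappa>"
proof -
  have "cdist \<kappa> \<tau> \<le> cdist \<tau> \<kappa>" if k: "\<kappa> \<in> cells \<L>" "\<tau> \<in> cells \<L>" for \<kappa> \<tau>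
  proof -
    obtain u v where uv: "u \<in> \<kappa>" "v \<in> \<tau>" "cdist \<kappa> \<tau> = gdist \<L> u v" using cdist_attained[OF k] .
    then show ?thesis
      using gdist_le_cdist[OF k(2,1) uv(2,1)] gdist_commute[of u v] cell_vert k by metis
  qed
  then show ?thesis using assms by (simp add: antisym)
qed

lemma cdist_refl:
  assumes "\<kappa> \<in> cells \<L>" shows "cdist \<kappa> \<kappa> \<le> 1"
proof -
  obtain u v where uv: "u \<in> \<kappa>" "v \<in> \<kappa>" "cdist \<kappa> \<kappa> = gdist \<L> u v" using cdist_attained[OF assms assms] .
  then show ?thesis using gdist_cell[OF assms] by simp
qed

lemma cdist_triangle:
  assumes "\<kappa> \<in> cells \<L>" "\<mu> \<in> cells \<L>" "\<tau> \<in> cells \<L>"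
  shows "cdist \<kappa> \<tau> \<le> cdist \<kappa> \<mu> + cdist \<mu> \<tau>"
proof -
  obtain u v where uv: "u \<in> \<kappa>" "v \<in> \<tau>" "cdist \<kappa> \<tau> = gdist \<L> u v" using cdist_attained[OF assms(1,3)] .
  obtain w where w: "w \<in> \<mu>" using cell_nonempty[OF assms(2)] by blast
  have "gdist \<L> u v \<le> gdist \<L> u w + gdist \<L> w v"
    using assms uv w cell_vert by (intro gdist_triangle) auto
  also have "\<dots> \<le> cdist \<kappa> \<mu> + cdist \<mu> \<tau>"
    using assms uv w by (intro add_mono gdist_le_cdist)
  finally show ?thesis using uv(3) by simp
qed

lemma cdist_le_gdist:
  assumes k: "\<kappa> \<in> cells \<L>" "\<tau> \<in> cells \<L>" and uv: "u \<in> \<kappa>" "v \<in> \<tau>"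
  shows "cdist \<kappa> \<tau> \<le> gdist \<L> u v + 2"
proof -
  obtain u' v' where u': "u' \<in> \<kappa>" "v' \<in> \<tau>" "cdist \<kappa> \<tau> = gdist \<L> u' v'" using cdist_attained[OF k] .
  have v: "u \<in> verts \<L>" "v \<in> verts \<L>" "u' \<in> verts \<L>" "v' \<in> verts \<L>" using k uv u' cell_vert by auto
  have "gdist \<L> u' v' \<le> gdist \<L> u' u + (gdist \<L> u v + gdist \<L> v v')"
    using gdist_triangle[OF v(3,1,4)] gdist_triangle[OF v(1,2,4)] by linarith
  moreover have "gdist \<L> u' u \<le> 1" "gdist \<L> v v' \<le> 1" using gdist_cell k uv u' by blast+
  ultimately show ?thesis using u'(3) by linarith
qed

lemma cdist_shift:
  assumes k: "\<kappa> \<in> cells \<L>" "\<tau> \<in> cells \<L>" and a: "a \<in> shifts \<L>"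
  shows "cdist ((+) a ` \<kappa>) ((+) a ` \<tau>) = cdist \<kappa> \<tau>"
proof -
  have "(\<lambda>(u, v). gdist \<L> u v) ` ((+) a ` \<kappa> \<times> (+) a ` \<tau>) = (\<lambda>(u, v). gdist \<L> (a + u) (a + v)) ` (\<kappa> \<times> \<tau>)"
    by (force simp: image_iff)
  also have "\<dots> = (\<lambda>(u, v). gdist \<L> u v) ` (\<kappa> \<times> \<tau>)"
    using gdist_shift k a cell_vert by (intro image_cong) auto
  finally show ?thesis by (simp add: cdist_def)
qed

lemma scaled_clusters_cells: "Q \<ge> 5 \<Longrightarrow> scaled_clusters {\<kappa> \<in> cells \<L>. card \<kappa> = j} cdist Q"
  by unfold_locales (use cdist_refl cdist_sym cdist_triangle in simp_all)

end

text \<open>A simplex at a vertex is a set of vertices at distance less than 2 from it, of which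
  there are at most \<open>c * 2 ^ d\<close>. The power of 2 counts all such sets, in all
  dimensions.\<close>

definition max_star :: "nat \<Rightarrow> real \<Rightarrow> nat" where
  "max_star d c = 2 ^ nat \<lfloor>c * 2 ^ d\<rfloor>"

context sweeping
begin

section \<open>Counting simplices in balls\<close>

lemma gball_mem:
  assumes "v \<in> verts \<L>"
  shows "\<kappa> \<in> gball \<L> v (real n) \<longleftrightarrow> \<kappa> \<in> cells \<L> \<and> (\<exists>u\<in>\<kappa>. gdist \<L> v u < n)"
proof -
  have "(MIN u\<in>\<kappa>. gdist \<L> v u) < n \<longleftrightarrow> (\<exists>u\<in>\<kappa>. gdist \<L> v u < n)" if "\<kappa> \<in> cells \<L>"
    using cell_finite[OF that] cell_nonempty[OF that] by (subst Min_less_iff) auto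
  then show ?thesis by (auto simp: gball_def)
qed

text \<open>A ball of radius 1 contains no vertex except its centre, so a cover by such balls lists
  all vertices. Simplices may stick out of the ball of radius \<open>n\<close>, but the vertices of
  its simplices stay within \<open>n\<close> of \<open>v\<close>; this gives the diameter
  \<open>2 * n\<close>.\<close>

lemma vertex_ball:
  assumes v: "v \<in> verts \<L>" and n: "n \<ge> 2" and loc: "2 * real n \<le> l * real (linear_size \<L>)"
  shows "finite {w \<in> verts \<L>. gdist \<L> v w < n}"
    and "real (card {w \<in> verts \<L>. gdist \<L> v w < n}) \<le> c\<^sub>B * real n ^ CARD('d)"
proof -
  have near: "gdist \<L> v x \<le> n" "x \<in> verts \<L>" if x: "x \<in> \<Union>(gball \<L> v (real n))" for x
  proof -
    obtain \<kappa> u where k: "\<kappa> \<in> cells \<L>" "x \<in> \<kappa>" "u \<in> \<kappa>" "gdist \<L> v u < n"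
      using x unfolding gball_mem[OF v] Union_iff Bex_def by blast
    then show "x \<in> verts \<L>" using cell_vert by blast
    then show "gdist \<L> v x \<le> n"
      using gdist_triangle[OF v cell_vert[OF k(1,3)], of x] gdist_cell[OF k(1,3,2)] k(4) by linarith
  qed
  have "local_region \<L> l (\<Union>(gball \<L> v (real n)))"
  proof (rule local_regionI[of _ "2 * n"])
    fix x y assume "x \<in> \<Union>(gball \<L> v (real n))" "y \<in> \<Union>(gball \<L> v (real n))"
    then have x: "gdist \<L> v x \<le> n" "x \<in> verts \<L>" and y: "gdist \<L> v y \<le> n" "y \<in> verts \<L>"
      using near by blast+
    show "gdist \<L> x y \<le> 2 * n"
      using gdist_triangle[OF x(2) v y(2)] gdist_commute[OF v x(2)] x y by linarith
  qed (use near loc in auto)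
  moreover have "\<forall>v\<in>verts \<L>. \<forall>R r. 0 < r \<and> r < R \<and> local_region \<L> l (\<Union>(gball \<L> v R)) \<longrightarrow>
        (\<exists>U. U \<subseteq> verts \<L> \<and> finite U \<and> gball \<L> v R \<subseteq> (\<Union>u\<in>U. gball \<L> u r) \<and>
             real (card U) \<le> c\<^sub>B * (R / r) ^ CARD('d))"
    using causal unfolding causal_def by (elim conjE) assumption
  moreover have "(0 :: real) < 1 \<and> 1 < real n" using n by simp
  ultimately obtain U where U: "U \<subseteq> verts \<L>" "finite U" "gball \<L> v (real n) \<subseteq> (\<Union>u\<in>U. gball \<L> u 1)"
      "real (card U) \<le> c\<^sub>B * (real n / 1) ^ CARD('d)"
    using v by meson
  have sub: "{w \<in> verts \<L>. gdist \<L> v w < n} \<subseteq> U"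
  proof
    fix w assume "w \<in> {w \<in> verts \<L>. gdist \<L> v w < n}"
    then have w: "w \<in> verts \<L>" "{w} \<in> gball \<L> v (real n)" unfolding gball_mem[OF v] by (auto simp: verts_def)
    then obtain u where u: "u \<in> U" "{w} \<in> gball \<L> u (real 1)" using U(3) by auto
    then have "u \<in> verts \<L>" using U(1) by blast
    then have "gdist \<L> u w = 0" using u(2) gball_mem[of u "{w}" 1] by simp
    then show "w \<in> U" using gdist_eq_0[OF \<open>u \<in> verts \<L>\<close> w(1)] u(1) by simp
  qed
  show "finite {w \<in> verts \<L>. gdist \<L> v w < n}" using sub U(2) by (rule finite_subset)
  have "real (card {w \<in> verts \<L>. gdist \<L> v w < n}) \<le> real (card U)" using card_mono[OF U(2) sub] by simp
  then show "real (card {w \<in> verts \<L>. gdist \<L> v w < n}) \<le> c\<^sub>B * real n ^ CARD('d)" using U(4) by simp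
qed

lemma card_vertex_star:
  assumes v: "v \<in> verts \<L>" and loc: "4 \<le> l * real (linear_size \<L>)"
  shows "card {\<kappa> \<in> cells \<L>. v \<in> \<kappa>} \<le> max_star CARD('d) c\<^sub>B"
proof -
  let ?N = "{w \<in> verts \<L>. gdist \<L> v w < 2}"
  have N: "finite ?N" "real (card ?N) \<le> c\<^sub>B * real 2 ^ CARD('d)"
    using vertex_ball[OF v, of 2] loc by simp_all
  have "\<kappa> \<in> Pow ?N" if "\<kappa> \<in> cells \<L>" "v \<in> \<kappa>" for \<kappa>
    using gdist_cell[OF that] cell_vert[OF that(1)] by force
  then have "card {\<kappa> \<in> cells \<L>. v \<in> \<kappa>} \<le> card (Pow ?N)"
    using N(1) by (intro card_mono) auto
  also have "\<dots> = 2 ^ card ?N" using N(1) by (rule card_Pow)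
  also have "\<dots> \<le> max_star CARD('d) c\<^sub>B"
    unfolding max_star_def using N(2) by (intro power_increasing) (auto simp: le_nat_floor)
  finally show ?thesis .
qed

lemma cell_ball:
  assumes \<kappa>: "\<kappa> \<in> cells \<L>" and n: "n \<ge> 1" and loc: "2 * real (n + 1) \<le> l * real (linear_size \<L>)"
  shows "finite {\<tau> \<in> cells \<L>. cdist \<kappa> \<tau> \<le> n}"
    and "real (card {\<tau> \<in> cells \<L>. cdist \<kappa> \<tau> \<le> n}) \<le> real (max_star CARD('d) c\<^sub>B) * (c\<^sub>B * real (n + 1) ^ CARD('d))"
proof -
  obtain v where v: "v \<in> \<kappa>" using cell_nonempty[OF \<kappa>] by blast
  have vv: "v \<in> verts \<L>" using cell_vert \<kappa> v by blast
  let ?N = "{w \<in> verts \<L>. gdist \<L> v w < n + 1}"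
  have N: "finite ?N" "real (card ?N) \<le> c\<^sub>B * real (n + 1) ^ CARD('d)"
    using vertex_ball[OF vv, of "n + 1"] n loc by simp_all
  have sub: "{\<tau> \<in> cells \<L>. cdist \<kappa> \<tau> \<le> n} \<subseteq> (\<Union>w\<in>?N. {\<tau> \<in> cells \<L>. w \<in> \<tau>})"
  proof
    fix \<tau> assume "\<tau> \<in> {\<tau> \<in> cells \<L>. cdist \<kappa> \<tau> \<le> n}"
    then have \<tau>: "\<tau> \<in> cells \<L>" "cdist \<kappa> \<tau> \<le> n" by auto
    obtain w where w: "w \<in> \<tau>" using cell_nonempty[OF \<tau>(1)] by blast
    then have "w \<in> ?N" using gdist_le_cdist[OF \<kappa> \<tau>(1) v w] \<tau> cell_vert by auto
    then show "\<tau> \<in> (\<Union>w\<in>?N. {\<tau> \<in> cells \<L>. w \<in> \<tau>})" using \<tau>(1) w by blast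
  qed
  have fin: "finite (\<Union>w\<in>?N. {\<tau> \<in> cells \<L>. w \<in> \<tau>})" using N(1) finite_vertex_star by blast
  show "finite {\<tau> \<in> cells \<L>. cdist \<kappa> \<tau> \<le> n}" using finite_subset[OF sub fin] .
  have "card {\<tau> \<in> cells \<L>. cdist \<kappa> \<tau> \<le> n} \<le> (\<Sum>w\<in>?N. card {\<tau> \<in> cells \<L>. w \<in> \<tau>})"
    using card_mono[OF fin sub] card_UN_le[OF N(1), of "\<lambda>w. {\<tau> \<in> cells \<L>. w \<in> \<tau>}"] by linarith
  also have "\<dots> \<le> (\<Sum>w\<in>?N. max_star CARD('d) c\<^sub>B)"
    using n loc by (intro sum_mono card_vertex_star) auto
  finally have "real (card {\<tau> \<in> cells \<L>. cdist \<kappa> \<tau> \<le> n}) \<le> real (card ?N) * real (max_star CARD('d) c\<^sub>B)"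
    by (simp flip: of_nat_mult)
  also have "\<dots> \<le> (c\<^sub>B * real (n + 1) ^ CARD('d)) * real (max_star CARD('d) c\<^sub>B)" using N(2) by (intro mult_right_mono) auto
  finally show "real (card {\<tau> \<in> cells \<L>. cdist \<kappa> \<tau> \<le> n}) \<le> real (max_star CARD('d) c\<^sub>B) * (c\<^sub>B * real (n + 1) ^ CARD('d))"
    by (simp add: mult.commute)
qed

end

text \<open>Clusters of level \<open>i\<close> have diameter at most \<open>4 * Q ^ i\<close>. Twice
  their lifetime gives the 8 in \<open>Q_large\<close>; the 5 is made of the 3 in the separation
  \<open>(Q - 3) * Q ^ i\<close> and the 2 that \<open>cdist\<close> may exceed \<open>gdist\<close>
  by. The conditions on \<open>Q ^ m\<close> say that clusters of level below \<open>m\<close> and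
  their diamonds are local and that the decoder has time for them.\<close>

locale scaled_sweeping = sweeping \<L> k l c\<^sub>B c\<^sub>D c\<^sub>P \<phi>
  for \<L> :: "'d::finite torus_lattice" and k l c\<^sub>B c\<^sub>D c\<^sub>P \<phi> +
  fixes Q m :: nat and Tm :: real
  assumes Q5: "Q \<ge> 5" and Q_large: "8 * (c\<^sub>P * c\<^sub>D) + 5 \<le> real Q"
    and l1: "0 < l" "l \<le> 1"
    and scale_local: "8 * real Q ^ m \<le> l * real (linear_size \<L>)"
      "4 * c\<^sub>D * real Q ^ m \<le> l * real (linear_size \<L>)"
    and scale_time: "4 * (c\<^sub>P * c\<^sub>D) * real Q ^ m + 2 \<le> Tm"
begin

abbreviation qubits :: "(real ^ 'd) set set" where
  "qubits \<equiv> {\<kappa> \<in> cells \<L>. card \<kappa> = k + 1}"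

sublocale scaled_clusters qubits cdist Q
  by (rule scaled_clusters_cells[OF Q5])

lemma pow_le: "i \<le> m \<Longrightarrow> real Q ^ i \<le> real Q ^ m"
  using Q5 by (intro power_increasing) auto

lemma ball_radius:
  assumes "i < m"
  shows "(Q - 1) * Q ^ i \<ge> 1" "(Q - 1) * Q ^ i + 1 \<le> Q ^ (i + 1)"
    "2 * real ((Q - 1) * Q ^ i + 1) \<le> l * real (linear_size \<L>)"
proof -
  have 1: "Q ^ i \<ge> 1" using Q5 by simp
  have 2: "(Q - 1) * Q ^ i + Q ^ i = Q ^ (i + 1)" using Q5 by (cases Q) auto
  have "1 * 1 \<le> (Q - 1) * Q ^ i" using Q5 1 by (intro mult_le_mono) auto
  then show "(Q - 1) * Q ^ i \<ge> 1" by simp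
  show 3: "(Q - 1) * Q ^ i + 1 \<le> Q ^ (i + 1)" using 1 2 by linarith
  then have "real ((Q - 1) * Q ^ i + 1) \<le> real (Q ^ (i + 1))" by (simp only: of_nat_le_iff)
  also have "\<dots> \<le> real Q ^ m" using pow_le[of "i + 1"] assms by simp
  finally have "2 * real ((Q - 1) * Q ^ i + 1) \<le> 2 * real Q ^ m" by simp
  also have "\<dots> \<le> 8 * real Q ^ m" by (intro mult_right_mono) auto
  finally show "2 * real ((Q - 1) * Q ^ i + 1) \<le> l * real (linear_size \<L>)"
    using scale_local(1) by linarith
qed

context
  fixes E assumes E: "E \<in> chains \<L> k"
begin

section \<open>Clusters of an invariant error\<close>

lemma E_qubits: "E \<subseteq> qubits" and E_shift: "a \<in> shifts \<L> \<Longrightarrow> shift a E = E"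
  using E shift_inverse_subset[of E a] by (auto simp: chains_iff)

lemma shift_image:
  assumes "a \<in> shifts \<L>"
  shows shift_level: "shift a (level i E) = level i E"
    and shift_cluster: "level_cluster i E c \<Longrightarrow> level_cluster i E (shift a c)"
proof -
  have f: "(\<lambda>\<kappa>. (+) a ` \<kappa>) ` E = E" using E_shift[OF assms] by (simp add: shift_def)
  have inj: "inj_on (\<lambda>\<kappa>. (+) a ` \<kappa>) E" using inj_plus_image by (rule inj_on_subset) simp
  have D: "cdist ((+) a ` x) ((+) a ` y) = cdist x y" if "x \<in> E" "y \<in> E" for x y
    using that E_qubits by (intro cdist_shift assms) auto
  show "shift a (level i E) = level i E" unfolding shift_def by (rule level_image(1)[OF E_qubits f inj D])
  show "level_cluster i E c \<Longrightarrow> level_cluster i E (shift a c)"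
    unfolding shift_def by (rule level_image(2)[OF E_qubits f inj D])
qed

lemma cluster_cells:
  assumes "level_cluster i E c" "i < m"
  shows "c \<subseteq> qubits" "finite c" "c \<noteq> {}"
proof -
  show c: "c \<subseteq> qubits" using level_cluster_subset[OF assms(1)] level_subset E_qubits by blast
  show ne: "c \<noteq> {}" using level_cluster_nonempty[OF E_qubits assms(1)] .
  obtain \<kappa> where \<kappa>: "\<kappa> \<in> c" using ne by blast
  have q: "4 * Q ^ i \<le> (Q - 1) * Q ^ i" using Q5 by (intro mult_right_mono) auto
  have "c \<subseteq> {\<tau> \<in> cells \<L>. cdist \<kappa> \<tau> \<le> (Q - 1) * Q ^ i}"
    using order_trans[OF level_cluster_diam[OF E_qubits assms(1) \<kappa>] q] c by blast
  moreover have "finite {\<tau> \<in> cells \<L>. cdist \<kappa> \<tau> \<le> (Q - 1) * Q ^ i}"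
    using \<kappa> c ball_radius[OF assms(2)] by (intro cell_ball(1)) auto
  ultimately show "finite c" by (rule finite_subset)
qed

definition clusters :: "(real ^ 'd) set set set" where
  "clusters = {c. \<exists>i<m. level_cluster i E c}"

lemma clusters_shift: "c \<in> clusters \<Longrightarrow> a \<in> shifts \<L> \<Longrightarrow> shift a c \<in> clusters"
  unfolding clusters_def using shift_cluster by blast

lemma clusters_eq: "c \<in> clusters \<Longrightarrow> c' \<in> clusters \<Longrightarrow> \<kappa> \<in> c \<Longrightarrow> \<kappa> \<in> c' \<Longrightarrow> c = c'"
  unfolding clusters_def using clusters_meet[OF E_qubits] by blast

text \<open>The choice is made from the set of all translates, which is the same for every translate
  of \<open>c\<close>; hence \<open>rep\<close> is constant on it.\<close>

definition rep :: "(real ^ 'd) set set \<Rightarrow> (real ^ 'd) set set" where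
  "rep c = (SOME c'. c' \<in> (\<lambda>a. shift a c) ` shifts \<L>)"

lemma rep_shift: "\<exists>a\<in>shifts \<L>. rep c = shift a c"
proof -
  have "\<exists>c'. c' \<in> (\<lambda>a. shift a c) ` shifts \<L>" using zero_shifts by blast
  then have "rep c \<in> (\<lambda>a. shift a c) ` shifts \<L>" unfolding rep_def by (rule someI_ex)
  then show ?thesis by blast
qed

lemma rep_of_shift: assumes "a \<in> shifts \<L>" shows "rep (shift a c) = rep c"
proof -
  have "(\<lambda>b. shift b (shift a c)) ` shifts \<L> = (\<lambda>b. shift b c) ` shifts \<L>"
  proof
    show "(\<lambda>b. shift b c) ` shifts \<L> \<subseteq> (\<lambda>b. shift b (shift a c)) ` shifts \<L>"
    proof
      fix x assume "x \<in> (\<lambda>b. shift b c) ` shifts \<L>"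
      then obtain b where "b \<in> shifts \<L>" "x = shift (b - a) (shift a c)" by (auto simp: shift_shift)
      then show "x \<in> (\<lambda>b. shift b (shift a c)) ` shifts \<L>" using diff_shifts assms by blast
    qed
  qed (use add_shifts assms in \<open>auto simp: shift_shift\<close>)
  then show ?thesis by (simp add: rep_def)
qed

lemma rep_rep: "rep (rep c) = rep c"
  using rep_shift[of c] rep_of_shift by metis

text \<open>This is a bound on the diameter and serves as the \<Delta> of
  \<open>clustered_error\<close>. The level of a cluster is unique, so the value does not depend on
  the choice.\<close>

definition radius :: "(real ^ 'd) set set \<Rightarrow> nat" where
  "radius c = 4 * Q ^ (SOME i. i < m \<and> level_cluster i E c)"

lemma radius:
  assumes "c \<in> clusters" obtains i where "i < m" "level_cluster i E c" "radius c = 4 * Q ^ i"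
proof -
  have "\<exists>i. i < m \<and> level_cluster i E c" using assms by (auto simp: clusters_def)
  from someI_ex[OF this] show thesis using that unfolding radius_def by blast
qed

lemma level_cluster_unique:
  assumes "level_cluster i E c" "level_cluster j E c" shows "i = j"
proof -
  have "\<not> i < j" if c: "level_cluster i E c" "level_cluster j E c" for i j
  proof
    assume "i < j"
    obtain \<kappa> where \<kappa>: "\<kappa> \<in> c" using level_cluster_nonempty[OF E_qubits c(1)] by blast
    have "\<kappa> \<in> level (Suc i) E"
      using level_cluster_subset[OF c(2)] level_antimono[of "Suc i" j E] \<open>i < j\<close> \<kappa> by auto
    then show False using level_Suc_disjoint[OF c(1)] \<kappa> by blast
  qed
  then show ?thesis using assms by (metis linorder_neqE_nat)
qed

lemma radius_shift:
  assumes "c \<in> clusters" "a \<in> shifts \<L>" shows "radius (shift a c) = radius c"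
proof -
  obtain i where i: "level_cluster i E c" "radius c = 4 * Q ^ i" using radius[OF assms(1)] by metis
  obtain j where j: "level_cluster j E (shift a c)" "radius (shift a c) = 4 * Q ^ j"
    using radius[OF clusters_shift[OF assms]] by metis
  then show ?thesis using i level_cluster_unique[OF j(1) shift_cluster[OF assms(2) i(1)]] by simp
qed

lemma orbit_eq_shift:
  assumes "orbit \<L> \<kappa> = orbit \<L> \<tau>" obtains a where "a \<in> shifts \<L>" "\<tau> = (+) a ` \<kappa>"
proof -
  have "\<tau> \<in> orbit \<L> \<tau>" unfolding orbit_def by (rule image_eqI[of _ _ 0]) auto
  then have "\<tau> \<in> orbit \<L> \<kappa>" using assms by simp
  then show thesis using that by (auto simp: orbit_def)
qed

lemma rep_cluster: "r \<in> rep ` clusters \<Longrightarrow> r \<in> clusters"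
  using rep_shift clusters_shift by (metis imageE)

lemma cluster_props: "c \<in> clusters \<Longrightarrow> c \<subseteq> qubits" "c \<in> clusters \<Longrightarrow> finite c" "c \<in> clusters \<Longrightarrow> c \<noteq> {}"
  unfolding clusters_def using cluster_cells by blast+

text \<open>Clusters that share a simplex coincide, so a representative is determined by the orbit
  of any one of its simplices, and the orbits are finite in number.\<close>

lemma finite_reps: "finite (rep ` clusters)"
proof -
  define o' where "o' r = orbit \<L> (SOME \<kappa>. \<kappa> \<in> r)" for r
  note r_clusters = rep_cluster
  have some: "(SOME \<kappa>. \<kappa> \<in> r) \<in> r" if "r \<in> clusters" for r
    using cluster_props(3)[OF that] by (simp add: some_in_eq)
  have "inj_on o' (rep ` clusters)"
  proof (rule inj_onI)
    fix r r' assume r: "r \<in> rep ` clusters" "r' \<in> rep ` clusters" "o' r = o' r'"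
    obtain a where a: "a \<in> shifts \<L>" "(SOME \<kappa>. \<kappa> \<in> r') = (+) a ` (SOME \<kappa>. \<kappa> \<in> r)"
      using orbit_eq_shift r(3) unfolding o'_def by metis
    have "(SOME \<kappa>. \<kappa> \<in> r') \<in> shift a r" unfolding a(2) using some r_clusters r(1) by (simp add: image_plus_mem)
    then have "shift a r = r'"
      using clusters_eq[OF clusters_shift[OF r_clusters[OF r(1)] a(1)] r_clusters[OF r(2)]] some r_clusters r(2) by blast
    then have "rep r = rep r'" using rep_of_shift[OF a(1)] by metis
    then show "r = r'" using r(1,2) rep_rep by auto
  qed
  moreover have "o' ` rep ` clusters \<subseteq> orbit \<L> ` cells \<L>"
  proof -
    have "(SOME \<kappa>. \<kappa> \<in> r) \<in> cells \<L>" if "r \<in> clusters" for r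
      using some[OF that] cluster_props(1)[OF that] by blast
    then show ?thesis using r_clusters unfolding o'_def by blast
  qed
  ultimately show ?thesis using finite_orbits by (meson finite_imageD finite_subset)
qed

text \<open>The clusters cover \<open>E\<close> and are collected up to translation. Different pairs
  of a shift and a representative give different, hence disjoint, clusters, so the sum of all
  translates is their union and equals \<open>E\<close>.\<close>

theorem low_level_error_corrected:
  assumes "level m E = {}"
  shows "\<not> decoder_fails \<L> k \<phi> Tm E"
proof -
  let ?R = "rep ` clusters"
  note RC = rep_cluster and props = cluster_props
  have ne: "shift a r \<noteq> shift b r'"
    if ab: "a \<in> shifts \<L>" "b \<in> shifts \<L>" "r \<in> ?R" "r' \<in> ?R" "(a, r) \<noteq> (b, r')" for a b r r'
  proof
    assume eq: "shift a r = shift b r'"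
    then have "rep r = rep r'" using rep_of_shift ab(1,2) by metis
    then have rr: "r = r'" using ab(3,4) rep_rep by auto
    have "shift (a - b) r = shift (- b) (shift a r)" by (simp add: shift_shift)
    also have "\<dots> = r" unfolding eq by (simp add: rr shift_shift)
    finally have "(+) (a - b) ` \<Union>r = \<Union>r" using Union_shift[of "a - b" r] by simp
    moreover have "finite (\<Union>r)" using props[OF RC[OF ab(3)]] cell_finite by blast
    moreover have "\<Union>r \<noteq> {}" using props[OF RC[OF ab(3)]] cell_nonempty by blast
    ultimately have "a - b = 0" by (rule plus_image_eq_self)
    then show False using ab(5) rr by simp
  qed
  have KQ: "2 * (c\<^sub>P * c\<^sub>D * real (4 * Q ^ i)) + 2 \<le> real ((Q - 3) * Q ^ i)" for i
  proof -
    have "1 \<le> real Q ^ i" using Q5 by simp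
    moreover have "8 * (c\<^sub>P * c\<^sub>D) * real Q ^ i \<le> (real Q - 5) * real Q ^ i"
      using Q_large by (intro mult_right_mono) auto
    moreover have "real ((Q - 3) * Q ^ i) = (real Q - 5) * real Q ^ i + 2 * real Q ^ i"
      using Q5 by (simp add: of_nat_diff algebra_simps)
    ultimately show ?thesis by (simp add: algebra_simps)
  qed
  have rad_le: "real (radius r) \<le> 4 * real Q ^ m" if "r \<in> clusters" for r
  proof -
    obtain i where "i < m" "radius r = 4 * Q ^ i" using radius[OF \<open>r \<in> clusters\<close>] by metis
    then show ?thesis using pow_le[of i] by simp
  qed
  interpret clustered_error \<L> k l c\<^sub>B c\<^sub>D c\<^sub>P \<phi> ?R radius Tm
  proof
    show "finite ?R" by (rule finite_reps)
    fix r assume r: "r \<in> ?R"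
    note rc = RC[OF r]
    show "finite r \<and> r \<noteq> {} \<and> r \<subseteq> {\<kappa> \<in> cells \<L>. card \<kappa> = k + 1}" using props[OF rc] by blast
    show "real (radius r) \<le> l * real (linear_size \<L>)"
      using rad_le[OF rc] scale_local(1) zero_le_power[of "real Q" m] by linarith
    have "c\<^sub>D * real (radius r) \<le> c\<^sub>D * (4 * real Q ^ m)" using rad_le[OF rc] pos by simp
    then show "c\<^sub>D * real (radius r) \<le> l * real (linear_size \<L>)" using scale_local(2) by simp
    have "c\<^sub>P * c\<^sub>D * real (radius r) \<le> c\<^sub>P * c\<^sub>D * (4 * real Q ^ m)" using rad_le[OF rc] pos by simp
    then show "c\<^sub>P * c\<^sub>D * real (radius r) + 2 \<le> Tm" using scale_time by simp
    fix u v assume "u \<in> \<Union>r" "v \<in> \<Union>r"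
    then obtain \<kappa> \<tau> where k: "\<kappa> \<in> r" "u \<in> \<kappa>" "\<tau> \<in> r" "v \<in> \<tau>" by blast
    obtain i where i: "level_cluster i E r" "radius r = 4 * Q ^ i" using radius[OF rc] by metis
    have "gdist \<L> u v \<le> cdist \<kappa> \<tau>" using k props(1)[OF rc] by (intro gdist_le_cdist) auto
    also have "\<dots> \<le> radius r" using level_cluster_diam[OF E_qubits i(1) k(1,3)] i(2) by simp
    finally show "gdist \<L> u v \<le> radius r" .
  next
    have "0 \<le> 4 * (c\<^sub>P * c\<^sub>D) * real Q ^ m" using pos by simp
    then show "2 \<le> Tm" using scale_time by linarith
  next
    fix a b r r' u v
    assume ab: "a \<in> shifts \<L>" "b \<in> shifts \<L>" "r \<in> ?R" "r' \<in> ?R" "(a, r) \<noteq> (b, r')"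
      and u: "u \<in> \<Union>(shift a r)" and v: "v \<in> \<Union>(shift b r')"
    let ?c = "shift a r" and ?c' = "shift b r'"
    have cc: "?c \<in> clusters" "?c' \<in> clusters" using clusters_shift RC ab by auto
    obtain i where i: "level_cluster i E ?c" "radius ?c = 4 * Q ^ i" using radius[OF cc(1)] by metis
    obtain j where j: "level_cluster j E ?c'" "radius ?c' = 4 * Q ^ j" using radius[OF cc(2)] by metis
    have rad: "radius r = 4 * Q ^ i" "radius r' = 4 * Q ^ j"
      using i(2) j(2) radius_shift RC ab by metis+
    obtain \<kappa> \<tau> where k: "\<kappa> \<in> ?c" "u \<in> \<kappa>" "\<tau> \<in> ?c'" "v \<in> \<tau>" using u v by blast
    have kc: "\<kappa> \<in> cells \<L>" "\<tau> \<in> cells \<L>" using k props(1)[OF cc(1)] props(1)[OF cc(2)] by auto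
    note ne' = ne[OF ab]
    \<comment> \<open>Separation is measured at the lower of the two levels, which also belongs to
      the smaller lifetime; so the minimum appears on both sides.\<close>
    have "(Q - 3) * Q ^ min i j < cdist \<kappa> \<tau>"
    proof (cases "i \<le> j")
      case True
      then show ?thesis using clusters_separated[OF E_qubits i(1) j(1) True ne' k(1,3)] by (simp add: min_def)
    next
      case False
      then have "(Q - 3) * Q ^ j < cdist \<tau> \<kappa>"
        using clusters_separated[OF E_qubits j(1) i(1) _ ne'[symmetric] k(3,1)] by simp
      then show ?thesis using False cdist_sym[OF kc] by (simp add: min_def)
    qed
    also have "\<dots> \<le> gdist \<L> u v + 2" using cdist_le_gdist[OF kc k(2,4)] .
    finally have "real ((Q - 3) * Q ^ min i j) < real (gdist \<L> u v) + 2" by linarith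
    then have g: "2 * (c\<^sub>P * c\<^sub>D * real (4 * Q ^ min i j)) < real (gdist \<L> u v)" using KQ[of "min i j"] by linarith
    have "min (radius r) (radius r') \<le> 4 * Q ^ min i j" unfolding rad by (simp add: min_def)
    then have "real (min (radius r) (radius r')) \<le> real (4 * Q ^ min i j)" by (simp only: of_nat_le_iff)
    then have "c\<^sub>P * c\<^sub>D * real (min (radius r) (radius r')) \<le> c\<^sub>P * c\<^sub>D * real (4 * Q ^ min i j)"
      using pos by (intro mult_left_mono) auto
    then show "2 * (c\<^sub>P * c\<^sub>D * real (min (radius r) (radius r'))) < real (gdist \<L> u v)" using g by linarith
  qed
  have "error = (\<Union>(a, r)\<in>shifts \<L> \<times> ?R. shift a r)"
    unfolding error_def periodic_def
  proof (rule msum_disjoint)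
    fix x y assume xy: "x \<in> shifts \<L> \<times> ?R" "y \<in> shifts \<L> \<times> ?R" "x \<noteq> y"
    obtain a r b r' where e: "x = (a, r)" "y = (b, r')" by (cases x; cases y) auto
    have "shift a r \<noteq> shift b r'" using ne[of a b r r'] xy e by auto
    moreover have "shift a r \<in> clusters" "shift b r' \<in> clusters" using clusters_shift RC xy e by auto
    ultimately have "shift a r \<inter> shift b r' = {}" using clusters_eq by blast
    then show "(case x of (a, r) \<Rightarrow> shift a r) \<inter> (case y of (a, r) \<Rightarrow> shift a r) = {}" by (simp add: e)
  qed
  also have "\<dots> = \<Union>clusters"
  proof
    show "(\<Union>(a, r)\<in>shifts \<L> \<times> ?R. shift a r) \<subseteq> \<Union>clusters"
    proof
      fix \<kappa> assume "\<kappa> \<in> (\<Union>(a, r)\<in>shifts \<L> \<times> ?R. shift a r)"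
      then obtain a r where "a \<in> shifts \<L>" "r \<in> ?R" "\<kappa> \<in> shift a r" by auto
      then show "\<kappa> \<in> \<Union>clusters" using clusters_shift[OF RC] by blast
    qed
    show "\<Union>clusters \<subseteq> (\<Union>(a, r)\<in>shifts \<L> \<times> ?R. shift a r)"
    proof
      fix \<kappa> assume "\<kappa> \<in> \<Union>clusters"
      then obtain c where c: "c \<in> clusters" "\<kappa> \<in> c" by blast
      obtain a where a: "a \<in> shifts \<L>" "rep c = shift a c" using rep_shift by blast
      then have "c = shift (- a) (rep c)" by (simp add: shift_shift)
      then have "\<kappa> \<in> shift (- a) (rep c)" using c(2) by simp
      then show "\<kappa> \<in> (\<Union>(a, r)\<in>shifts \<L> \<times> ?R. shift a r)"
        using uminus_shifts[OF a(1)] c(1) by (intro UN_I[of "(- a, rep c)"]) auto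
    qed
  qed
  also have "\<dots> = E"
  proof
    show "\<Union>clusters \<subseteq> E" using level_cluster_subset level_subset unfolding clusters_def by blast
    show "E \<subseteq> \<Union>clusters" using clusters_cover[OF assms] unfolding clusters_def by blast
  qed
  finally show ?thesis using decoder_succeeds by simp
qed

end

end

section \<open>The threshold\<close>

text \<open>With \<open>B = max_star d c * max 1 c\<close> and \<open>q = Q ^ d\<close> this is the
  \<open>B * q\<^sup>2\<close> of the tree count; the maximum ensures
  \<open>B \<ge> 1\<close>.\<close>

definition tree_rate :: "nat \<Rightarrow> real \<Rightarrow> nat \<Rightarrow> real" where
  "tree_rate d c Q = real (max_star d c) * max 1 c * (real Q ^ d)\<^sup>2"

lemma prob_Pi_pmf_bernoulli_all:
  assumes "finite S" "A \<subseteq> S" "0 \<le> p" "p \<le> 1"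
  shows "measure_pmf.prob (Pi_pmf S False (\<lambda>_. bernoulli_pmf p)) {e. \<forall>q\<in>A. e q} = p ^ card A"
proof -
  have "{e. \<forall>q\<in>A. e q} = Pi S (\<lambda>q. if q \<in> A then {True} else UNIV)"
    using assms(2) by (auto simp: Pi_def)
  then have "measure_pmf.prob (Pi_pmf S False (\<lambda>_. bernoulli_pmf p)) {e. \<forall>q\<in>A. e q} =
      (\<Prod>q\<in>S. measure_pmf.prob (bernoulli_pmf p) (if q \<in> A then {True} else UNIV))"
    using measure_Pi_pmf_Pi[OF assms(1)] by simp
  also have "\<dots> = (\<Prod>q\<in>S. if q \<in> A then p else 1)"
    using assms by (intro prod.cong) (auto simp: measure_pmf_single)
  also have "\<dots> = p ^ card A"
    using assms by (simp add: prod.If_cases Int_absorb1)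
  finally show ?thesis .
qed

context torus_triangulation
begin

section \<open>Orbits as simplices of the torus\<close>

lemma orbit_shift: assumes "a \<in> shifts \<L>" shows "orbit \<L> ((+) a ` \<kappa>) = orbit \<L> \<kappa>"
proof
  show "orbit \<L> ((+) a ` \<kappa>) \<subseteq> orbit \<L> \<kappa>"
  proof
    fix x assume "x \<in> orbit \<L> ((+) a ` \<kappa>)"
    then obtain b where "b \<in> shifts \<L>" "x = (+) (b + a) ` \<kappa>" by (auto simp: orbit_def image_image add.assoc)
    then show "x \<in> orbit \<L> \<kappa>" using add_shifts[OF _ assms] by (auto simp: orbit_def)
  qed
  show "orbit \<L> \<kappa> \<subseteq> orbit \<L> ((+) a ` \<kappa>)"
  proof
    fix x assume "x \<in> orbit \<L> \<kappa>"
    then obtain b where b: "b \<in> shifts \<L>" "x = (+) b ` \<kappa>" by (auto simp: orbit_def)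
    then have "x = (+) (b - a) ` (+) a ` \<kappa>" by (simp add: image_image)
    then show "x \<in> orbit \<L> ((+) a ` \<kappa>)" unfolding orbit_def using diff_shifts[OF b(1) assms] by blast
  qed
qed

lemma mem_orbit: "\<kappa> \<in> orbit \<L> \<kappa>"
  unfolding orbit_def by (rule image_eqI[of _ _ 0]) auto

lemma finite_simplices: "finite (simplices \<L> i)"
  unfolding simplices_def using finite_orbits by (rule finite_subset[rotated]) blast

lemma Union_simplices_chain: "S \<subseteq> simplices \<L> i \<Longrightarrow> \<Union>S \<in> chains \<L> i"
  unfolding chains_def by blast

end

context sweeping
begin

text \<open>The volume bound of the family counts vertices only. Every simplex has a translate that
  contains the chosen lift of one of its vertices, and the stars are bounded.\<close>

lemma card_simplices_le:
  assumes "4 \<le> l * real (linear_size \<L>)"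
  shows "card (simplices \<L> k) \<le> card (simplices \<L> 0) * max_star CARD('d) c\<^sub>B"
proof -
  define v where "v x = (SOME v. v \<in> verts \<L> \<and> orbit \<L> {v} = x)" for x
  have v: "v (orbit \<L> {u}) \<in> verts \<L>" "orbit \<L> {v (orbit \<L> {u})} = orbit \<L> {u}" if "u \<in> verts \<L>" for u
  proof -
    have "\<exists>w. w \<in> verts \<L> \<and> orbit \<L> {w} = orbit \<L> {u}" using that by blast
    from someI_ex[OF this] show "v (orbit \<L> {u}) \<in> verts \<L>" "orbit \<L> {v (orbit \<L> {u})} = orbit \<L> {u}"
      by (auto simp: v_def)
  qed
  have s0: "simplices \<L> 0 = (\<lambda>u. orbit \<L> {u}) ` verts \<L>"
    unfolding simplices_def verts_def by (auto simp: card_1_singleton_iff image_iff)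
  let ?st = "\<lambda>x. orbit \<L> ` {\<kappa> \<in> cells \<L>. v x \<in> \<kappa>}"
  have sub: "simplices \<L> k \<subseteq> (\<Union>x\<in>simplices \<L> 0. ?st x)"
  proof
    fix y assume "y \<in> simplices \<L> k"
    then obtain \<kappa> where \<kappa>: "\<kappa> \<in> cells \<L>" "y = orbit \<L> \<kappa>" by (auto simp: simplices_def)
    obtain u where u: "u \<in> \<kappa>" using cell_nonempty[OF \<kappa>(1)] by blast
    have uv: "u \<in> verts \<L>" using cell_vert \<kappa>(1) u by blast
    have "{v (orbit \<L> {u})} \<in> orbit \<L> {u}" using mem_orbit v(2)[OF uv] by metis
    then obtain a where a: "a \<in> shifts \<L>" "v (orbit \<L> {u}) = a + u" by (auto simp: orbit_def)
    have "y \<in> ?st (orbit \<L> {u})"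
      unfolding a(2) \<kappa>(2) using orbit_shift[OF a(1), of \<kappa>] cell_shift[OF \<kappa>(1) a(1)] u
      by (intro image_eqI[of _ _ "(+) a ` \<kappa>"]) auto
    then show "y \<in> (\<Union>x\<in>simplices \<L> 0. ?st x)" using s0 uv by blast
  qed
  have fin: "finite (?st x)" for x using finite_vertex_star by simp
  have "card (simplices \<L> k) \<le> (\<Sum>x\<in>simplices \<L> 0. card (?st x))"
    using card_mono[OF _ sub] card_UN_le[OF finite_simplices[of 0], of ?st] fin finite_simplices
    by (meson finite_UN_I order_trans)
  also have "\<dots> \<le> (\<Sum>x\<in>simplices \<L> 0. max_star CARD('d) c\<^sub>B)"
  proof (rule sum_mono)
    fix x assume "x \<in> simplices \<L> 0"
    then have "v x \<in> verts \<L>" using v(1) s0 by auto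
    then have "card {\<kappa> \<in> cells \<L>. v x \<in> \<kappa>} \<le> max_star CARD('d) c\<^sub>B" using card_vertex_star assms by blast
    then show "card (?st x) \<le> max_star CARD('d) c\<^sub>B" using card_image_le[OF finite_vertex_star] order_trans by blast
  qed
  finally show ?thesis by simp
qed

end

context scaled_sweeping
begin

lemma card_trees_le:
  assumes v: "v \<in> qubits"
  shows "finite (trees m v)" "real (card (trees m v)) \<le> tree_rate CARD('d) c\<^sub>B Q ^ (2 ^ m)"
proof -
  define B where "B = real (max_star CARD('d) c\<^sub>B) * max 1 c\<^sub>B"
  define q where "q = real Q ^ CARD('d)"
  have sb: "real (max_star CARD('d) c\<^sub>B) \<ge> 1" by (simp add: max_star_def)
  have "1 * 1 \<le> B" unfolding B_def using sb by (intro mult_mono) auto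
  then have B: "B \<ge> 1" by simp
  have q: "q \<ge> 1" unfolding q_def using Q5 by simp
  have balls: "finite {w \<in> qubits. cdist v w \<le> (Q - 1) * Q ^ i} \<and>
      real (card {w \<in> qubits. cdist v w \<le> (Q - 1) * Q ^ i}) \<le> B * q ^ (i + 1)"
    if v: "v \<in> qubits" and i: "i < m" for v i
  proof -
    let ?n = "(Q - 1) * Q ^ i"
    have vc: "v \<in> cells \<L>" using v by simp
    note ball = cell_ball[OF vc ball_radius(1)[OF i] ball_radius(3)[OF i]]
    have sub: "{w \<in> qubits. cdist v w \<le> ?n} \<subseteq> {w \<in> cells \<L>. cdist v w \<le> ?n}" by blast
    have "real (card {w \<in> qubits. cdist v w \<le> ?n}) \<le> real (card {w \<in> cells \<L>. cdist v w \<le> ?n})"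
      using card_mono[OF ball(1) sub] by simp
    also have "\<dots> \<le> real (max_star CARD('d) c\<^sub>B) * (c\<^sub>B * real (?n + 1) ^ CARD('d))" by (rule ball(2))
    also have "\<dots> \<le> real (max_star CARD('d) c\<^sub>B) * (max 1 c\<^sub>B * real (Q ^ (i + 1)) ^ CARD('d))"
    proof -
      have "real (?n + 1) \<le> real (Q ^ (i + 1))" using ball_radius(2)[OF i] by (simp only: of_nat_le_iff)
      then show ?thesis by (intro mult_left_mono mult_mono power_mono) auto
    qed
    also have "\<dots> = B * q ^ (i + 1)"
      unfolding B_def q_def by (simp add: power_mult[symmetric] mult.commute mult.assoc del: power_Suc)
    finally show ?thesis using finite_subset[OF sub ball(1)] by blast
  qed
  show "finite (trees m v)" by (rule card_trees(1)[OF B q balls v order_refl])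
  have "tree_rate CARD('d) c\<^sub>B Q = B * q\<^sup>2" by (simp add: tree_rate_def B_def q_def)
  then show "real (card (trees m v)) \<le> tree_rate CARD('d) c\<^sub>B Q ^ (2 ^ m)"
    using card_trees(2)[OF B q balls v order_refl] by simp
qed

text \<open>Independence holds for simplices of the torus. Two leaves of one orbit would be within
  \<open>2 * Q ^ m\<close>, whereas a nontrivial shift moves a vertex by at least the linear size;
  so \<open>2 ^ m\<close> leaves are \<open>2 ^ m\<close> different qubits.\<close>

lemma inj_on_orbit_tree:
  assumes v: "v \<in> qubits" and A: "A \<in> trees m v"
  shows "inj_on (orbit \<L>) A"
proof (rule inj_onI)
  fix \<kappa> \<tau> assume k: "\<kappa> \<in> A" "\<tau> \<in> A" "orbit \<L> \<kappa> = orbit \<L> \<tau>"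
  obtain a where a: "a \<in> shifts \<L>" "\<tau> = (+) a ` \<kappa>"
    using mem_orbit[of \<tau>] unfolding k(3)[symmetric] by (auto simp: orbit_def)
  have p: "A \<subseteq> qubits" "\<forall>x\<in>A. cdist v x \<le> Q ^ m" using trees_props[OF v A] by auto
  have c: "\<kappa> \<in> cells \<L>" "\<tau> \<in> cells \<L>" "v \<in> cells \<L>" using k p v by auto
  obtain u where u: "u \<in> \<kappa>" using cell_nonempty[OF c(1)] by blast
  have "gdist \<L> u (a + u) \<le> cdist \<kappa> \<tau>" using u by (intro gdist_le_cdist c) (auto simp: a(2))
  also have "\<dots> \<le> cdist v \<kappa> + cdist v \<tau>" using cdist_triangle[OF c(1,3,2)] cdist_sym[OF c(1,3)] by simp
  also have "\<dots> \<le> 2 * Q ^ m" using p(2) k(1,2) by (simp add: add_mono mult_2)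
  finally have g: "real (gdist \<L> u (a + u)) \<le> 2 * real Q ^ m" by (simp flip: of_nat_power of_nat_mult add: of_nat_le_iff)
  have "a = 0"
  proof (rule ccontr)
    assume "a \<noteq> 0"
    then have "real (linear_size \<L>) \<le> 2 * real Q ^ m"
      using linear_size_le_gdist[OF cell_vert[OF c(1) u] a(1)] g by simp
    moreover have "8 * real Q ^ m \<le> real (linear_size \<L>)"
      using scale_local(1) l1(2) mult_right_mono[of l 1 "real (linear_size \<L>)"] by simp
    moreover have "0 < real Q ^ m" using Q5 by simp
    ultimately show False by linarith
  qed
  then show "\<kappa> = \<tau>" using a(2) by simp
qed

text \<open>This is a union bound over the simplices of the torus and, for each, over the trees at
  one fixed lift. All leaves of a tree are in error with probability
  \<open>p ^ (2 ^ m)\<close>.\<close>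

theorem failure_prob_le:
  assumes p: "0 \<le> p" "p \<le> 1"
  shows "failure_prob \<L> k \<phi> Tm p \<le> real (card (simplices \<L> k)) * (tree_rate CARD('d) c\<^sub>B Q * p) ^ (2 ^ m)"
proof -
  define M where "M = Pi_pmf (simplices \<L> k) False (\<lambda>_. bernoulli_pmf p)"
  define r where "r x = (SOME \<kappa>. \<kappa> \<in> qubits \<and> orbit \<L> \<kappa> = x)" for x
  have r: "r x \<in> qubits" "orbit \<L> (r x) = x" if "x \<in> simplices \<L> k" for x
  proof -
    have "\<exists>\<kappa>. \<kappa> \<in> qubits \<and> orbit \<L> \<kappa> = x" using that by (auto simp: simplices_def)
    from someI_ex[OF this] show "r x \<in> qubits" "orbit \<L> (r x) = x" by (auto simp: r_def)
  qed
  define G where "G A = {e :: (real ^ 'd) set set \<Rightarrow> bool. \<forall>x\<in>orbit \<L> ` A. e x}" for A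
  have sub: "{e. decoder_fails \<L> k \<phi> Tm (\<Union>{q \<in> simplices \<L> k. e q})} \<subseteq>
      (\<Union>x\<in>simplices \<L> k. \<Union>A\<in>trees m (r x). G A)"
  proof
    fix e assume e: "e \<in> {e. decoder_fails \<L> k \<phi> Tm (\<Union>{q \<in> simplices \<L> k. e q})}"
    define E where "E = \<Union>{q \<in> simplices \<L> k. e q}"
    have E: "E \<in> chains \<L> k" unfolding E_def by (rule Union_simplices_chain) blast
    have "level m E \<noteq> {}" using low_level_error_corrected[OF E] e by (auto simp: E_def)
    then obtain \<kappa> where \<kappa>: "\<kappa> \<in> level m E" by blast
    have \<kappa>q: "\<kappa> \<in> qubits" using \<kappa> level_subset E_qubits[OF E] by blast
    define x where "x = orbit \<L> \<kappa>"
    have x: "x \<in> simplices \<L> k" using \<kappa>q by (auto simp: x_def simplices_def)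
    \<comment> \<open>The set of survivors is invariant under shifts, so the survivor \<kappa> may
      be replaced by the fixed lift of its orbit.\<close>
    have "r x \<in> orbit \<L> \<kappa>" using mem_orbit[of "r x"] r(2)[OF x] by (simp add: x_def)
    then obtain a where a: "a \<in> shifts \<L>" "r x = (+) a ` \<kappa>" by (auto simp: orbit_def)
    have "r x \<in> level m E"
      using shift_level[OF E a(1), of m] \<kappa> image_plus_mem[of a \<kappa> "level m E"] a(2) by simp
    then obtain A where A: "A \<in> trees m (r x)" "A \<subseteq> E" using level_tree[OF E_qubits[OF E]] by blast
    have "e (orbit \<L> \<tau>)" if "\<tau> \<in> A" for \<tau>
    proof -
      obtain y where y: "y \<in> simplices \<L> k" "e y" "\<tau> \<in> y" using \<open>\<tau> \<in> A\<close> A(2) by (auto simp: E_def)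
      then obtain \<mu> where "y = orbit \<L> \<mu>" by (auto simp: simplices_def)
      moreover from this obtain b where "b \<in> shifts \<L>" "\<tau> = (+) b ` \<mu>" using y(3) by (auto simp: orbit_def)
      ultimately show ?thesis using orbit_shift y(2) by simp
    qed
    then have "e \<in> G A" by (simp add: G_def)
    then show "e \<in> (\<Union>x\<in>simplices \<L> k. \<Union>A\<in>trees m (r x). G A)" using x A(1) by blast
  qed
  have G: "measure_pmf.prob M (G A) = p ^ (2 ^ m)" if x: "x \<in> simplices \<L> k" and A: "A \<in> trees m (r x)" for x A
  proof -
    have props: "A \<subseteq> qubits" "card A = 2 ^ m" using trees_props[OF r(1)[OF x] A] by auto
    have "orbit \<L> ` A \<subseteq> simplices \<L> k" using props(1) by (auto simp: simplices_def)
    then have "measure_pmf.prob M (G A) = p ^ card (orbit \<L> ` A)"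
      unfolding M_def G_def by (intro prob_Pi_pmf_bernoulli_all finite_simplices p)
    then show ?thesis using card_image[OF inj_on_orbit_tree[OF r(1)[OF x] A]] props(2) by simp
  qed
  have "failure_prob \<L> k \<phi> Tm p \<le> measure_pmf.prob M (\<Union>x\<in>simplices \<L> k. \<Union>A\<in>trees m (r x). G A)"
    unfolding failure_prob_def M_def[symmetric] using sub by (intro measure_pmf.finite_measure_mono) auto
  also have "\<dots> \<le> (\<Sum>x\<in>simplices \<L> k. measure_pmf.prob M (\<Union>A\<in>trees m (r x). G A))"
    by (intro measure_pmf.finite_measure_subadditive_finite finite_simplices) auto
  also have "\<dots> \<le> (\<Sum>x\<in>simplices \<L> k. (tree_rate CARD('d) c\<^sub>B Q * p) ^ (2 ^ m))"
  proof (rule sum_mono)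
    fix x assume x: "x \<in> simplices \<L> k"
    have "measure_pmf.prob M (\<Union>A\<in>trees m (r x). G A) \<le> (\<Sum>A\<in>trees m (r x). measure_pmf.prob M (G A))"
      using card_trees_le(1)[OF r(1)[OF x]] by (intro measure_pmf.finite_measure_subadditive_finite) auto
    also have "\<dots> = real (card (trees m (r x))) * p ^ (2 ^ m)" using G[OF x] by simp
    also have "\<dots> \<le> tree_rate CARD('d) c\<^sub>B Q ^ (2 ^ m) * p ^ (2 ^ m)"
      using card_trees_le(2)[OF r(1)[OF x]] p by (intro mult_right_mono) auto
    finally show "measure_pmf.prob M (\<Union>A\<in>trees m (r x). G A) \<le> (tree_rate CARD('d) c\<^sub>B Q * p) ^ (2 ^ m)"
      by (simp add: power_mult_distrib)
  qed
  finally show ?thesis by simp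
qed

end

section \<open>Asymptotics in the linear size\<close>

lemma T_max_ge:
  assumes "c\<^sub>D \<ge> 1" "c\<^sub>P \<ge> 1" "L > 0"
  shows "real L / (6 * c\<^sub>D) + 1 \<le> T_max c\<^sub>D c\<^sub>P L"
proof -
  define Q where "Q = 6 * c\<^sub>D * c\<^sub>P"
  define m where "m = \<lceil>log Q (real L / c\<^sub>D)\<rceil>"
  have "1 * 1 \<le> c\<^sub>D * c\<^sub>P" using assms by (intro mult_mono) auto
  then have Q: "Q > 1" by (simp add: Q_def)
  have pos: "real L / c\<^sub>D > 0" using assms by simp
  \<comment> \<open>The exponent \<open>m - 1\<close> costs a factor
    \<open>Q = 6 * c\<^sub>D * c\<^sub>P\<close>, of which the prefactor
    \<open>c\<^sub>D * c\<^sub>P\<close> restores all but the 6; rounding up only increases the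
    power.\<close>
  have "real L / c\<^sub>D / Q = Q powr (log Q (real L / c\<^sub>D) - 1)"
    using Q pos by (simp add: powr_diff)
  also have "\<dots> \<le> Q powr (real_of_int (m - 1))"
    using Q le_of_int_ceiling[of "log Q (real L / c\<^sub>D)"] by (intro powr_mono) (auto simp: m_def)
  also have "\<dots> = Q powi (m - 1)" using Q by (subst powr_real_of_int') auto
  finally have "c\<^sub>D * c\<^sub>P * (real L / c\<^sub>D / Q) \<le> c\<^sub>D * c\<^sub>P * Q powi (m - 1)"
    using assms by (intro mult_left_mono) auto
  moreover have "c\<^sub>D * c\<^sub>P * (real L / c\<^sub>D / Q) = real L / (6 * c\<^sub>D)"
    using assms by (simp add: Q_def field_simps)
  ultimately show ?thesis unfolding T_max_def Let_def Q_def[symmetric] m_def[symmetric] by simp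
qed

lemma poly_times_half_power_tendsto_0: "(\<lambda>y. real y ^ c * (1 / 2) ^ y) \<longlonglongrightarrow> 0"
proof -
  \<comment> \<open>The limit of \<open>y * x ^ y\<close> for \<open>x < 1\<close> is raised to the
    power \<open>c + 1\<close>. Taking \<open>c + 1\<close> instead of \<open>c\<close> includes
    \<open>c = 0\<close>.\<close>
  define x where "x = root (Suc c) (1 / 2)"
  have x: "0 \<le> x" "x ^ Suc c = 1 / 2"
    by (simp_all add: x_def real_root_pow_pos2 del: power_Suc)
  have "x < 1"
  proof (rule ccontr)
    assume "\<not> x < 1"
    then have "1 \<le> x ^ Suc c" by (intro one_le_power) simp
    then show False using x(2) by simp
  qed
  then have "norm x < 1" using x(1) by simp
  then have "(\<lambda>y. real y * x ^ y) \<longlonglongrightarrow> 0" by (rule powser_times_n_limit_0)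
  then have "(\<lambda>y. (real y * x ^ y) ^ Suc c) \<longlonglongrightarrow> 0 ^ Suc c" by (rule tendsto_power)
  moreover have "(real y * x ^ y) ^ Suc c = real y ^ Suc c * (1 / 2) ^ y" for y
  proof -
    have "(x ^ y) ^ Suc c = (x ^ Suc c) ^ y" by (simp only: power_mult[symmetric] mult.commute)
    then show ?thesis by (simp only: power_mult_distrib x(2))
  qed
  ultimately have lim: "(\<lambda>y. real y ^ Suc c * (1 / 2) ^ y) \<longlonglongrightarrow> 0"
    by (simp del: power_Suc)
  show ?thesis
  proof (rule tendsto_sandwich[OF _ _ tendsto_const lim])
    have "real y ^ c * (1 / 2) ^ y \<le> real y ^ Suc c * (1 / 2) ^ y" if "y \<ge> 1" for y
      using that by (intro mult_right_mono power_increasing) auto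
    then show "\<forall>\<^sub>F y in sequentially. real y ^ c * (1 / 2) ^ y \<le> real y ^ Suc c * (1 / 2) ^ y"
      using eventually_ge_at_top[of 1] by (rule eventually_mono[rotated])
  qed auto
qed

lemma scale_exists:
  fixes H L :: real
  assumes "0 < H" "H \<le> L" "Q > (1 :: nat)"
  obtains m where "H * real Q ^ m \<le> L" "L < H * real Q ^ Suc m"
proof -
  define N where "N = (LEAST N. L / H < real Q ^ N)"
  have "\<exists>N. L / H < real Q ^ N" using assms(3) by (intro real_arch_pow) simp
  then have N: "L / H < real Q ^ N" unfolding N_def by (rule LeastI_ex)
  have "N \<noteq> 0" using N assms by (intro notI) (simp add: field_simps)
  then obtain m where m: "N = Suc m" using not0_implies_Suc by blast
  then have "\<not> L / H < real Q ^ m" unfolding N_def by (metis lessI not_less_Least)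
  then show thesis using that[of m] N m assms(1) by (simp add: field_simps)
qed

text \<open>The threshold is \<open>1 / (2 * \<mu>)\<close> with \<mu> the tree rate, built from the
  dimension and the constants of causality; it is therefore fixed before the rule \<phi>. Below it
  the trees at one simplex contribute at most \<open>(1 / 2) ^ (2 ^ m)\<close>.\<close>

theorem theorem3:
  fixes \<L> :: "nat \<Rightarrow> 'd::finite torus_lattice"
    and k deg :: nat
    and l c\<^sub>B c\<^sub>D c\<^sub>P c\<^sub>V :: real
  assumes lattice: "\<And>n. valid_lattice (\<L> n)"
    and growing: "filterlim (\<lambda>n. linear_size (\<L> n)) at_top sequentially"
    and volume: "\<And>n. real (card (simplices (\<L> n) 0)) \<le> c\<^sub>V * real (linear_size (\<L> n)) ^ deg"
    and fraction: "0 < l" "l < 1"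
    and causal: "\<And>n. causal (\<L> n) k l c\<^sub>B c\<^sub>D c\<^sub>P"
    and type: "k \<in> {2..CARD('d) - 1}"
  shows "\<exists>p_th>0. \<forall>\<phi>. (\<forall>\<^sub>F n in sequentially. sweep_rule (\<L> n) k (\<phi> n)) \<longrightarrow>
    (\<forall>p\<in>{0..1}. p < p_th \<longrightarrow>
      (\<lambda>n. failure_prob (\<L> n) k (\<phi> n) (T_max c\<^sub>D c\<^sub>P (linear_size (\<L> n))) p) \<longlonglongrightarrow> 0)"
proof -
  define K where "K = c\<^sub>P * c\<^sub>D"
  \<comment> \<open>\<open>Q\<close> is made a power of 2 so that
    \<open>Q ^ m = (2 ^ m) ^ s\<close>, which bounds the linear size by a polynomial in the number
    \<open>2 ^ m\<close> of leaves; \<open>s \<ge> 3\<close> gives \<open>Q \<ge> 5\<close>.\<close>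
  obtain s :: nat where s: "8 * K + 5 < 2 ^ s" "s \<ge> 3"
  proof -
    obtain t :: nat where "8 * K + 5 < 2 ^ t" using real_arch_pow[of 2 "8 * K + 5"] by auto
    also have "(2::real) ^ t \<le> 2 ^ (t + 3)" by (intro power_increasing) auto
    finally show thesis by (intro that[of "t + 3"]) auto
  qed
  define Q :: nat where "Q = 2 ^ s"
  have "(2::nat) ^ 3 \<le> 2 ^ s" using s(2) by (intro power_increasing) auto
  then have Q5: "Q \<ge> 5" by (simp add: Q_def)
  define \<mu> where "\<mu> = tree_rate CARD('d) c\<^sub>B Q"
  have \<mu>: "\<mu> > 0" using Q5 by (simp add: \<mu>_def tree_rate_def max_star_def)
  \<comment> \<open>\<open>H\<close> is a ratio of linear size to \<open>Q ^ m\<close> that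
    suffices: the first summand for the two locality conditions, the second for the running time,
    where the 1 absorbs an additive constant through \<open>Q ^ m \<ge> 1\<close>. The absolute
    values are there because positivity of the constants is derived only later, for large
    lattices.\<close>
  define H where "H = (8 + 4 * \<bar>c\<^sub>D\<bar>) / l + 6 * \<bar>c\<^sub>D\<bar> * (4 * \<bar>K\<bar> + 1)"
  have H: "H > 0" using fraction by (auto simp: H_def intro!: add_pos_nonneg divide_pos_pos)
  define L where "L n = linear_size (\<L> n)" for n
  define S where "S = real (max_star CARD('d) c\<^sub>B)"
  have "(\<lambda>n. failure_prob (\<L> n) k (\<phi> n) (T_max c\<^sub>D c\<^sub>P (L n)) p) \<longlonglongrightarrow> 0"
    if rule: "\<forall>\<^sub>F n in sequentially. sweep_rule (\<L> n) k (\<phi> n)" and p: "p \<in> {0..1}" "p < 1 / (2 * \<mu>)" for \<phi> p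
  proof -
    \<comment> \<open>The number of levels is the largest that fits. For linear sizes below
      \<open>H\<close> it is arbitrary, which affects finitely many \<open>n\<close>.\<close>
    have "\<forall>n. \<exists>m. H \<le> real (L n) \<longrightarrow> H * real Q ^ m \<le> real (L n) \<and> real (L n) < H * real Q ^ Suc m"
      using scale_exists[OF H, of "real (L _)" Q] Q5 by fastforce
    from choice[OF this] obtain m
      where m: "\<And>n. H \<le> real (L n) \<Longrightarrow> H * real Q ^ m n \<le> real (L n)"
        "\<And>n. H \<le> real (L n) \<Longrightarrow> real (L n) < H * real Q ^ Suc (m n)" by blast
    have Lbig: "\<forall>\<^sub>F n in sequentially. c \<le> real (L n)" for c
    proof -
      have "filterlim (\<lambda>n. real (L n)) at_top sequentially"
        unfolding L_def by (rule filterlim_compose[OF filterlim_real_sequentially growing])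
      then show ?thesis by (simp add: filterlim_at_top)
    qed
    have m_top: "filterlim m at_top sequentially"
      unfolding filterlim_at_top
    proof
      fix N
      show "\<forall>\<^sub>F n in sequentially. N \<le> m n"
        using Lbig[of "H * real Q ^ N"] Lbig[of H]
      proof eventually_elim
        case (elim n)
        show "N \<le> m n"
        proof (rule ccontr)
          assume "\<not> N \<le> m n"
          then have "real Q ^ Suc (m n) \<le> real Q ^ N" using Q5 by (intro power_increasing) auto
          then have "H * real Q ^ Suc (m n) \<le> H * real Q ^ N" using H by simp
          then show False using m(2)[OF elim(2)] elim(1) by linarith
        qed
      qed
    qed
    \<comment> \<open>\<open>y n\<close> is the number of leaves of a tree; the failure probability
      will be bounded by a fixed power of \<open>y n\<close> times \<open>(1 / 2) ^ y n\<close>, up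
      to a constant.\<close>
    define y where "y n = (2::nat) ^ m n" for n
    have y_top: "filterlim y at_top sequentially"
    proof -
      have "filterlim (\<lambda>m. (2::nat) ^ m) at_top sequentially"
        by (rule filterlim_subseq) (simp add: strict_mono_def)
      then show ?thesis unfolding y_def using m_top by (rule filterlim_compose)
    qed
    have bound: "\<forall>\<^sub>F n in sequentially. failure_prob (\<L> n) k (\<phi> n) (T_max c\<^sub>D c\<^sub>P (L n)) p \<le>
        (\<bar>c\<^sub>V\<bar> * S * (H * real Q) ^ deg) * (real (y n) ^ (s * deg) * (1 / 2) ^ y n)"
      using rule Lbig[of H] Lbig[of "2 / l"] Lbig[of 1]
    proof eventually_elim
      case (elim n)
      have valid: "torus_triangulation (\<L> n)" using lattice by unfold_locales
      interpret sweeping "\<L> n" k l c\<^sub>B c\<^sub>D c\<^sub>P "\<phi> n"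
      proof (intro sweeping.intro valid sweeping_axioms.intro)
        show "2 \<le> l * real (linear_size (\<L> n))" using elim(3) fraction by (simp add: L_def field_simps)
      qed (use causal elim(1) type in auto)
      have K: "K > 0" "\<bar>K\<bar> = K" "\<bar>c\<^sub>D\<bar> = c\<^sub>D" using pos by (auto simp: K_def)
      have Qm: "real Q ^ m n \<ge> 1" using Q5 by simp
      have "(8 + 4 * c\<^sub>D) / l * real Q ^ m n \<le> H * real Q ^ m n"
        using Qm K pos by (intro mult_right_mono) (auto simp: H_def)
      then have "(8 + 4 * c\<^sub>D) / l * real Q ^ m n \<le> real (L n)" using m(1)[OF elim(2)] by linarith
      then have h1: "(8 + 4 * c\<^sub>D) * real Q ^ m n \<le> l * real (L n)"
        using fraction by (simp add: field_simps)
      have "6 * c\<^sub>D * (4 * K + 1) * real Q ^ m n \<le> H * real Q ^ m n"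
        using Qm K pos fraction by (intro mult_right_mono) (auto simp: H_def)
      then have "6 * c\<^sub>D * (4 * K + 1) * real Q ^ m n \<le> real (L n)" using m(1)[OF elim(2)] by linarith
      then have "(4 * K + 1) * real Q ^ m n \<le> real (L n) / (6 * c\<^sub>D)"
        using pos by (simp add: field_simps)
      then have "4 * K * real Q ^ m n + 2 \<le> real (L n) / (6 * c\<^sub>D) + 1"
        using Qm by (simp add: algebra_simps)
      also have "\<dots> \<le> T_max c\<^sub>D c\<^sub>P (L n)" using elim(4) by (intro T_max_ge constants_ge_1) simp
      finally have time: "4 * K * real Q ^ m n + 2 \<le> T_max c\<^sub>D c\<^sub>P (L n)" .
      have loc: "8 * real Q ^ m n \<le> l * real (L n)" "4 * c\<^sub>D * real Q ^ m n \<le> l * real (L n)"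
      proof -
        have "0 \<le> 4 * c\<^sub>D * real Q ^ m n" using pos by simp
        moreover have "8 * real Q ^ m n + 4 * c\<^sub>D * real Q ^ m n \<le> l * real (L n)"
          using h1 by (simp only: distrib_right)
        ultimately show "8 * real Q ^ m n \<le> l * real (L n)" "4 * c\<^sub>D * real Q ^ m n \<le> l * real (L n)"
          using Qm by linarith+
      qed
      interpret scaled_sweeping "\<L> n" k l c\<^sub>B c\<^sub>D c\<^sub>P "\<phi> n" Q "m n" "T_max c\<^sub>D c\<^sub>P (L n)"
      proof unfold_locales
        show "8 * (c\<^sub>P * c\<^sub>D) + 5 \<le> real Q" using s(1) by (simp add: Q_def K_def)
      qed (use Q5 fraction loc time in \<open>auto simp: L_def K_def\<close>)
      have "4 \<le> l * real (L n)" using loc(1) Qm by linarith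
      then have "card (simplices (\<L> n) k) \<le> card (simplices (\<L> n) 0) * max_star CARD('d) c\<^sub>B"
        using card_simplices_le by (simp add: L_def)
      then have "real (card (simplices (\<L> n) k)) \<le> real (card (simplices (\<L> n) 0)) * S"
        unfolding S_def by (simp flip: of_nat_mult)
      also have "\<dots> \<le> (\<bar>c\<^sub>V\<bar> * real (L n) ^ deg) * S"
      proof (intro mult_right_mono)
        show "real (card (simplices (\<L> n) 0)) \<le> \<bar>c\<^sub>V\<bar> * real (L n) ^ deg"
          using volume[of n] mult_right_mono[OF abs_ge_self[of c\<^sub>V], of "real (L n) ^ deg"] by (simp add: L_def)
      qed (simp add: S_def)
      also have "\<dots> \<le> (\<bar>c\<^sub>V\<bar> * (H * real Q * real (y n) ^ s) ^ deg) * S"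
      proof -
        have "real Q ^ m n = real (y n) ^ s"
          by (simp add: Q_def y_def power_mult[symmetric] mult.commute)
        then have "real (L n) \<le> H * real Q * real (y n) ^ s" using m(2)[OF elim(2)] by (simp add: mult_ac)
        then show ?thesis by (intro mult_right_mono mult_left_mono power_mono) (auto simp: S_def)
      qed
      finally have card: "real (card (simplices (\<L> n) k)) \<le> \<bar>c\<^sub>V\<bar> * (H * real Q * real (y n) ^ s) ^ deg * S" .
      have "failure_prob (\<L> n) k (\<phi> n) (T_max c\<^sub>D c\<^sub>P (L n)) p \<le>
          real (card (simplices (\<L> n) k)) * (\<mu> * p) ^ y n"
        unfolding \<mu>_def y_def using p by (intro failure_prob_le) auto
      also have "\<dots> \<le> (\<bar>c\<^sub>V\<bar> * (H * real Q * real (y n) ^ s) ^ deg * S) * (1 / 2) ^ y n"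
      proof (intro mult_mono card power_mono)
        show "\<mu> * p \<le> 1 / 2" using p(2) \<mu> by (simp add: field_simps)
        show "0 \<le> \<bar>c\<^sub>V\<bar> * (H * real Q * real (y n) ^ s) ^ deg * S" using H by (simp add: S_def)
      qed (use \<mu> p in auto)
      also have "\<dots> = (\<bar>c\<^sub>V\<bar> * S * (H * real Q) ^ deg) * (real (y n) ^ (s * deg) * (1 / 2) ^ y n)"
        by (simp add: power_mult_distrib power_mult[symmetric] mult_ac)
      finally show ?case .
    qed
    have "(\<lambda>n. (\<bar>c\<^sub>V\<bar> * S * (H * real Q) ^ deg) * (real (y n) ^ (s * deg) * (1 / 2) ^ y n)) \<longlonglongrightarrow>
        (\<bar>c\<^sub>V\<bar> * S * (H * real Q) ^ deg) * 0"
      by (intro tendsto_mult tendsto_const filterlim_compose[OF poly_times_half_power_tendsto_0 y_top])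
    then show ?thesis
      by (intro tendsto_sandwich[OF _ bound tendsto_const]) (auto simp: failure_prob_def)
  qed
  then show ?thesis using \<mu> unfolding L_def by (intro exI[of _ "1 / (2 * \<mu>)"]) auto
qed

end
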